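(* Let $p$ be an odd prime. There exists a unique isomorphism of groups $$\mathscr{U}_\infty\to\bigl(\mathbf{Z}_p[[T]]^\times\bigr)^{\mathcal{N}=\mathrm{id}},\qquad u\mapsto f_u,$$ such that $f_u(\pi_n)=u_n$ for all $u=(u_n)_{n}\in\mathscr{U}_\infty$ and all $n\ge1$.
   Context: For $n\geq1$ let $K_n=\mathbf{Q}_p(\mu_{p^n})$ and $\mathscr{U}_n=\mathcal{O}_{K_n}^\times$; let $\mathscr{U}_\infty=\varprojlim_n\mathscr{U}_n$, the limit being taken with respect to the norm maps $N_{n+1,n}:K_{n+1}^\times\to K_{n}^\times$. Fix primitive $p^n$th roots of unity $\xi_{p^n}$ with $\xi_{p^{n+1}}^p=\xi_{p^n}$, and let $\pi_n=\xi_{p^n}-1$, a uniformiser of $K_n$. Let $\varphi$ be the injective ring endomorphism $\varphi(f)(T)=f((1+T)^p-1)$ of $\mathbf{Z}_p[[T]]$. The norm operator $\mathcal{N}$ is the unique multiplicative operator on $\mathbf{Z}_p[[T]]$ with $(\varphi\circ\mathcal{N})(f)(T)=\prod_{\eta\in\mu_p}f(\eta(1+T)-1)$. The superscript $\mathcal{N}=\mathrm{id}$ denotes the subgroup of elements $f$ with $\mathcal{N}(f)=f$. *)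

theory Defs
  imports
    "HOL-Algebra.Algebraic_Closure_Type"
    "HOL-Algebra.Generated_Fields"
    "HOL-Library.FuncSet"
    "HOL-Computational_Algebra.Computational_Algebra"
    "Berlekamp_Zassenhaus.Finite_Field"
begin

unbundle fps_syntax

text \<open>
  Throughout, the prime \<open>p\<close> is the cardinality of a type \<open>'p\<close> of class \<^class>\<open>prime_card\<close>.
  The ring of \<open>p\<close>-adic integers is the inverse limit of the rings of integers modulo \<open>p ^ n\<close>; the
  \<open>n\<close>-th component is represented by its residue in \<open>{0..<p ^ n}\<close>.
\<close>

typedef 'p padic_int =
  "{x :: nat \<Rightarrow> int. \<forall>n. x n \<in> {0..<int CARD('p::prime_card) ^ n} \<and>
                       x (Suc n) mod int CARD('p) ^ n = x n}"
  morphisms padic_res Abs_padic_int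
proof -
  have "int CARD('p) > 0"
    using prime_card_int[where 'a = 'p] prime_gt_0_int by blast
  then show ?thesis
    by (intro exI[of _ "\<lambda>_. 0"]) auto
qed

setup_lifting type_definition_padic_int

lemma prime_card_int_pos [simp]: "int CARD('p::prime_card) > 0"
  using prime_card_int[where 'a = 'p] prime_gt_0_int by blast

lemma padic_compatible_mod:
  fixes p a b :: int
  assumes "a mod p ^ n = b mod p ^ n"
  shows "(a mod p ^ Suc n) mod p ^ n = b mod p ^ n"
  using assms by (simp add: mod_mod_cancel)

instantiation padic_int :: (prime_card) comm_ring_1
begin

lift_definition zero_padic_int :: "'a padic_int" is "\<lambda>_. 0"
  using prime_card_int_pos[where 'p = 'a] by auto

lift_definition one_padic_int :: "'a padic_int" is "\<lambda>n. 1 mod int CARD('a) ^ n"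
  by (auto intro!: padic_compatible_mod simp del: power_Suc)

lift_definition plus_padic_int :: "'a padic_int \<Rightarrow> 'a padic_int \<Rightarrow> 'a padic_int"
  is "\<lambda>x y n. (x n + y n) mod int CARD('a) ^ n"
  by (auto intro!: padic_compatible_mod simp del: power_Suc) (metis mod_add_eq mod_mod_trivial)

lift_definition times_padic_int :: "'a padic_int \<Rightarrow> 'a padic_int \<Rightarrow> 'a padic_int"
  is "\<lambda>x y n. (x n * y n) mod int CARD('a) ^ n"
  by (auto intro!: padic_compatible_mod simp del: power_Suc) (metis mod_mult_eq mod_mod_trivial)

lift_definition uminus_padic_int :: "'a padic_int \<Rightarrow> 'a padic_int"
  is "\<lambda>x n. (- x n) mod int CARD('a) ^ n"
  by (auto intro!: padic_compatible_mod simp del: power_Suc) (metis mod_minus_eq mod_mod_trivial)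

lift_definition minus_padic_int :: "'a padic_int \<Rightarrow> 'a padic_int \<Rightarrow> 'a padic_int"
  is "\<lambda>x y n. (x n - y n) mod int CARD('a) ^ n"
  by (auto intro!: padic_compatible_mod simp del: power_Suc) (metis mod_diff_eq mod_mod_trivial)

instance
proof
  fix a b c :: "'a padic_int"
  show "a * b * c = a * (b * c)"
    by transfer (simp add: mod_mult_left_eq mod_mult_right_eq mult.assoc)
  show "a * b = b * a"
    by transfer (simp add: mult.commute)
  show "1 * a = a"
    by transfer (auto simp: mod_mult_left_eq mod_pos_pos_trivial)
  show "a + b + c = a + (b + c)"
    by transfer (simp add: mod_add_left_eq mod_add_right_eq add.assoc)
  show "a + b = b + a"
    by transfer (simp add: add.commute)
  show "0 + a = a"
    by transfer (auto simp: mod_pos_pos_trivial)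
  show "- a + a = 0"
    by transfer (simp add: mod_add_left_eq)
  show "a - b = a + - b"
    by transfer (simp add: mod_add_right_eq)
  show "(a + b) * c = a * c + b * c"
    by transfer (simp add: mod_mult_left_eq mod_add_eq distrib_right)
  have "1 mod int CARD('a) ^ 1 \<noteq> 0"
    using prime_card_int[where 'a = 'a] prime_gt_1_int[of "int CARD('a)"] by simp
  then show "(0 :: 'a padic_int) \<noteq> 1"
    by transfer metis
qed

end

lemma padic_res_mod:
  fixes x :: "'p::prime_card padic_int"
  assumes "m \<le> n"
  shows "padic_res x n mod int CARD('p) ^ m = padic_res x m"
  using assms
proof (induction n rule: dec_induct)
  case base
  then show ?case
    using padic_res[of x] by (auto simp: mod_pos_pos_trivial)
next
  case (step n)
  have "padic_res x (Suc n) mod int CARD('p) ^ n = padic_res x n"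
    using padic_res[of x] by auto
  then have "padic_res x n mod int CARD('p) ^ m
      = padic_res x (Suc n) mod int CARD('p) ^ n mod int CARD('p) ^ m"
    by simp
  also have "\<dots> = padic_res x (Suc n) mod int CARD('p) ^ m"
    using step by (intro mod_mod_cancel le_imp_power_dvd) auto
  finally show ?case
    using step by simp
qed

instance padic_int :: (prime_card) idom
proof
  fix x y :: "'a padic_int"
  let ?p = "int CARD('a)"
  have p: "prime ?p"
    by (rule prime_card_int)
  have nz: "\<exists>a. \<forall>n\<ge>a. \<not> ?p ^ a dvd padic_res z n" if "z \<noteq> 0" for z :: "'a padic_int"
  proof -
    from that obtain a where "padic_res z a \<noteq> 0"
      by (metis padic_res_inject zero_padic_int.rep_eq ext)
    then show ?thesis
      using padic_res_mod[of a _ z] by (metis mod_0_imp_dvd dvd_imp_mod_0)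
  qed
  assume "x \<noteq> 0" "y \<noteq> 0"
  then obtain a b where a: "\<forall>n\<ge>a. \<not> ?p ^ a dvd padic_res x n"
    and b: "\<forall>n\<ge>b. \<not> ?p ^ b dvd padic_res y n"
    using nz by meson
  define u v where "u = padic_res x (a + b)" and "v = padic_res y (a + b)"
  have uv: "\<not> ?p ^ a dvd u" "\<not> ?p ^ b dvd v"
    using a b by (auto simp: u_def v_def)
  then have "u \<noteq> 0" "v \<noteq> 0"
    by auto
  moreover have "multiplicity ?p u < a" "multiplicity ?p v < b"
    using uv by (meson multiplicity_dvd' not_le)+
  ultimately have "multiplicity ?p (u * v) < a + b"
    using p by (simp add: prime_elem_multiplicity_mult_distrib)
  then have "\<not> ?p ^ (a + b) dvd u * v"
    using p \<open>u \<noteq> 0\<close> \<open>v \<noteq> 0\<close> by (subst power_dvd_iff_le_multiplicity) auto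
  then have "padic_res (x * y) (a + b) \<noteq> 0"
    by (simp add: times_padic_int.rep_eq u_def v_def mod_eq_0_iff_dvd)
  then show "x * y \<noteq> 0"
    by (metis zero_padic_int.rep_eq)
qed

type_synonym 'p padic = "'p padic_int fract"

text \<open>All the fields \<open>K\<^sub>n\<close> live inside one algebraic closure of the \<open>p\<close>-adic numbers.\<close>

type_synonym 'p padic_closure = "'p padic alg_closure"

definition of_padic_int :: "'p::prime_card padic_int \<Rightarrow> 'p padic_closure" where
  "of_padic_int x = to_ac (to_fract x)"

definition padic_integral :: "'p::prime_card padic_closure \<Rightarrow> bool" where
  "padic_integral x \<longleftrightarrow> (\<exists>q. lead_coeff q = 1 \<and> poly (map_poly of_padic_int q) x = 0)"

text \<open>
  Convergence for the \<open>p\<close>-adic topology of the algebraic closure. The elements integral over the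
  \<open>p\<close>-adic integers are those of absolute value at most 1, so their multiples by the powers
  of \<open>p\<close> form a neighbourhood basis of 0.
\<close>

definition padic_tendsto ::
    "(nat \<Rightarrow> 'p::prime_card padic_closure) \<Rightarrow> 'p padic_closure \<Rightarrow> bool" where
  "padic_tendsto s y \<longleftrightarrow>
     (\<forall>m. \<forall>\<^sub>F n in sequentially. padic_integral ((s n - y) / of_nat CARD('p) ^ m))"

definition padic_sums ::
    "(nat \<Rightarrow> 'p::prime_card padic_closure) \<Rightarrow> 'p padic_closure \<Rightarrow> bool" where
  "padic_sums a y \<longleftrightarrow> padic_tendsto (\<lambda>n. \<Sum>k<n. a k) y"

definition padic_suminf :: "(nat \<Rightarrow> 'p::prime_card padic_closure) \<Rightarrow> 'p padic_closure" where
  "padic_suminf a = (THE y. padic_sums a y)"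

text \<open>\<open>fps_evaluates f x y\<close>: the series \<open>f(x)\<close> converges, with value \<open>y\<close>.\<close>

definition fps_evaluates ::
    "'p::prime_card padic_int fps \<Rightarrow> 'p padic_closure \<Rightarrow> 'p padic_closure \<Rightarrow> bool" where
  "fps_evaluates f x y \<longleftrightarrow> padic_sums (\<lambda>k. of_padic_int (f $ k) * x ^ k) y"

definition primitive_root_of_unity :: "nat \<Rightarrow> 'a::field \<Rightarrow> bool" where
  "primitive_root_of_unity n x \<longleftrightarrow> n > 0 \<and> x ^ n = 1 \<and> (\<forall>k. 0 < k \<and> k < n \<longrightarrow> x ^ k \<noteq> 1)"

definition cyclo_field :: "nat \<Rightarrow> 'p::prime_card padic_closure set" where
  "cyclo_field n =
     generate_field ring_of_type_algebra (range to_ac \<union> {x. x ^ (CARD('p) ^ n) = 1})"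

definition cyclo_units :: "nat \<Rightarrow> 'p::prime_card padic_closure set" where
  "cyclo_units n = {x \<in> cyclo_field n. x \<noteq> 0 \<and> padic_integral x \<and> padic_integral (inverse x)}"

text \<open>
  The norm of a finite separable extension \<open>L / K\<close> of subfields of an algebraically closed field
  is the product over all \<open>K\<close>-embeddings of \<open>L\<close>; extensionality makes each embedding count once.
\<close>

definition field_embeddings :: "'a::field set \<Rightarrow> 'a set \<Rightarrow> ('a \<Rightarrow> 'a) set" where
  "field_embeddings K L =
     {\<sigma> \<in> extensional L.
        \<sigma> \<in> Ring.ring_hom (ring_of_type_algebra\<lparr>carrier := L\<rparr>) ring_of_type_algebra \<and>
        (\<forall>x\<in>K. \<sigma> x = x)}"

definition field_norm :: "'a::field set \<Rightarrow> 'a set \<Rightarrow> 'a \<Rightarrow> 'a" where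
  "field_norm K L x = (\<Prod>\<sigma>\<in>field_embeddings K L. \<sigma> x)"

text \<open>Norm-compatible sequences are indexed by \<open>n \<ge> 1\<close>.\<close>

definition norm_compatible_units :: "(nat \<Rightarrow> 'p::prime_card padic_closure) monoid" where
  "norm_compatible_units =
     \<lparr>carrier = {u \<in> (\<Pi>\<^sub>E n\<in>{1..}. cyclo_units n).
                   \<forall>n\<ge>1. field_norm (cyclo_field n) (cyclo_field (Suc n)) (u (Suc n)) = u n},
      monoid.mult = (\<lambda>u v. \<lambda>n\<in>{1..}. u n * v n),
      one = (\<lambda>n\<in>{1..}. 1)\<rparr>"

definition padic_phi :: "'p::prime_card padic_int fps \<Rightarrow> 'p padic_int fps" where
  "padic_phi f = f oo ((1 + fps_X) ^ CARD('p) - 1)"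

text \<open>
  Substitution of \<open>g\<close> in \<open>f\<close> where \<open>g\<close> may have a nonzero constant coefficient, so that the
  coefficients of the result are infinite sums and \<^const>\<open>fps_compose\<close> does not apply.
\<close>

definition padic_fps_compose ::
    "'p::prime_card padic_closure fps \<Rightarrow> 'p padic_closure fps \<Rightarrow> 'p padic_closure fps" where
  "padic_fps_compose f g = Abs_fps (\<lambda>j. padic_suminf (\<lambda>k. f $ k * (g ^ k) $ j))"

definition fps_of_padic_int :: "'p::prime_card padic_int fps \<Rightarrow> 'p padic_closure fps" where
  "fps_of_padic_int f = Abs_fps (\<lambda>k. of_padic_int (f $ k))"

definition norm_operator :: "'p::prime_card padic_int fps \<Rightarrow> 'p padic_int fps" where
  "norm_operator =
     (THE N. (\<forall>f g. N (f * g) = N f * N g) \<and>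
             (\<forall>f. fps_of_padic_int (padic_phi (N f)) =
                  (\<Prod>\<eta> | \<eta> ^ CARD('p) = 1.
                     padic_fps_compose (fps_of_padic_int f)
                       (fps_const \<eta> * (1 + fps_X) - 1))))"

definition norm_fixed_units :: "'p::prime_card padic_int fps monoid" where
  "norm_fixed_units =
     \<lparr>carrier = {f. f dvd 1 \<and> norm_operator f = f}, monoid.mult = (*), one = 1\<rparr>"

end

theory Submission
  imports Defs "Jordan_Normal_Form.Char_Poly" "HOL-Library.Diagonal_Subsequence"
    "HOL-Library.Nat_Bijection" "HOL-Number_Theory.Residues"
begin

text \<open>
  The norm \<open>N\<close> of \<open>\<int>\<^sub>p[[T]]\<close> over \<open>\<phi>(\<int>\<^sub>p[[T]])\<close> is a determinant whose eigenvectors are powers of \<open>\<eta> (1 + T) - 1\<close>;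
  evaluating the same matrix at \<open>T = \<pi>\<^sub>n\<^sub>+\<^sub>1\<close> shows that \<open>(N f)(\<pi>\<^sub>n)\<close> is the field norm of \<open>f(\<pi>\<^sub>n\<^sub>+\<^sub>1)\<close>.
  A nonzero series cannot vanish at all \<open>\<pi>\<^sub>n\<close>, because \<open>p\<close> is a unit times \<open>\<pi>\<^sub>n ^ d\<close> with \<open>d\<close> unbounded in \<open>n\<close>;
  this gives uniqueness, and makes an interpolating series \<open>N\<close>-invariant. For existence, choose
  \<open>f\<^sub>n\<close> with \<open>f\<^sub>n(\<pi>\<^sub>n) = u\<^sub>n\<close>. On units, \<open>N\<close> is the identity modulo \<open>p\<close> and maps \<open>1 + p ^ k \<int>\<^sub>p[[T]]\<close> into
  \<open>1 + p ^ (k + 1) \<int>\<^sub>p[[T]]\<close> for \<open>k \<ge> 1\<close>, so the \<open>m\<close>-fold norm of \<open>f\<^sub>2\<^sub>m\<close> takes a value congruent to \<open>u\<^sub>n\<close> modulo \<open>p ^ (m + 1)\<close>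
  at each \<open>\<pi>\<^sub>n\<close> with \<open>n \<le> m\<close>. A limit point of these norms is the required series.
\<close>

section \<open>The ring of \<open>p\<close>-adic integers\<close>

text \<open>No valuation is ever constructed on the algebraic closure, and the closure is not
  complete. Statements on valuations are therefore phrased through integrality over Z_p and
  divisibility by powers of p, and limits are taken only in the rings \<open>cyclo_ints n\<close>,
  which are complete because they are finitely generated over Z_p by powers of a uniformizer. Series
  are evaluated at points that are themselves power series over the closure; one evaluation
  homomorphism then covers both the substitution of \<eta>(1+T)-1 in the norm operator and the
  values at \<pi>_n. The determinant is what makes the product over \<eta> descend: it has
  coefficients in Z_p by construction, and a Vandermonde matrix of eigenvectors identifies its image
  under phi with the product. In the existence step the index \<open>2 m\<close> guarantees that at
  least \<open>m\<close> norms are taken on the way down to any level up to \<open>m\<close>, so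
  that one approximation serves all these levels at once.\<close>

abbreviation padic_p :: "'p::prime_card padic_int" where
  "padic_p \<equiv> of_nat CARD('p)"

lemma prime_CARD: "prime CARD('p::prime_card)"
  using prime_card_int[where 'a='p] by simp

lemma CARD_gt_1: "CARD('p::prime_card) > 1"
  using prime_CARD prime_gt_1_nat by blast

lemma padic_res_bounds: "0 \<le> padic_res x n" "padic_res (x :: 'p::prime_card padic_int) n < int CARD('p) ^ n"
  using padic_res[of x] by auto

lemma padic_res_mod_self [simp]:
  "padic_res (x :: 'p::prime_card padic_int) n mod int CARD('p) ^ n = padic_res x n"
  by (rule padic_res_mod) simp

lemma padic_res_of_nat:
  "padic_res (of_nat k :: 'p::prime_card padic_int) n = int k mod int CARD('p) ^ n"
  by (induction k) (simp_all add: zero_padic_int.rep_eq plus_padic_int.rep_eq one_padic_int.rep_eq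
      mod_add_eq add.commute)

lemma padic_eqI: "(\<And>n. padic_res x n = padic_res y n) \<Longrightarrow> x = y"
  by (meson padic_res_inject ext)

text \<open>Division by p^k shifts the residue sequence by \<open>k\<close> places: the residue of
  the quotient modulo p^n is obtained from that of \<open>a\<close> modulo p^(n+k).\<close>

lemma padic_p_power_dvd_iff:
  fixes a :: "'p::prime_card padic_int"
  shows "padic_p ^ k dvd a \<longleftrightarrow> padic_res a k = 0"
proof
  let ?p = "int CARD('p)"
  assume "padic_p ^ k dvd a"
  then obtain b where "a = of_nat (CARD('p) ^ k) * b"
    by auto
  then show "padic_res a k = 0"
    by (simp only: times_padic_int.rep_eq padic_res_of_nat) simp
next
  let ?p = "int CARD('p)"
  assume 0: "padic_res a k = 0"
  have dvd: "?p ^ k dvd padic_res a (n + k)" for n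
    using padic_res_mod[of k "n + k" a] 0 by auto
  define b where "b n = padic_res a (n + k) div ?p ^ k" for n
  have eq: "padic_res a (n + k) = ?p ^ k * b n" for n
    using dvd[of n] by (simp add: b_def)
  have "b n \<in> {0..<?p ^ n} \<and> b (Suc n) mod ?p ^ n = b n" for n
  proof
    have "0 \<le> ?p ^ k * b n" "?p ^ k * b n < ?p ^ k * ?p ^ n"
      using padic_res_bounds[of a "n + k"] unfolding eq by (auto simp: power_add mult.commute)
    moreover have "?p ^ k > 0"
      by simp
    ultimately show "b n \<in> {0..<?p ^ n}"
      by (auto simp: zero_le_mult_iff simp del: zero_less_power_eq)
    have "?p ^ k * b (Suc n) mod (?p ^ k * ?p ^ n) = ?p ^ k * b n"
      using padic_res_mod[of "n + k" "Suc n + k" a] unfolding eq by (simp add: power_add mult.commute)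
    then show "b (Suc n) mod ?p ^ n = b n"
      by (simp add: mod_mult_mult1)
  qed
  then have b: "padic_res (Abs_padic_int b :: 'p padic_int) = b"
    by (intro Abs_padic_int_inverse) auto
  have "a = of_nat (CARD('p) ^ k) * Abs_padic_int b"
  proof (rule padic_eqI)
    fix n
    have "padic_res (of_nat (CARD('p) ^ k) * (Abs_padic_int b :: 'p padic_int)) n = (?p ^ k mod ?p ^ n * b n) mod ?p ^ n"
      by (simp only: times_padic_int.rep_eq padic_res_of_nat b) simp
    also have "\<dots> = padic_res a (n + k) mod ?p ^ n"
      unfolding eq by (simp add: mod_mult_left_eq)
    also have "\<dots> = padic_res a n"
      by (rule padic_res_mod) simp
    finally show "padic_res a n = padic_res (of_nat (CARD('p) ^ k) * (Abs_padic_int b :: 'p padic_int)) n" ..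
  qed
  then show "padic_p ^ k dvd a"
    by simp
qed

lemma padic_res_eq_iff:
  fixes a b :: "'p::prime_card padic_int"
  shows "padic_res a k = padic_res b k \<longleftrightarrow> padic_p ^ k dvd a - b"
proof -
  have "padic_res (a - b) k = 0 \<longleftrightarrow> padic_res a k mod int CARD('p) ^ k = padic_res b k mod int CARD('p) ^ k"
    unfolding minus_padic_int.rep_eq by (simp only: mod_eq_0_iff_dvd mod_eq_dvd_iff)
  then show ?thesis
    by (simp add: padic_p_power_dvd_iff)
qed

lemma padic_eq_0I:
  fixes a :: "'p::prime_card padic_int"
  assumes "\<And>n. padic_p ^ n dvd a"
  shows "a = 0"
  using assms by (intro padic_eqI) (simp add: padic_p_power_dvd_iff zero_padic_int.rep_eq)

text \<open>The diagonal of residues, the n-th residue of the n-th term, is itself a compatible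
  sequence.\<close>

lemma padic_complete:
  fixes S :: "nat \<Rightarrow> 'p::prime_card padic_int"
  assumes "\<And>n. padic_p ^ n dvd S (Suc n) - S n"
  shows "\<exists>s. \<forall>n. padic_p ^ n dvd s - S n"
proof -
  define r where "r n = padic_res (S n) n" for n
  have "padic_res (S (Suc n)) n = padic_res (S n) n" for n
    using assms[of n] by (simp add: padic_res_eq_iff)
  then have "r n \<in> {0..<int CARD('p) ^ n} \<and> r (Suc n) mod int CARD('p) ^ n = r n" for n
    using padic_res_bounds[of "S n" n] padic_res_mod[of n "Suc n" "S (Suc n)"] by (auto simp: r_def)
  then have "padic_res (Abs_padic_int r :: 'p padic_int) = r"
    by (intro Abs_padic_int_inverse) auto
  then have "padic_p ^ n dvd (Abs_padic_int r) - S n" for n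
    by (simp flip: padic_res_eq_iff add: r_def)
  then show ?thesis
    by blast
qed

lemma padic_sum_complete:
  fixes a :: "nat \<Rightarrow> 'p::prime_card padic_int"
  shows "\<exists>s. \<forall>n. padic_p ^ n dvd s - (\<Sum>k<n. padic_p ^ k * a k)"
  by (rule padic_complete) simp

text \<open>An inverse \<open>b\<close> modulo p is corrected to a true inverse by the geometric
  series for 1/(1 - p y), where a b = 1 - p y.\<close>

lemma padic_unit_iff:
  fixes a :: "'p::prime_card padic_int"
  shows "a dvd 1 \<longleftrightarrow> \<not> padic_p dvd a"
proof
  assume "a dvd 1"
  moreover have "\<not> (padic_p :: 'p padic_int) dvd 1"
    using padic_p_power_dvd_iff[of 1 "1 :: 'p padic_int"] CARD_gt_1[where 'p='p]
    by (simp add: one_padic_int.rep_eq)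
  ultimately show "\<not> padic_p dvd a"
    using dvd_trans by blast
next
  assume n: "\<not> padic_p dvd a"
  let ?r = "padic_res a 1"
  have "?r \<noteq> 0"
    using n padic_p_power_dvd_iff[of 1 a] by simp
  then have "\<not> int CARD('p) dvd ?r"
    using padic_res_bounds[of a 1] zdvd_not_zless[of ?r "int CARD('p)"] by auto
  then have "coprime (int CARD('p)) ?r"
    using prime_card_int[where 'a='p] by (simp add: prime_imp_coprime)
  then obtain c where "[?r * c = 1] (mod int CARD('p))"
    using cong_solve_coprime_int[of ?r "int CARD('p)"] by (auto simp: coprime_commute)
  then have c: "(?r * (c mod int CARD('p))) mod int CARD('p) = 1"
    using CARD_gt_1[where 'p='p] by (simp add: cong_def mod_mult_right_eq)
  define b where "b = (of_nat (nat (c mod int CARD('p))) :: 'p padic_int)"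
  have "padic_res (a * b) 1 = padic_res (1 :: 'p padic_int) 1"
    unfolding times_padic_int.rep_eq b_def padic_res_of_nat one_padic_int.rep_eq
    using c CARD_gt_1[where 'p='p] by (simp add: pos_mod_bound)
  then obtain z where "a * b - 1 = padic_p * z"
    unfolding padic_res_eq_iff power_one_right by (auto simp only: dvd_def)
  then obtain y where ab: "a * b = 1 - padic_p * y"
    by (metis (no_types) add_diff_cancel_left' diff_add_cancel minus_diff_eq mult_minus_right diff_minus_eq_add add.commute)
  obtain s where s: "padic_p ^ n dvd s - (\<Sum>k<n. padic_p ^ k * y ^ k)" for n
    using padic_sum_complete[of "\<lambda>k. y ^ k"] by blast
  have "padic_p ^ n dvd s * (a * b) - 1" for n
  proof -
    have "(\<Sum>k<n. padic_p ^ k * y ^ k) * (a * b) = 1 - padic_p ^ n * y ^ n"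
      using one_diff_power_eq[of "padic_p * y" n]
      unfolding ab power_mult_distrib by (metis mult.commute)
    then have "s * (a * b) - 1 = (s - (\<Sum>k<n. padic_p ^ k * y ^ k)) * (a * b) - padic_p ^ n * y ^ n"
      by (simp add: left_diff_distrib)
    then show ?thesis
      using s[of n] by simp
  qed
  then have "s * (a * b) - 1 = 0"
    by (rule padic_eq_0I)
  then have "1 = a * (s * b)"
    by (simp add: algebra_simps)
  then show "a dvd 1" ..
qed

lemma padic_p_nonzero [simp]: "(padic_p :: 'p::prime_card padic_int) \<noteq> 0"
proof
  assume "(padic_p :: 'p padic_int) = 0"
  then have "padic_res (padic_p :: 'p padic_int) 2 = 0"
    by (simp add: zero_padic_int.rep_eq)
  moreover have "1 * int CARD('p) < int CARD('p) * int CARD('p)"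
    using CARD_gt_1[where 'p='p] by (intro mult_strict_right_mono) auto
  ultimately show False
    using CARD_gt_1[where 'p='p] by (simp add: padic_res_of_nat power2_eq_square)
qed

text \<open>Some power of p does not divide a nonzero element; the exponent just before the first
  failure leaves a cofactor prime to p, hence a unit.\<close>

lemma padic_factor:
  fixes a :: "'p::prime_card padic_int"
  assumes "a \<noteq> 0"
  obtains k u where "a = padic_p ^ k * u" "u dvd 1"
proof -
  obtain n where "\<not> padic_p ^ n dvd a"
    using assms padic_eq_0I by blast
  then have *: "\<not> padic_p ^ (LEAST n. \<not> padic_p ^ n dvd a) dvd a"
    by (rule LeastI)
  then obtain k where k: "(LEAST n. \<not> padic_p ^ n dvd a) = Suc k"
    by (cases "LEAST n. \<not> padic_p ^ n dvd a") auto
  then have "padic_p ^ k dvd a"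
    using not_less_Least[of k "\<lambda>n. \<not> padic_p ^ n dvd a"] by auto
  then obtain u where u: "a = padic_p ^ k * u" ..
  have "\<not> padic_p dvd u"
    using *[unfolded k] unfolding u power_Suc2 by (auto dest: mult_dvd_mono[OF dvd_refl])
  then show thesis
    using that u padic_unit_iff by blast
qed

text \<open>Reading the residue modulo p as a natural number reduces the claim to Fermat's theorem;
  residues divisible by p form a separate case because that theorem assumes coprimality.\<close>

lemma padic_little_fermat:
  fixes a :: "'p::prime_card padic_int"
  shows "padic_p dvd a ^ CARD('p) - a"
proof -
  have pw: "padic_res (a ^ n) 1 = (padic_res a 1) ^ n mod int CARD('p)" for n
    by (induction n) (simp_all add: one_padic_int.rep_eq times_padic_int.rep_eq mod_mult_right_eq)
  have p0: "CARD('p) > 0"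
    using CARD_gt_1[where 'p='p] by simp
  have "[nat (padic_res a 1) ^ CARD('p) = nat (padic_res a 1)] (mod CARD('p))"
  proof (cases "CARD('p) dvd nat (padic_res a 1)")
    case True
    then show ?thesis
      using p0 dvd_trans[OF True dvd_power[of "CARD('p)" "nat (padic_res a 1)"]]
      by (simp add: cong_def mod_eq_0_iff_dvd[THEN iffD2] del: zero_less_card_finite)
  next
    case False
    then have "[nat (padic_res a 1) ^ (CARD('p) - 1) * nat (padic_res a 1) = 1 * nat (padic_res a 1)] (mod CARD('p))"
      by (intro cong_mult fermat_theorem prime_CARD) auto
    then show ?thesis
      using CARD_gt_1[where 'p='p] by (simp flip: power_Suc2)
  qed
  then have "[padic_res a 1 ^ CARD('p) = padic_res a 1] (mod int CARD('p))"
    using padic_res_bounds[of a 1] by (simp flip: cong_int_iff)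
  then have "padic_res (a ^ CARD('p)) 1 = padic_res a 1"
    unfolding pw by (metis cong_def padic_res_mod_self power_one_right)
  then show ?thesis
    by (simp add: padic_res_eq_iff)
qed

section \<open>Integral elements of the algebraic closure\<close>

lemma to_ac_eq_0_iff [simp]: "to_ac y = 0 \<longleftrightarrow> y = 0"
proof
  assume "to_ac y = 0"
  then have "to_ac (y * inverse y) = 0"
    by (simp only: to_ac_mult) simp
  then show "y = 0"
    by (metis right_inverse to_ac_1 zero_neq_one)
qed simp

lemma of_padic_int_eq_0_iff: "of_padic_int x = 0 \<longleftrightarrow> x = 0"
  by (simp add: of_padic_int_def)

interpretation of_padic: inj_idom_hom "of_padic_int :: 'p::prime_card padic_int \<Rightarrow> _"
  by unfold_locales (simp_all add: of_padic_int_def hom_distribs of_padic_int_eq_0_iff[unfolded of_padic_int_def])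

interpretation of_padic_poly: map_poly_inj_idom_hom "of_padic_int :: 'p::prime_card padic_int \<Rightarrow> _" ..

abbreviation padic_poly :: "'p::prime_card padic_int poly \<Rightarrow> 'p padic_closure \<Rightarrow> 'p padic_closure" where
  "padic_poly q x \<equiv> poly (map_poly of_padic_int q) x"

abbreviation closure_p :: "'p::prime_card padic_closure" where
  "closure_p \<equiv> of_nat CARD('p)"

lemma closure_p_nonzero [simp]: "(closure_p :: 'p::prime_card padic_closure) \<noteq> 0"
  using of_padic.hom_0_iff[of "padic_p :: 'p padic_int"] by (simp add: of_padic.hom_of_nat)

section \<open>Integrality through finitely generated Z_p-modules\<close>

definition padic_span :: "'i set \<Rightarrow> ('i \<Rightarrow> 'p::prime_card padic_closure) \<Rightarrow> 'p padic_closure set" where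
  "padic_span I v = {\<Sum>i\<in>I. of_padic_int (a i) * v i | a. True}"

lemma padic_span_0: "0 \<in> padic_span I v"
  unfolding padic_span_def by (auto intro!: exI[of _ "\<lambda>_. 0"])

lemma padic_span_base: "finite I \<Longrightarrow> i \<in> I \<Longrightarrow> v i \<in> padic_span I v"
  unfolding padic_span_def
  by (auto intro!: exI[of _ "\<lambda>j. if j = i then 1 else 0"] simp: if_distrib if_distribR cong: if_cong)

lemma padic_span_add: "x \<in> padic_span I v \<Longrightarrow> y \<in> padic_span I v \<Longrightarrow> x + y \<in> padic_span I v"
proof -
  assume "x \<in> padic_span I v" "y \<in> padic_span I v"
  then obtain a b where "x = (\<Sum>i\<in>I. of_padic_int (a i) * v i)" "y = (\<Sum>i\<in>I. of_padic_int (b i) * v i)"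
    by (auto simp: padic_span_def)
  then have "x + y = (\<Sum>i\<in>I. of_padic_int (a i + b i) * v i)"
    by (simp add: hom_distribs ring_distribs sum.distrib)
  then show ?thesis
    by (auto simp: padic_span_def)
qed

lemma padic_span_scale: "x \<in> padic_span I v \<Longrightarrow> of_padic_int c * x \<in> padic_span I v"
proof -
  assume "x \<in> padic_span I v"
  then obtain a where "x = (\<Sum>i\<in>I. of_padic_int (a i) * v i)"
    by (auto simp: padic_span_def)
  then have "of_padic_int c * x = (\<Sum>i\<in>I. of_padic_int (c * a i) * v i)"
    by (simp add: hom_distribs sum_distrib_left mult.assoc)
  then show ?thesis
    by (auto simp: padic_span_def)
qed

lemma padic_span_sum: "(\<And>j. j \<in> J \<Longrightarrow> f j \<in> padic_span I v) \<Longrightarrow> (\<Sum>j\<in>J. f j) \<in> padic_span I v"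
  by (induction J rule: infinite_finite_induct) (auto simp: padic_span_0 padic_span_add)

lemma padic_span_mult_closed:
  assumes "\<And>i. i \<in> I \<Longrightarrow> x * v i \<in> padic_span I v" "y \<in> padic_span I v"
  shows "x * y \<in> padic_span I v"
proof -
  obtain a where "y = (\<Sum>i\<in>I. of_padic_int (a i) * v i)"
    using assms(2) by (auto simp: padic_span_def)
  then have "x * y = (\<Sum>i\<in>I. of_padic_int (a i) * (x * v i))"
    by (simp add: sum_distrib_left mult_ac)
  then show ?thesis
    by (simp add: padic_span_sum padic_span_scale assms(1))
qed

text \<open>\<open>x\<close> is an eigenvalue of the matrix of multiplication by \<open>x\<close>, so it is a root of the
  characteristic polynomial of that matrix.\<close>

lemma padic_integral_if_span:
  fixes x :: "'p::prime_card padic_closure"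
  assumes fin: "finite I" and nz: "\<exists>i\<in>I. v i \<noteq> 0"
    and cl: "\<And>i. i \<in> I \<Longrightarrow> x * v i \<in> padic_span I v"
  shows "padic_integral x"
proof -
  obtain n f where bij: "bij_betw f {..<n::nat} I"
    using fin by (metis ex_bij_betw_nat_finite atLeast0LessThan)
  have "\<exists>b. x * v i = (\<Sum>j\<in>I. of_padic_int (b j) * v j)" if "i \<in> I" for i
    using cl[OF that] by (auto simp: padic_span_def)
  then obtain a where a: "\<And>i. i \<in> I \<Longrightarrow> x * v i = (\<Sum>j\<in>I. of_padic_int (a i j) * v j)"
    by metis
  define A where "A = mat n n (\<lambda>(i, j). a (f i) (f j))"
  have A: "A \<in> carrier_mat n n"
    by (simp add: A_def)
  define w where "w = Matrix.vec n (\<lambda>i. v (f i))"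
  have "map_mat of_padic_int A *\<^sub>v w = x \<cdot>\<^sub>v w"
  proof (rule eq_vecI)
    fix i assume "i < dim_vec (x \<cdot>\<^sub>v w)"
    then have i: "i < n"
      by (simp add: w_def)
    then have "f i \<in> I"
      using bij by (auto simp: bij_betw_def)
    then have "x * v (f i) = (\<Sum>j<n. of_padic_int (a (f i) (f j)) * v (f j))"
      by (simp only: a sum.reindex_bij_betw[OF bij, symmetric])
    then show "(map_mat of_padic_int A *\<^sub>v w) $ i = (x \<cdot>\<^sub>v w) $ i"
      using i by (simp add: w_def A_def scalar_prod_def atLeast0LessThan)
  qed (simp add: w_def A_def)
  moreover have "w \<noteq> 0\<^sub>v n"
  proof -
    obtain i where "i < n" "v (f i) \<noteq> 0"
      using nz bij by (auto simp: bij_betw_def)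
    then have "w $ i \<noteq> 0\<^sub>v n $ i"
      by (simp add: w_def)
    then show ?thesis
      by auto
  qed
  ultimately have "eigenvector (map_mat of_padic_int A) w x"
    unfolding eigenvector_def by (simp add: w_def A_def)
  then have "poly (char_poly (map_mat of_padic_int A)) x = 0"
    using A by (subst eigenvalue_root_char_poly[of _ n, symmetric]) (auto simp: eigenvalue_def)
  then have "padic_poly (char_poly A) x = 0"
    by (simp add: of_padic.char_poly_hom[OF A])
  moreover have "lead_coeff (char_poly A) = 1"
    using degree_monic_char_poly[OF A] by simp
  ultimately show ?thesis
    unfolding padic_integral_def by blast
qed

text \<open>The monic relation is solved for its top power. The positive exponent ensures that 1
  lies among the lower powers.\<close>

lemma padic_integralE:
  fixes x :: "'p::prime_card padic_closure"
  assumes "padic_integral x"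
  obtains m c where "m > 0" "x ^ m = (\<Sum>l<m. of_padic_int (c l) * x ^ l)"
proof -
  obtain q where q: "lead_coeff q = 1" "padic_poly q x = 0"
    using assms by (auto simp: padic_integral_def)
  let ?m = "degree q"
  have m: "?m > 0"
  proof (rule ccontr)
    assume "\<not> ?m > 0"
    then have "q = 1"
      using q(1) by (metis degree_eq_zeroE gr0I lead_coeff_pCons(2) one_pCons coeff_pCons_0)
    then show False
      using q(2) by simp
  qed
  have "0 = (\<Sum>i\<le>?m. of_padic_int (coeff q i) * x ^ i)"
    using q(2) by (simp add: poly_altdef)
  also have "\<dots> = (\<Sum>i<?m. of_padic_int (coeff q i) * x ^ i) + x ^ ?m"
    using q(1) by (simp flip: lessThan_Suc_atMost)
  finally have "x ^ ?m = (\<Sum>i<?m. of_padic_int (- coeff q i) * x ^ i)"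
    by (simp add: hom_distribs sum_negf eq_neg_iff_add_eq_0 add.commute)
  with m show thesis
    by (rule that)
qed

lemma padic_integral_of_padic_int [simp]: "padic_integral (of_padic_int a)"
  unfolding padic_integral_def by (intro exI[of _ "[:- a, 1:]"]) (simp add: hom_distribs)

text \<open>Multiplication by \<open>x\<close> moves each power to the next one, except the top one,
  which the monic relation rewrites in lower powers. The factor \<open>z\<close> stays free so that
  the same argument serves both variables of a family of monomials.\<close>

lemma padic_span_power_step:
  assumes x: "x ^ m = (\<Sum>l<m. of_padic_int (c l) * x ^ l)" and i: "i < m"
    and z: "\<And>l. l < m \<Longrightarrow> x ^ l * z \<in> padic_span I v"
  shows "x * (x ^ i * z) \<in> padic_span I v"
proof (cases "Suc i < m")
  case True
  then show ?thesis
    using z[of "Suc i"] by (simp add: mult.assoc)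
next
  case False
  then have "m = Suc i"
    using i by simp
  then have "x * (x ^ i * z) = x ^ m * z"
    by simp
  also have "\<dots> = (\<Sum>l<m. of_padic_int (c l) * (x ^ l * z))"
    unfolding x by (simp add: sum_distrib_right mult.assoc)
  also have "\<dots> \<in> padic_span I v"
    by (intro padic_span_sum padic_span_scale z) simp
  finally show ?thesis .
qed

text \<open>The monomials in \<open>x\<close> and \<open>y\<close> below the degrees of the two
  monic relations span a module stable under both elements, hence under their sum and
  product.\<close>

lemma padic_integral_two:
  fixes x y :: "'p::prime_card padic_closure"
  assumes "padic_integral x" "padic_integral y"
  shows "padic_integral (x + y) \<and> padic_integral (x * y)"
proof -
  obtain m c where m: "m > 0" "x ^ m = (\<Sum>l<m. of_padic_int (c l) * x ^ l)"
    using assms(1) by (rule padic_integralE)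
  obtain n d where n: "n > 0" "y ^ n = (\<Sum>l<n. of_padic_int (d l) * y ^ l)"
    using assms(2) by (rule padic_integralE)
  define I where "I = {..<m} \<times> {..<n}"
  define v where "v = (\<lambda>(i, j). x ^ i * y ^ j)"
  have fin: "finite I"
    by (simp add: I_def)
  have nz: "\<exists>i\<in>I. v i \<noteq> 0"
    using m(1) n(1) by (intro bexI[of _ "(0, 0)"]) (auto simp: I_def v_def)
  have base: "x ^ i * y ^ j \<in> padic_span I v" if "i < m" "j < n" for i j
    using padic_span_base[OF fin, of "(i, j)" v] that by (simp add: I_def v_def)
  have x: "x * v k \<in> padic_span I v" if "k \<in> I" for k
    using that padic_span_power_step[OF m(2), of _ "y ^ _" I v] base
    by (auto simp: I_def v_def)
  have y: "y * v k \<in> padic_span I v" if "k \<in> I" for k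
    using that padic_span_power_step[OF n(2), of _ "x ^ _" I v] base
    by (auto simp: I_def v_def mult.commute)
  show ?thesis
  proof
    show "padic_integral (x + y)"
      using x y by (intro padic_integral_if_span[OF fin nz]) (simp add: ring_distribs padic_span_add)
    show "padic_integral (x * y)"
      using x y padic_span_mult_closed[of I x v]
      by (intro padic_integral_if_span[OF fin nz]) (simp add: mult.assoc)
  qed
qed

lemma padic_integral_add [simp]: "padic_integral x \<Longrightarrow> padic_integral y \<Longrightarrow> padic_integral (x + y)"
  and padic_integral_mult [simp]: "padic_integral x \<Longrightarrow> padic_integral y \<Longrightarrow> padic_integral (x * y)"
  by (simp_all add: padic_integral_two)

lemma padic_integral_of_nat [simp]: "padic_integral (of_nat n)"
  using padic_integral_of_padic_int[of "of_nat n"] by (simp add: of_padic.hom_of_nat)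

lemma padic_integral_0 [simp]: "padic_integral 0"
  using padic_integral_of_nat[of 0] by simp

lemma padic_integral_1 [simp]: "padic_integral 1"
  using padic_integral_of_nat[of 1] by simp

lemma padic_integral_uminus [simp]: "padic_integral x \<Longrightarrow> padic_integral (- x)"
  using padic_integral_mult[of "of_padic_int (- 1)" x, OF padic_integral_of_padic_int]
  by (simp add: hom_distribs)

lemma padic_integral_diff [simp]: "padic_integral x \<Longrightarrow> padic_integral y \<Longrightarrow> padic_integral (x - y)"
  using padic_integral_add[of x "- y"] by simp

lemma padic_integral_power [simp]: "padic_integral x \<Longrightarrow> padic_integral (x ^ n)"
  by (induction n) auto

lemma padic_integral_sum: "(\<And>i. i \<in> I \<Longrightarrow> padic_integral (f i)) \<Longrightarrow> padic_integral (sum f I)"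
  by (induction I rule: infinite_finite_induct) auto

lemma padic_integral_padic_poly [simp]: "padic_integral x \<Longrightarrow> padic_integral (padic_poly q x)"
  by (simp add: poly_altdef padic_integral_sum)

text \<open>Substituting X^k keeps a polynomial monic when \<open>k\<close> is positive.\<close>

lemma padic_integral_powerD:
  assumes "padic_integral (x ^ k)" "k > 0"
  shows "padic_integral x"
proof -
  obtain q where q: "lead_coeff q = 1" "padic_poly q (x ^ k) = 0"
    using assms by (auto simp: padic_integral_def)
  then have "lead_coeff (q \<circ>\<^sub>p monom 1 k) = 1"
    using assms(2) by (subst lead_coeff_comp) (simp_all add: degree_monom_eq)
  moreover have "padic_poly (q \<circ>\<^sub>p monom 1 k) x = 0"
    using q(2) by (simp add: of_padic.map_poly_pcompose poly_pcompose poly_monom hom_distribs)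
  ultimately show ?thesis
    unfolding padic_integral_def by blast
qed

text \<open>Clearing denominators in a monic relation for 1/p would write 1 as a multiple of p in
  Z_p.\<close>

lemma not_padic_integral_inverse_p: "\<not> padic_integral (1 / closure_p :: 'p::prime_card padic_closure)"
proof
  let ?P = "closure_p :: 'p padic_closure"
  assume "padic_integral (1 / ?P)"
  then obtain m c where m: "m > 0" "(1 / ?P) ^ m = (\<Sum>l<m. of_padic_int (c l) * (1 / ?P) ^ l)"
    by (rule padic_integralE)
  have "?P ^ m * (1 / ?P) ^ m = (\<Sum>l<m. of_padic_int (c l) * (?P ^ m * (1 / ?P) ^ l))"
    unfolding m(2) by (simp add: sum_distrib_left mult_ac)
  also have "\<dots> = (\<Sum>l<m. of_padic_int (c l) * ?P ^ (m - l))"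
    by (intro sum.cong) (auto simp: power_divide power_diff)
  also have "\<dots> = of_padic_int (\<Sum>l<m. c l * padic_p ^ (m - l))"
    by (simp add: hom_distribs)
  finally have "of_padic_int 1 = of_padic_int (\<Sum>l<m. c l * (padic_p :: 'p padic_int) ^ (m - l))"
    by (simp add: power_divide)
  then have "1 = (\<Sum>l<m. c l * (padic_p :: 'p padic_int) ^ (m - l))"
    by (simp only: of_padic.eq_iff)
  moreover have "padic_p dvd (\<Sum>l<m. c l * (padic_p :: 'p padic_int) ^ (m - l))"
    by (intro dvd_sum dvd_mult dvd_power) auto
  ultimately have "(padic_p :: 'p padic_int) dvd 1"
    by simp
  then show False
    using padic_unit_iff by blast
qed

section \<open>The filtration by powers of p\<close>

definition padic_small :: "nat \<Rightarrow> 'p::prime_card padic_closure \<Rightarrow> bool" where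
  "padic_small m x \<longleftrightarrow> padic_integral (x / closure_p ^ m)"

lemma padic_small_0_iff [simp]: "padic_small 0 x \<longleftrightarrow> padic_integral x"
  by (simp add: padic_small_def)

lemma padic_small_zero [simp]: "padic_small m 0"
  by (simp add: padic_small_def)

lemma padic_small_iff: "padic_small m x \<longleftrightarrow> (\<exists>y. padic_integral y \<and> x = closure_p ^ m * y)"
  unfolding padic_small_def
  by (rule iffI, rule exI[of _ "x / closure_p ^ m"]) auto

lemma padic_small_add [simp]: "padic_small m x \<Longrightarrow> padic_small m y \<Longrightarrow> padic_small m (x + y)"
  unfolding padic_small_def by (simp add: add_divide_distrib)

lemma padic_small_diff [simp]: "padic_small m x \<Longrightarrow> padic_small m y \<Longrightarrow> padic_small m (x - y)"
  unfolding padic_small_def by (simp add: diff_divide_distrib)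

lemma padic_small_uminus: "padic_small m x \<Longrightarrow> padic_small m (- x)"
  using padic_small_diff[of m 0 x] by simp

lemma padic_small_sum: "(\<And>i. i \<in> I \<Longrightarrow> padic_small m (f i)) \<Longrightarrow> padic_small m (sum f I)"
  by (induction I rule: infinite_finite_induct) auto

lemma padic_small_mult: "padic_small m x \<Longrightarrow> padic_small n y \<Longrightarrow> padic_small (m + n) (x * y)"
  unfolding padic_small_def
  by (metis (no_types, lifting) padic_integral_mult power_add times_divide_times_eq)

lemma padic_small_mult_left: "padic_small m x \<Longrightarrow> padic_integral y \<Longrightarrow> padic_small m (x * y)"
  using padic_small_mult[of m x 0 y] by simp

lemma padic_small_mult_right: "padic_integral x \<Longrightarrow> padic_small m y \<Longrightarrow> padic_small m (x * y)"
  using padic_small_mult[of 0 x m y] by simp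

lemma padic_small_mono:
  assumes "padic_small n x" "m \<le> n"
  shows "padic_small m x"
proof -
  obtain y where "padic_integral y" "x = closure_p ^ n * y"
    using assms(1) by (auto simp: padic_small_iff)
  then have "padic_integral (closure_p ^ (n - m) * y)" "x = closure_p ^ m * (closure_p ^ (n - m) * y)"
    using assms(2) by (simp_all flip: mult.assoc power_add)
  then show ?thesis
    unfolding padic_small_iff by blast
qed

lemma padic_small_imp_integral: "padic_small n x \<Longrightarrow> padic_integral x"
  using padic_small_mono[of n x 0] by simp

text \<open>Integral elements induce on Z_p its own divisibility by p: with \<open>a\<close> written
  as a power of p times a unit, too small an exponent would make 1/p integral.\<close>

lemma padic_small_of_padic_int_iff:
  fixes a :: "'p::prime_card padic_int"
  shows "padic_small k (of_padic_int a) \<longleftrightarrow> padic_p ^ k dvd a"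
proof
  assume "padic_p ^ k dvd a"
  then obtain b where "a = padic_p ^ k * b" ..
  then show "padic_small k (of_padic_int a)"
    unfolding padic_small_iff by (intro exI[of _ "of_padic_int b"]) (simp add: hom_distribs)
next
  assume small: "padic_small k (of_padic_int a)"
  show "padic_p ^ k dvd a"
  proof (cases "a = 0")
    case False
    then obtain j u where a: "a = padic_p ^ j * u" "u dvd 1"
      by (rule padic_factor)
    obtain w where w: "1 = u * w"
      using a(2) by (rule dvdE)
    have "\<not> j < k"
    proof
      assume "j < k"
      then obtain i where k: "k = j + Suc i"
        by (metis less_imp_Suc_add add_Suc_right)
      have "padic_integral (of_padic_int a / closure_p ^ k * (of_padic_int w * closure_p ^ i))"
        using small by (intro padic_integral_mult) (simp_all add: padic_small_def)
      also have "of_padic_int a / closure_p ^ k * (of_padic_int w * closure_p ^ i) =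
          of_padic_int (u * w) / (closure_p :: 'p padic_closure)"
        by (simp add: a(1) k hom_distribs power_add)
      finally show False
        using not_padic_integral_inverse_p[where 'p='p] by (simp flip: w)
    qed
    then show ?thesis
      unfolding a(1) by (simp add: le_imp_power_dvd)
  qed simp
qed

text \<open>A relation of least degree has nonzero constant term, since otherwise cancelling
  \<open>z\<close> would lower the degree. That constant is a power of p up to a unit of Z_p, so
  \<open>z\<close> is inverted, up to a power of p, by a polynomial in itself.\<close>

lemma padic_inverse_poly:
  fixes z :: "'p::prime_card padic_closure"
  assumes "padic_integral z" "z \<noteq> 0"
  shows "\<exists>s e. z * padic_poly s z = closure_p ^ e"
proof -
  define Q where "Q q \<longleftrightarrow> q \<noteq> 0 \<and> padic_poly q z = 0" for q
  have "\<exists>q. Q q"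
    using assms(1) unfolding padic_integral_def Q_def by (metis leading_coeff_0_iff zero_neq_one)
  then obtain q where q: "Q q" "\<And>r. Q r \<Longrightarrow> degree q \<le> degree r"
    using ex_has_least_nat[of Q _ degree] by blast
  obtain c s where qs: "q = pCons c s"
    by (cases q)
  have c: "c \<noteq> 0"
  proof
    assume "c = 0"
    then have "Q s"
      using q(1) assms(2) by (auto simp: Q_def qs hom_distribs)
    then show False
      using q(2)[of s] by (auto simp: qs Q_def)
  qed
  then obtain e u where u: "c = padic_p ^ e * u" "u dvd 1"
    by (rule padic_factor)
  obtain w where w: "1 = u * w"
    using u(2) by (rule dvdE)
  have "z * padic_poly s z = of_padic_int (- c)"
    using q(1) by (simp add: Q_def qs hom_distribs eq_neg_iff_add_eq_0 add.commute)
  moreover have "z * padic_poly (smult (- w) s) z = - (z * padic_poly s z) * of_padic_int w"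
    by (simp add: hom_distribs mult_ac)
  ultimately have "z * padic_poly (smult (- w) s) z = of_padic_int (c * w)"
    by (simp add: hom_distribs)
  also have "c * w = padic_p ^ e"
    using w by (simp add: u mult.assoc)
  finally have "z * padic_poly (smult (- w) s) z = closure_p ^ e"
    by (simp only: of_padic.hom_power of_padic.hom_of_nat)
  then show ?thesis
    by blast
qed

text \<open>This is the Hausdorff property. A nonzero integral \<open>z\<close> divides some p^e
  with integral quotient, and divisibility of \<open>z\<close> by p^(e+1) would then make 1/p
  integral.\<close>

lemma padic_small_all_imp_0:
  fixes z :: "'p::prime_card padic_closure"
  assumes "\<And>m. padic_small m z"
  shows "z = 0"
proof (rule ccontr)
  assume "z \<noteq> 0"
  have z: "padic_integral z"
    using assms[of 0] by simp
  obtain s e where s: "z * padic_poly s z = closure_p ^ e"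
    using padic_inverse_poly[OF z \<open>z \<noteq> 0\<close>] by blast
  have "padic_integral (z / closure_p ^ Suc e * padic_poly s z)"
    using assms[of "Suc e"] z by (intro padic_integral_mult) (simp_all add: padic_small_def)
  also have "z / closure_p ^ Suc e * padic_poly s z = 1 / closure_p"
    using s by (simp add: field_simps)
  finally show False
    using not_padic_integral_inverse_p by blast
qed

lemma padic_tendsto_small_iff:
  "padic_tendsto s y \<longleftrightarrow> (\<forall>m. \<forall>\<^sub>F n in sequentially. padic_small m (s n - y))"
  by (simp add: padic_tendsto_def padic_small_def)

lemma padic_tendsto_unique:
  assumes "padic_tendsto s y" "padic_tendsto s z"
  shows "y = z"
proof -
  have "padic_small m (y - z)" for m
  proof -
    have "\<forall>\<^sub>F n in sequentially. padic_small m (s n - y) \<and> padic_small m (s n - z)"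
      using assms by (auto simp: padic_tendsto_small_iff eventually_conj_iff)
    then obtain n where "padic_small m (s n - y)" "padic_small m (s n - z)"
      by (auto simp: eventually_sequentially)
    then show ?thesis
      using padic_small_diff[of m "s n - z" "s n - y"] by simp
  qed
  then show ?thesis
    using padic_small_all_imp_0[of "y - z"] by simp
qed

lemma fps_evaluates_unique: "fps_evaluates f x y \<Longrightarrow> fps_evaluates f x z \<Longrightarrow> y = z"
  unfolding fps_evaluates_def padic_sums_def by (rule padic_tendsto_unique)

section \<open>Units and topologically nilpotent elements\<close>

definition padic_unit :: "'p::prime_card padic_closure \<Rightarrow> bool" where
  "padic_unit x \<longleftrightarrow> x \<noteq> 0 \<and> padic_integral x \<and> padic_integral (inverse x)"

lemma padic_unit_mult [simp]: "padic_unit x \<Longrightarrow> padic_unit y \<Longrightarrow> padic_unit (x * y)"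
  unfolding padic_unit_def inverse_mult_distrib by (simp del: inverse_mult_distrib)

lemma padic_unit_power [simp]: "padic_unit x \<Longrightarrow> padic_unit (x ^ n)"
  by (simp add: padic_unit_def power_inverse flip: power_inverse)

lemma padic_unit_uminus [simp]: "padic_unit x \<Longrightarrow> padic_unit (- x)"
  by (simp add: padic_unit_def)

lemma padic_unitI: "x * y = 1 \<Longrightarrow> padic_integral x \<Longrightarrow> padic_integral y \<Longrightarrow> padic_unit x"
  unfolding padic_unit_def using inverse_unique by fastforce

lemma padic_unitD: "padic_unit (x * y) \<Longrightarrow> padic_integral x \<Longrightarrow> padic_integral y \<Longrightarrow> padic_unit x"
  by (rule padic_unitI[of _ "y * inverse (x * y)"])
    (auto simp: padic_unit_def simp flip: mult.assoc simp del: inverse_mult_distrib)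

lemma padic_unit_of_padic_int: "u dvd 1 \<Longrightarrow> padic_unit (of_padic_int u)"
proof (elim dvdE)
  fix w assume "1 = u * w"
  then have "of_padic_int u * of_padic_int w = 1"
    by (simp flip: of_padic.hom_mult)
  then show ?thesis
    by (rule padic_unitI) auto
qed

text \<open>The closure is not complete, so the inverse comes from algebra and not from a geometric
  series: 1 + p y satisfies a relation whose constant term is (-1)^m modulo p, a unit of Z_p, and 1
  + p y divides that constant term.\<close>

lemma padic_unit_1_plus_p:
  fixes y :: "'p::prime_card padic_closure"
  assumes "padic_integral y"
  shows "padic_unit (1 + closure_p * y)"
proof -
  obtain m c where m: "m > 0" "y ^ m = (\<Sum>l<m. of_padic_int (c l) * y ^ l)"
    using assms by (rule padic_integralE)
  define t where "t = 1 + closure_p * y"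
  \<comment> \<open>This is p^m q((X-1)/p) for the monic q that vanishes at \<open>y\<close>; the
    powers of p clear its denominators.\<close>
  define r :: "'p padic_int poly" where
    "r = [:- 1, 1:] ^ m - (\<Sum>l<m. smult (c l * padic_p ^ (m - l)) ([:- 1, 1:] ^ l))"
  have t: "padic_integral t"
    using assms by (simp add: t_def)
  have "padic_poly r t = (closure_p * y) ^ m -
      (\<Sum>l<m. of_padic_int (c l) * closure_p ^ (m - l) * (closure_p * y) ^ l)"
    by (simp add: r_def hom_distribs poly_sum t_def)
  also have "\<dots> = closure_p ^ m * (y ^ m - (\<Sum>l<m. of_padic_int (c l) * y ^ l))"
  proof -
    have "of_padic_int (c l) * closure_p ^ (m - l) * (closure_p * y) ^ l =
        closure_p ^ m * (of_padic_int (c l) * y ^ l)" if "l < m" for l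
    proof -
      have "closure_p ^ m = closure_p ^ (m - l) * (closure_p :: 'p padic_closure) ^ l"
        using that by (simp flip: power_add)
      then show ?thesis
        by (simp add: power_mult_distrib mult_ac)
    qed
    then have "(\<Sum>l<m. of_padic_int (c l) * closure_p ^ (m - l) * (closure_p * y) ^ l) =
        (\<Sum>l<m. closure_p ^ m * (of_padic_int (c l) * y ^ l))"
      by (intro sum.cong) auto
    then show ?thesis
      by (simp only: power_mult_distrib right_diff_distrib sum_distrib_left)
  qed
  finally have rt: "padic_poly r t = 0"
    using m(2) by simp
  obtain a s where r: "r = pCons a s"
    by (cases r)
  have "a = poly r 0"
    by (simp add: r)
  also have "\<dots> = (- 1) ^ m - (\<Sum>l<m. c l * padic_p ^ (m - l) * (- 1) ^ l)"
    by (simp add: r_def poly_sum)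
  finally have a: "a + (\<Sum>l<m. c l * padic_p ^ (m - l) * (- 1) ^ l) = (- 1) ^ m"
    by simp
  have "padic_p dvd (\<Sum>l<m. c l * padic_p ^ (m - l) * (- 1) ^ l)"
    by (intro dvd_sum dvd_mult2 dvd_mult dvd_power) auto
  moreover have "\<not> padic_p dvd ((- 1) ^ m :: 'p padic_int)"
    unfolding padic_unit_iff[symmetric] by (cases "even m") simp_all
  ultimately have "\<not> padic_p dvd a"
    unfolding a[symmetric] using dvd_add by blast
  then have "padic_unit (of_padic_int a)"
    by (simp add: padic_unit_of_padic_int padic_unit_iff)
  moreover have "t * (- padic_poly s t) = of_padic_int a"
    using rt by (simp add: r hom_distribs add_eq_0_iff)
  ultimately show ?thesis
    using padic_unitD[of t "- padic_poly s t"] t by (simp add: t_def)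
qed

text \<open>Stands in for positive valuation, that is, membership in the maximal ideal of the ring
  of integral elements.\<close>

definition padic_topnil :: "'p::prime_card padic_closure \<Rightarrow> bool" where
  "padic_topnil x \<longleftrightarrow> (\<exists>N>0. padic_small 1 (x ^ N))"

lemma padic_topnil_integral: "padic_topnil x \<Longrightarrow> padic_integral x"
  unfolding padic_topnil_def using padic_integral_powerD padic_small_imp_integral by blast

lemma padic_topnil_mult: "padic_topnil x \<Longrightarrow> padic_integral y \<Longrightarrow> padic_topnil (x * y)"
  unfolding padic_topnil_def by (metis power_mult_distrib padic_small_mult_left padic_integral_power)

lemma padic_topnil_powerD: "padic_topnil (x ^ k) \<Longrightarrow> k > 0 \<Longrightarrow> padic_topnil x"
  unfolding padic_topnil_def by (metis power_mult mult_pos_pos nat_0_less_mult_iff)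

text \<open>The N-th powers of both elements agree modulo p, because their difference has the factor
  p s.\<close>

lemma padic_topnil_add_p:
  assumes "padic_topnil x" "padic_integral s"
  shows "padic_topnil (x + closure_p * s)"
proof -
  obtain N where N: "N > 0" "padic_small 1 (x ^ N)"
    using assms(1) by (auto simp: padic_topnil_def)
  let ?y = "x + closure_p * s"
  have "?y ^ N - x ^ N = (?y - x) * (\<Sum>i<N. x ^ (N - Suc i) * ?y ^ i)"
    by (rule power_diff_sumr2)
  also have "padic_small 1 \<dots>"
    using assms padic_topnil_integral[OF assms(1)]
    by (intro padic_small_mult_left padic_integral_sum) (auto simp: padic_small_def)
  finally have "padic_small 1 (?y ^ N)"
    using N(2) padic_small_add[of 1 "?y ^ N - x ^ N" "x ^ N"] by simp
  then show ?thesis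
    using N(1) by (auto simp: padic_topnil_def)
qed

text \<open>The finite alternating geometric sum multiplies 1 + x to 1 - (-x)^N, which is 1 plus a
  multiple of p and so a unit; an integral divisor of a unit, with integral quotient, is a
  unit.\<close>

lemma padic_unit_1_plus_topnil:
  assumes "padic_topnil x"
  shows "padic_unit (1 + x)"
proof -
  obtain N where N: "N > 0" "padic_small 1 (x ^ N)"
    using assms by (auto simp: padic_topnil_def)
  have x: "padic_integral x"
    using assms by (rule padic_topnil_integral)
  obtain y where y: "padic_integral y" "(- x) ^ N = closure_p * (- y)"
  proof -
    have "padic_small 1 ((- x) ^ N)"
      using padic_small_mult_right[of "(- 1) ^ N" 1 "x ^ N"] N(2) by (simp flip: power_mult_distrib)
    then obtain y where "padic_integral y" "(- x) ^ N = closure_p * y"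
      by (auto simp: padic_small_iff)
    then show thesis
      using that[of "- y"] by simp
  qed
  have "(1 + x) * (\<Sum>i<N. (- x) ^ i) = 1 - (- x) ^ N"
    by (simp add: one_diff_power_eq)
  also have "padic_unit \<dots>"
    unfolding y(2) using padic_unit_1_plus_p[OF y(1)] by simp
  finally show ?thesis
    using x padic_unitD[of "1 + x" "\<Sum>i<N. (- x) ^ i"] by (simp add: padic_integral_sum)
qed

lemma not_padic_unit_topnil:
  assumes "padic_topnil x"
  shows "\<not> padic_unit x"
proof
  assume "padic_unit x"
  obtain N where "padic_small 1 (x ^ N)"
    using assms by (auto simp: padic_topnil_def)
  then have "padic_small 1 (inverse (x ^ N) * x ^ N)"
    using \<open>padic_unit x\<close> by (intro padic_small_mult_right) (metis padic_unit_power padic_unit_def)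
  then show False
    using \<open>padic_unit x\<close> not_padic_integral_inverse_p[where 'p='a]
    by (simp add: padic_small_def padic_unit_def)
qed

section \<open>Uniformizers from roots of unity\<close>

text \<open>The terms of exponent 2 to p - 1 in (1 + x)^p, freed of their common factor p x^2. The
  ring is arbitrary because the expansion is applied both in the closure and to power
  series.\<close>

definition binomial_tail :: "nat \<Rightarrow> 'a::comm_ring_1 \<Rightarrow> 'a" where
  "binomial_tail p x = (\<Sum>k\<in>{2..<p}. of_nat ((p choose k) div p) * x ^ (k - 2))"

lemma prime_power_binomial:
  fixes x :: "'a::comm_ring_1"
  assumes "prime p"
  shows "(1 + x) ^ p = 1 + x ^ p + of_nat p * (x * (1 + x * binomial_tail p x))"
proof -
  have p: "p \<ge> 2"
    using assms prime_ge_2_nat by blast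
  have "(1 + x) ^ p = (\<Sum>k\<le>p. of_nat (p choose k) * x ^ k)"
    using binomial_ring[of x 1 p] by (simp add: add.commute)
  also have "{..p} = insert 0 (insert 1 (insert p {2..<p}))"
    using p by auto
  also have "(\<Sum>k\<in>\<dots>. of_nat (p choose k) * x ^ k) =
      1 + (of_nat p * x + (x ^ p + (\<Sum>k\<in>{2..<p}. of_nat (p choose k) * x ^ k)))"
    using p by simp
  also have "(\<Sum>k\<in>{2..<p}. of_nat (p choose k) * x ^ k) =
      (\<Sum>k\<in>{2..<p}. of_nat p * (x * (x * (of_nat ((p choose k) div p) * x ^ (k - 2)))))"
  proof (rule sum.cong[OF refl])
    fix k assume k: "k \<in> {2..<p}"
    then have "p choose k = p * ((p choose k) div p)"
      using assms by (auto intro!: dvd_mult_div_cancel[symmetric] dvd_choose_prime)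
    then have "of_nat (p choose k) = (of_nat p * of_nat ((p choose k) div p) :: 'a)"
      by (metis of_nat_mult)
    moreover obtain j where "k = Suc (Suc j)"
      using k by (metis add_2_eq_Suc atLeastLessThan_iff le_Suc_ex)
    ultimately show "of_nat (p choose k) * x ^ k =
        of_nat p * (x * (x * (of_nat ((p choose k) div p) * x ^ (k - 2))))"
      by (simp add: mult_ac)
  qed
  also have "\<dots> = of_nat p * (x * (x * binomial_tail p x))"
    by (simp add: binomial_tail_def sum_distrib_left)
  finally show ?thesis
    by (simp add: ring_distribs)
qed

lemma padic_integral_binomial_tail: "padic_integral x \<Longrightarrow> padic_integral (binomial_tail p x)"
  by (simp add: binomial_tail_def padic_integral_sum)

text \<open>With x = \<zeta> - 1, the binomial expansion shows that \<zeta>^p - 1 and x^p agree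
  modulo p, so topological nilpotence passes from \<zeta>^p - 1 to \<open>x\<close>.\<close>

lemma padic_topnil_root_of_unity:
  fixes \<zeta> :: "'p::prime_card padic_closure"
  assumes "\<zeta> ^ (CARD('p) ^ n) = 1"
  shows "padic_topnil (\<zeta> - 1)"
  using assms
proof (induction n arbitrary: \<zeta>)
  case 0
  then show ?case
    by (auto simp: padic_topnil_def intro!: exI[of _ 1])
next
  case (Suc n)
  define x where "x = \<zeta> - 1"
  have "padic_integral \<zeta>"
    using Suc.prems by (intro padic_integral_powerD[of \<zeta> "CARD('p) ^ Suc n"]) auto
  then have x: "padic_integral x"
    by (simp add: x_def)
  have "padic_topnil (\<zeta> ^ CARD('p) - 1)"
    using Suc by (simp add: power_mult)
  moreover define t where "t = x * (1 + x * binomial_tail CARD('p) x)"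
  have "\<zeta> ^ CARD('p) - 1 = x ^ CARD('p) + closure_p * t"
    using prime_power_binomial[OF prime_CARD[where 'p='p], of x] by (simp add: x_def t_def)
  ultimately have "padic_topnil (x ^ CARD('p) + closure_p * t)"
    by simp
  moreover have "padic_integral (- t)"
    using x by (simp add: t_def padic_integral_binomial_tail)
  ultimately have "padic_topnil (x ^ CARD('p) + closure_p * t + closure_p * (- t))"
    by (rule padic_topnil_add_p)
  then have "padic_topnil (x ^ CARD('p))"
    by simp
  then show ?case
    unfolding x_def by (rule padic_topnil_powerD) simp
qed

text \<open>Total ramification of degree \<open>d\<close>: if p has valuation 1, then
  \<open>x\<close> has valuation 1/d.\<close>

definition padic_uniformizer :: "nat \<Rightarrow> 'p::prime_card padic_closure \<Rightarrow> bool" where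
  "padic_uniformizer d x \<longleftrightarrow> d > 0 \<and> padic_topnil x \<and> (\<exists>w. padic_unit w \<and> x ^ d = closure_p * w)"

text \<open>For order p, expand (1 + x)^p = 1 and cancel \<open>x\<close>: what remains reads
  x^(p-1) = -p(1 + ...), where the bracket is a unit. For higher order put y = \<zeta>^p - 1, so
  that y = x^p + p x(1 + ...); as p is a multiple of \<open>y\<close>, x^p is \<open>y\<close> times
  a unit, which multiplies the ramification degree by p.\<close>

lemma padic_uniformizer_root_of_unity:
  fixes \<zeta> :: "'p::prime_card padic_closure"
  assumes "\<zeta> ^ (CARD('p) ^ Suc n) = 1" "\<zeta> ^ (CARD('p) ^ n) \<noteq> 1"
  shows "padic_uniformizer (CARD('p) ^ n * (CARD('p) - 1)) (\<zeta> - 1)"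
  using assms
proof (induction n arbitrary: \<zeta>)
  case 0
  define x where "x = \<zeta> - 1"
  have x: "padic_topnil x" "x \<noteq> 0"
    using padic_topnil_root_of_unity[of \<zeta> 1] 0 by (auto simp: x_def)
  have "1 = 1 + x ^ CARD('p) + closure_p * (x * (1 + x * binomial_tail CARD('p) x))"
    using prime_power_binomial[OF prime_CARD[where 'p='p], of x] 0 by (simp add: x_def)
  moreover have "x ^ CARD('p) = x * x ^ (CARD('p) - 1)"
    using CARD_gt_1[where 'p='p] by (simp flip: power_Suc)
  ultimately have "x * (x ^ (CARD('p) - 1) + closure_p * (1 + x * binomial_tail CARD('p) x)) = 0"
    by (simp add: algebra_simps)
  then have "x ^ (CARD('p) - 1) + closure_p * (1 + x * binomial_tail CARD('p) x) = 0"
    using x(2) by simp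
  then have "x ^ (CARD('p) - 1) = closure_p * (- (1 + x * binomial_tail CARD('p) x))"
    by (simp only: eq_neg_iff_add_eq_0 mult_minus_right)
  moreover have "padic_unit (- (1 + x * binomial_tail CARD('p) x))"
    using x(1) by (intro padic_unit_uminus padic_unit_1_plus_topnil padic_topnil_mult
        padic_integral_binomial_tail padic_topnil_integral)
  ultimately show ?case
    using x(1) CARD_gt_1[where 'p='p] by (auto simp: padic_uniformizer_def x_def)
next
  case (Suc n)
  let ?p = "CARD('p)"
  define x where "x = \<zeta> - 1"
  define y where "y = \<zeta> ^ ?p - 1"
  define d where "d = ?p ^ n * (?p - 1)"
  have x: "padic_topnil x"
    using padic_topnil_root_of_unity[of \<zeta> "Suc (Suc n)"] Suc.prems by (simp add: x_def)
  have ix: "padic_integral x"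
    using x by (rule padic_topnil_integral)
  have "padic_uniformizer d y"
    unfolding y_def d_def using Suc.prems by (intro Suc.IH) (simp_all add: power_mult)
  then obtain w where w: "d > 0" "padic_topnil y" "padic_unit w" "y ^ d = closure_p * w"
    by (auto simp: padic_uniformizer_def)
  then have "y \<noteq> 0"
    by (auto simp: zero_power padic_unit_def)
  define t where "t = 1 + x * binomial_tail ?p x"
  have t: "padic_integral t"
    using ix by (simp add: t_def padic_integral_binomial_tail)
  have "y = x ^ ?p + closure_p * (x * t)"
    using prime_power_binomial[OF prime_CARD[where 'p='p], of x] by (simp add: x_def y_def t_def)
  then have "x ^ ?p = y - closure_p * (x * t)"
    by simp
  \<comment> \<open>Exhibiting p as a multiple of \<open>y\<close> lets the term with p be absorbed
    into a unit factor of the form 1 + x(...).\<close>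
  also have "closure_p = y * (y ^ (d - 1) * inverse w)"
  proof -
    have "y * y ^ (d - 1) = closure_p * w"
      using w(1,4) by (simp flip: power_Suc)
    then have "y * (y ^ (d - 1) * inverse w) = closure_p * (w * inverse w)"
      by (simp flip: mult.assoc)
    moreover have "w * inverse w = 1"
      using w(3) by (simp add: padic_unit_def)
    ultimately show ?thesis
      by (simp only: mult_1_right)
  qed
  finally have "x ^ ?p = y * (1 + x * (- (y ^ (d - 1) * inverse w * t)))"
    by (simp add: algebra_simps)
  moreover define u where "u = 1 + x * (- (y ^ (d - 1) * inverse w * t))"
  ultimately have "x ^ ?p = y * u"
    by simp
  then have "x ^ (?p * d) = closure_p * (w * u ^ d)"
    by (simp add: power_mult power_mult_distrib w(4))
  moreover have "padic_unit u"
    unfolding u_def using w t padic_topnil_integral[OF w(2)]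
    by (intro padic_unit_1_plus_topnil padic_topnil_mult x padic_integral_uminus padic_integral_mult)
      (auto simp: padic_unit_def)
  then have "padic_unit (w * u ^ d)"
    using w by simp
  moreover have "?p * d > 0"
    using w CARD_gt_1[where 'p='p] by simp
  ultimately have "padic_uniformizer (?p * d) x"
    using x by (auto simp: padic_uniformizer_def)
  then show ?case
    by (simp add: x_def d_def mult.assoc)
qed

lemma padic_uniformizer_nonzero: "padic_uniformizer d x \<Longrightarrow> x \<noteq> 0"
  by (auto simp: padic_uniformizer_def zero_power padic_unit_def)

lemma padic_uniformizer_integral: "padic_uniformizer d x \<Longrightarrow> padic_integral x"
  by (simp add: padic_uniformizer_def padic_topnil_integral)

text \<open>Since \<open>p\<close> is a unit times \<open>x ^ d\<close>, the terms of valuation at least that of \<open>p\<close> and those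
  with exponent exceeding \<open>i\<close> do not affect the valuation.\<close>

lemma padic_uniformizer_leading_term:
  fixes c :: "nat \<Rightarrow> 'p::prime_card padic_int"
  assumes x: "padic_uniformizer d x" and i: "i < d" "i < N" "\<not> padic_p dvd c i"
    and c: "\<And>j. j < i \<Longrightarrow> padic_p dvd c j"
    and y: "padic_small 1 (y - (\<Sum>k<N. of_padic_int (c k) * x ^ k))"
  shows "\<exists>v. padic_unit v \<and> y = x ^ i * v"
proof -
  obtain w where w: "padic_unit w" "x ^ d = closure_p * w" and tx: "padic_topnil x"
    using x by (auto simp: padic_uniformizer_def)
  have ix: "padic_integral x"
    using tx by (rule padic_topnil_integral)
  define b where "b = (\<Sum>k\<in>{Suc i..<N}. of_padic_int (c k) * x ^ (k - Suc i))"
  have b: "padic_integral b"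
    using ix by (simp add: b_def padic_integral_sum)
  have "(\<Sum>k<N. of_padic_int (c k) * x ^ k) =
      (\<Sum>k<i. of_padic_int (c k) * x ^ k) + of_padic_int (c i) * x ^ i
      + (\<Sum>k\<in>{Suc i..<N}. of_padic_int (c k) * x ^ k)"
    using i sum.atLeastLessThan_concat[of 0 i N "\<lambda>k. of_padic_int (c k) * x ^ k"]
      sum.atLeast_Suc_lessThan[of i N "\<lambda>k. of_padic_int (c k) * x ^ k"]
    by (simp add: lessThan_atLeast0 add.assoc)
  also have "(\<Sum>k\<in>{Suc i..<N}. of_padic_int (c k) * x ^ k) = x ^ i * (x * b)"
    unfolding b_def sum_distrib_left
  proof (rule sum.cong[OF refl])
    fix k assume "k \<in> {Suc i..<N}"
    then have "k = Suc i + (k - Suc i)"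
      by simp
    then have "x ^ k = x ^ i * x * x ^ (k - Suc i)"
      by (metis power_add power_Suc2)
    then show "of_padic_int (c k) * x ^ k = x ^ i * (x * (of_padic_int (c k) * x ^ (k - Suc i)))"
      by (simp add: mult_ac)
  qed
  finally have "y = (y - (\<Sum>k<N. of_padic_int (c k) * x ^ k)) + (\<Sum>k<i. of_padic_int (c k) * x ^ k)
      + x ^ i * (of_padic_int (c i) + x * b)"
    by (simp add: algebra_simps)
  moreover have "padic_small 1 ((y - (\<Sum>k<N. of_padic_int (c k) * x ^ k)) + (\<Sum>k<i. of_padic_int (c k) * x ^ k))"
    using c ix by (intro padic_small_add y padic_small_sum padic_small_mult_left)
      (auto simp: padic_small_of_padic_int_iff)
  then obtain a where a: "padic_integral a"
    "(y - (\<Sum>k<N. of_padic_int (c k) * x ^ k)) + (\<Sum>k<i. of_padic_int (c k) * x ^ k) = closure_p * a"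
    by (auto simp: padic_small_iff)
  ultimately have y_eq: "y = closure_p * a + x ^ i * (of_padic_int (c i) + x * b)"
    by metis
  define u where "u = of_padic_int (c i)"
  have u: "padic_unit u"
    using i by (simp add: u_def padic_unit_of_padic_int padic_unit_iff)
  have "d = Suc i + (d - Suc i)"
    using i by simp
  then have "x ^ d = x ^ i * x * x ^ (d - Suc i)"
    by (metis power_add power_Suc2)
  then have "x ^ i * (x * (x ^ (d - Suc i) * inverse w)) = closure_p * (w * inverse w)"
    unfolding w(2) by (simp flip: mult.assoc)
  moreover have "w * inverse w = 1"
    using w(1) by (simp add: padic_unit_def)
  ultimately have p_eq: "closure_p = x ^ i * (x * (x ^ (d - Suc i) * inverse w))"
    by (simp only: mult_1_right)
  then have "y = x ^ i * (u * (1 + x * (inverse u * (b + x ^ (d - Suc i) * inverse w * a))))"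
  proof -
    have "y = x ^ i * (u + x * (b + x ^ (d - Suc i) * inverse w * a))"
      unfolding y_eq u_def[symmetric] by (subst p_eq) (simp add: ring_distribs mult_ac)
    moreover have "u * (1 + x * (inverse u * (b + x ^ (d - Suc i) * inverse w * a))) =
        u + (u * inverse u) * (x * (b + x ^ (d - Suc i) * inverse w * a))"
      by (simp only: ring_distribs mult_ac mult_1_left)
    ultimately show ?thesis
      using u by (simp add: padic_unit_def)
  qed
  moreover have "padic_unit (u * (1 + x * (inverse u * (b + x ^ (d - Suc i) * inverse w * a))))"
    using u w a b ix
    by (intro padic_unit_mult padic_unit_1_plus_topnil padic_topnil_mult tx) (auto simp: padic_unit_def)
  ultimately show ?thesis
    by blast
qed

text \<open>Otherwise let \<open>j\<close> be the first index with a unit coefficient. The number 0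
  differs from the sum by a multiple of p, so it would have leading term x^j, that is, be x^j times
  a unit.\<close>

lemma padic_uniformizer_small_sum:
  fixes c :: "nat \<Rightarrow> 'p::prime_card padic_int"
  assumes x: "padic_uniformizer d x" and y: "padic_small 1 (\<Sum>k<N. of_padic_int (c k) * x ^ k)"
    and i: "i < d" "i < N"
  shows "padic_p dvd c i"
proof (rule ccontr)
  assume "\<not> padic_p dvd c i"
  then have L: "\<not> padic_p dvd c (LEAST i. \<not> padic_p dvd c i)"
    and le: "(LEAST i. \<not> padic_p dvd c i) \<le> i"
    by (rule LeastI, rule Least_le)
  define j where "j = (LEAST i. \<not> padic_p dvd c i)"
  have c: "\<And>k. k < j \<Longrightarrow> padic_p dvd c k"
    using not_less_Least unfolding j_def by blast
  have small: "padic_small 1 (0 - (\<Sum>k<N. of_padic_int (c k) * x ^ k))"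
    using padic_small_uminus[OF y] by simp
  have j: "j < d" "j < N" "\<not> padic_p dvd c j"
    using L le i by (simp_all add: j_def)
  obtain v where "padic_unit v" "0 = x ^ j * v"
    using padic_uniformizer_leading_term[OF x j c small] by blast
  then show False
    using padic_uniformizer_nonzero[OF x] by (auto simp: padic_unit_def)
qed

lemma padic_poly_sum:
  assumes "degree h < N"
  shows "padic_poly h x = (\<Sum>k<N. of_padic_int (coeff h k) * x ^ k)"
proof -
  have "(\<Sum>k<N. of_padic_int (coeff h k) * x ^ k) = (\<Sum>k\<le>degree h. of_padic_int (coeff h k) * x ^ k)"
    using assms by (intro sum.mono_neutral_right) (auto simp: coeff_eq_0)
  then show ?thesis
    by (simp add: poly_altdef)
qed

text \<open>Linear independence of 1, x, ..., x^(d-1) over Z_p by descent: p divides every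
  coefficient, and the relation persists after division by p. It plays the part of irreducibility of
  the cyclotomic polynomial.\<close>

lemma padic_uniformizer_poly_eq_0:
  fixes h :: "'p::prime_card padic_int poly"
  assumes x: "padic_uniformizer d x" and h: "degree h < d" "padic_poly h x = 0"
  shows "h = 0"
proof (rule poly_eqI)
  fix i
  have dvd: "padic_p ^ m dvd coeff h i" for m
    using h
  proof (induction m arbitrary: h)
    case (Suc m)
    have "padic_p dvd coeff h k" for k
    proof (cases "k < d")
      case True
      then show ?thesis
        using padic_uniformizer_small_sum[OF x, of "coeff h" d k] Suc.prems padic_poly_sum[of h d x] by simp
    qed (use Suc.prems in \<open>simp add: coeff_eq_0\<close>)
    then have "[:padic_p:] dvd h"
      by (simp add: const_poly_dvd_iff)
    then obtain g where "h = [:padic_p:] * g" ..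
    then have g: "h = smult padic_p g"
      by simp
    have "degree g < d" "padic_poly g x = 0"
      using Suc.prems by (simp_all add: g hom_distribs)
    then have "padic_p ^ m dvd coeff g i"
      by (rule Suc.IH)
    then show ?case
      by (simp add: g mult_dvd_mono)
  qed simp
  then show "coeff h i = coeff 0 i"
    using padic_eq_0I[OF dvd] by simp
qed

text \<open>Pseudo-division scales the dividend by a power of the leading coefficient, here 1, so it
  is true division.\<close>

lemma monic_division:
  fixes f g :: "'a::idom poly"
  assumes "lead_coeff g = 1" "degree g > 0"
  shows "\<exists>q r. f = g * q + r \<and> degree r < degree g"
proof -
  obtain q r where qr: "pseudo_divmod f g = (q, r)"
    by fastforce
  have "g \<noteq> 0"
    using assms by auto
  then have "f = g * q + r" "r = 0 \<or> degree r < degree g"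
    using pseudo_divmod[OF _ qr] assms by auto
  then show ?thesis
    using assms by (intro exI[of _ q] exI[of _ r]) auto
qed

text \<open>The cyclotomic polynomial of order p^(n+1), translated so as to annihilate \<zeta> - 1
  instead of \<zeta>.\<close>

definition cyclotomic_shift :: "nat \<Rightarrow> nat \<Rightarrow> 'a::comm_ring_1 poly" where
  "cyclotomic_shift p n = (\<Sum>i<p. monom 1 (i * p ^ n)) \<circ>\<^sub>p [:1, 1:]"

lemma cyclotomic_shift_monic:
  assumes "p > 1"
  shows "lead_coeff (cyclotomic_shift p n :: 'a::idom poly) = 1"
    and "degree (cyclotomic_shift p n :: 'a::idom poly) = p ^ n * (p - 1)"
proof -
  define F :: "'a poly" where "F = (\<Sum>i<p. monom 1 (i * p ^ n))"
  have c: "coeff F ((p - 1) * p ^ n) = 1"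
  proof -
    have "coeff F ((p - 1) * p ^ n) = (\<Sum>i<p. if i = p - 1 then 1 else 0)"
      using assms by (auto simp: F_def coeff_sum intro!: sum.cong)
    then show ?thesis
      using assms by simp
  qed
  have "degree F \<le> (p - 1) * p ^ n"
    unfolding F_def
  proof (rule degree_sum_le)
    fix i assume "i \<in> {..<p}"
    then show "degree (monom 1 (i * p ^ n) :: 'a poly) \<le> (p - 1) * p ^ n"
      by (intro order_trans[OF degree_monom_le] mult_right_mono) auto
  qed simp
  then have d: "degree F = (p - 1) * p ^ n"
    using c by (metis le_degree le_antisym zero_neq_one)
  show "lead_coeff (cyclotomic_shift p n :: 'a poly) = 1"
    unfolding cyclotomic_shift_def F_def[symmetric] using c d by (subst lead_coeff_comp) simp_all
  show "degree (cyclotomic_shift p n :: 'a poly) = p ^ n * (p - 1)"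
    unfolding cyclotomic_shift_def F_def[symmetric] using d by (simp add: degree_pcompose mult.commute)
qed

lemma cyclotomic_shift_root:
  fixes \<zeta> :: "'p::prime_card padic_closure"
  assumes "\<zeta> ^ (CARD('p) ^ Suc n) = 1" "\<zeta> ^ (CARD('p) ^ n) \<noteq> 1"
  shows "padic_poly (cyclotomic_shift CARD('p) n) (\<zeta> - 1) = 0"
proof -
  let ?y = "\<zeta> ^ (CARD('p) ^ n)"
  have "padic_poly (cyclotomic_shift CARD('p) n) (\<zeta> - 1) = (\<Sum>i<CARD('p). ?y ^ i)"
    by (simp add: cyclotomic_shift_def hom_distribs of_padic.map_poly_pcompose poly_pcompose poly_sum
        poly_monom power_mult[symmetric] mult.commute)
  moreover have "(1 - ?y) * (\<Sum>i<CARD('p). ?y ^ i) = 1 - ?y ^ CARD('p)"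
    by (simp add: one_diff_power_eq)
  ultimately show ?thesis
    using assms by (simp add: power_mult[symmetric] mult.commute)
qed

text \<open>The remainder of \<open>h\<close> modulo the translated cyclotomic polynomial vanishes
  at \<zeta> - 1 and has degree below the ramification degree, so it is 0. Hence \<open>h\<close> is
  a multiple of a polynomial that vanishes at all conjugates.\<close>

lemma padic_poly_conjugate:
  fixes \<zeta> \<zeta>' :: "'p::prime_card padic_closure"
  assumes "\<zeta> ^ (CARD('p) ^ Suc n) = 1" "\<zeta> ^ (CARD('p) ^ n) \<noteq> 1"
    and "\<zeta>' ^ (CARD('p) ^ Suc n) = 1" "\<zeta>' ^ (CARD('p) ^ n) \<noteq> 1"
    and "padic_poly h (\<zeta> - 1) = 0"
  shows "padic_poly h (\<zeta>' - 1) = 0"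
proof -
  let ?\<Psi> = "cyclotomic_shift CARD('p) n :: 'p padic_int poly"
  note monic = cyclotomic_shift_monic[OF CARD_gt_1[where 'p='p], of n, where 'a="'p padic_int"]
  have "degree ?\<Psi> > 0"
    using monic CARD_gt_1[where 'p='p] by simp
  then obtain q r where h: "h = ?\<Psi> * q + r" and r: "degree r < degree ?\<Psi>"
    using monic_division monic(1) by blast
  have "padic_poly r (\<zeta> - 1) = 0"
    using assms(5) cyclotomic_shift_root[OF assms(1,2)] by (simp add: h hom_distribs)
  then have "r = 0"
    using padic_uniformizer_poly_eq_0[OF padic_uniformizer_root_of_unity[OF assms(1,2)]] r monic(2) by simp
  then show ?thesis
    using cyclotomic_shift_root[OF assms(3,4)] by (simp add: h hom_distribs)
qed

section \<open>Rings of integers of cyclotomic fields\<close>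

lemma ring_of_type_algebra_simps [simp]:
  "carrier ring_of_type_algebra = UNIV"
  "x \<otimes>\<^bsub>ring_of_type_algebra\<^esub> y = x * y"
  "x \<oplus>\<^bsub>ring_of_type_algebra\<^esub> y = x + y"
  "\<one>\<^bsub>ring_of_type_algebra\<^esub> = 1"
  "\<zero>\<^bsub>ring_of_type_algebra\<^esub> = 0"
  by (simp_all add: ring_of_type_algebra_def)

lemma type_ring_a_inv [simp]: "\<ominus>\<^bsub>ring_of_type_algebra\<^esub> (x :: 'a::field) = - x"
  unfolding a_inv_def m_inv_def by (rule the_equality) (auto simp: eq_neg_iff_add_eq_0)

lemma type_ring_m_inv [simp]: "(x :: 'a::field) \<noteq> 0 \<Longrightarrow> inv\<^bsub>ring_of_type_algebra\<^esub> x = inverse x"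
  unfolding m_inv_def by (rule the_equality) (auto intro: inverse_unique[symmetric])

lemma cyclo_field_1: "1 \<in> cyclo_field n"
  using generate_field.one[of ring_of_type_algebra] by (simp add: cyclo_field_def)

lemma cyclo_field_to_ac: "to_ac a \<in> cyclo_field n"
  unfolding cyclo_field_def by (rule generate_field.incl) auto

lemma cyclo_field_of_padic_int: "of_padic_int a \<in> cyclo_field n"
  unfolding of_padic_int_def by (rule cyclo_field_to_ac)

lemma cyclo_field_root_of_unity:
  "(\<zeta> :: 'p::prime_card padic_closure) ^ (CARD('p) ^ n) = 1 \<Longrightarrow> \<zeta> \<in> cyclo_field n"
  unfolding cyclo_field_def by (rule generate_field.incl) auto

lemma cyclo_field_uminus: "x \<in> cyclo_field n \<Longrightarrow> - x \<in> cyclo_field n"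
  using generate_field.a_inv[of x ring_of_type_algebra] by (simp add: cyclo_field_def)

lemma cyclo_field_add: "x \<in> cyclo_field n \<Longrightarrow> y \<in> cyclo_field n \<Longrightarrow> x + y \<in> cyclo_field n"
  using generate_field.eng_add[of x ring_of_type_algebra _ y] by (simp add: cyclo_field_def)

lemma cyclo_field_mult: "x \<in> cyclo_field n \<Longrightarrow> y \<in> cyclo_field n \<Longrightarrow> x * y \<in> cyclo_field n"
  using generate_field.eng_mult[of x ring_of_type_algebra _ y] by (simp add: cyclo_field_def)

lemma cyclo_field_0: "0 \<in> cyclo_field n"
  using cyclo_field_of_padic_int[of 0] by simp

lemma cyclo_field_inverse: "x \<in> cyclo_field n \<Longrightarrow> inverse x \<in> cyclo_field n"
  using generate_field.m_inv[of x ring_of_type_algebra]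
  by (cases "x = 0") (simp_all add: cyclo_field_def)

lemma cyclo_field_diff: "x \<in> cyclo_field n \<Longrightarrow> y \<in> cyclo_field n \<Longrightarrow> x - y \<in> cyclo_field n"
  using cyclo_field_add[OF _ cyclo_field_uminus, of x n y] by simp

lemma cyclo_field_divide: "x \<in> cyclo_field n \<Longrightarrow> y \<in> cyclo_field n \<Longrightarrow> x / y \<in> cyclo_field n"
  using cyclo_field_mult[OF _ cyclo_field_inverse, of x n y] by (simp add: divide_inverse)

lemma cyclo_field_power: "x \<in> cyclo_field n \<Longrightarrow> x ^ k \<in> cyclo_field n"
  by (induction k) (simp_all add: cyclo_field_1 cyclo_field_mult)

lemma cyclo_field_sum: "(\<And>i. i \<in> I \<Longrightarrow> f i \<in> cyclo_field n) \<Longrightarrow> sum f I \<in> cyclo_field n"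
  by (induction I rule: infinite_finite_induct) (simp_all add: cyclo_field_0 cyclo_field_add)

lemma cyclo_field_p: "(closure_p :: 'p::prime_card padic_closure) \<in> cyclo_field n"
  using cyclo_field_of_padic_int[of "padic_p :: 'p padic_int" n] by (simp add: of_padic.hom_of_nat)

lemma cyclo_field_padic_poly: "x \<in> cyclo_field n \<Longrightarrow> padic_poly h x \<in> cyclo_field n"
  by (simp add: poly_altdef cyclo_field_sum cyclo_field_mult cyclo_field_power cyclo_field_of_padic_int)

lemmas cyclo_field_closed = cyclo_field_0 cyclo_field_1 cyclo_field_of_padic_int cyclo_field_p
  cyclo_field_uminus cyclo_field_add cyclo_field_mult cyclo_field_inverse cyclo_field_diff
  cyclo_field_divide cyclo_field_power cyclo_field_sum cyclo_field_padic_poly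

definition cyclo_ints :: "nat \<Rightarrow> 'p::prime_card padic_closure set" where
  "cyclo_ints n = {x \<in> cyclo_field n. padic_integral x}"

lemma cyclo_ints_closed:
  "of_padic_int a \<in> cyclo_ints n" "0 \<in> cyclo_ints n" "1 \<in> cyclo_ints n"
  "x \<in> cyclo_ints n \<Longrightarrow> y \<in> cyclo_ints n \<Longrightarrow> x + y \<in> cyclo_ints n"
  "x \<in> cyclo_ints n \<Longrightarrow> y \<in> cyclo_ints n \<Longrightarrow> x - y \<in> cyclo_ints n"
  "x \<in> cyclo_ints n \<Longrightarrow> y \<in> cyclo_ints n \<Longrightarrow> x * y \<in> cyclo_ints n"
  "x \<in> cyclo_ints n \<Longrightarrow> x ^ k \<in> cyclo_ints n"
  "x \<in> cyclo_ints n \<Longrightarrow> padic_poly h x \<in> cyclo_ints n"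
  "(\<And>i. i \<in> I \<Longrightarrow> f i \<in> cyclo_ints n) \<Longrightarrow> sum f I \<in> cyclo_ints n"
  by (simp_all add: cyclo_ints_def cyclo_field_closed padic_integral_sum)

lemma cyclo_ints_root_of_unity:
  fixes \<zeta> :: "'p::prime_card padic_closure"
  assumes "\<zeta> ^ (CARD('p) ^ n) = 1"
  shows "\<zeta> \<in> cyclo_ints n"
  using assms padic_integral_powerD[of \<zeta> "CARD('p) ^ n"]
  by (simp add: cyclo_ints_def cyclo_field_root_of_unity)

text \<open>X^N - 1 has at most \<open>N\<close> roots, and the \<open>N\<close> distinct powers of
  a primitive root already provide that many.\<close>

lemma root_of_unity_powers:
  fixes \<xi> :: "'a::field"
  assumes "primitive_root_of_unity N \<xi>"
  shows "inj_on ((^) \<xi>) {..<N}" "{x. x ^ N = 1} = (^) \<xi> ` {..<N}"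
proof -
  have N: "N > 0" "\<xi> ^ N = 1" and *: "\<And>k. 0 < k \<Longrightarrow> k < N \<Longrightarrow> \<xi> ^ k \<noteq> 1"
    using assms by (auto simp: primitive_root_of_unity_def)
  have nz: "\<xi> \<noteq> 0"
    using N by (auto simp: zero_power)
  have "i = j" if "i \<le> j" "j < N" "\<xi> ^ i = \<xi> ^ j" for i j
  proof (rule ccontr)
    assume "i \<noteq> j"
    have "\<xi> ^ j = \<xi> ^ i * \<xi> ^ (j - i)"
      using that(1) by (simp flip: power_add)
    then have "\<xi> ^ (j - i) = 1"
      using nz that(3) by simp
    then show False
      using *[of "j - i"] that \<open>i \<noteq> j\<close> by simp
  qed
  then show inj: "inj_on ((^) \<xi>) {..<N}"
    by (intro inj_onI) (metis lessThan_iff nat_le_linear)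
  have "[:-1:] + monom 1 N \<noteq> (0 :: 'a poly)" "degree ([:-1:] + monom 1 N :: 'a poly) = N"
    using N(1) by (simp_all add: degree_add_eq_right degree_monom_eq)
      (metis coeff_add coeff_monom coeff_pCons_0 add_cancel_left_right coeff_0 neg_equal_0_iff_equal zero_neq_one order_less_irrefl)
  then have fin: "finite {x. x ^ N = (1 :: 'a)}" and card: "card {x. x ^ N = (1 :: 'a)} \<le> N"
    using poly_roots_finite[of "[:-1:] + monom 1 N :: 'a poly"]
      card_poly_roots_bound[of "[:-1:] + monom 1 N :: 'a poly"]
    by (simp_all add: poly_monom)
  have "(^) \<xi> ` {..<N} \<subseteq> {x. x ^ N = 1}"
    using N(2) by (auto simp: power_mult[symmetric] mult.commute) (metis power_mult power_one mult.commute)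
  then show "{x. x ^ N = 1} = (^) \<xi> ` {..<N}"
    using fin card inj by (metis card_image card_lessThan card_seteq)
qed

lemma primitive_root_of_unityD:
  fixes \<zeta> :: "'p::prime_card padic_closure"
  assumes "primitive_root_of_unity (CARD('p) ^ Suc n) \<zeta>"
  shows "\<zeta> ^ (CARD('p) ^ Suc n) = 1" "\<zeta> ^ (CARD('p) ^ n) \<noteq> 1"
proof -
  have "CARD('p) ^ n < CARD('p) ^ Suc n"
    using CARD_gt_1[where 'p='p] by (intro power_strict_increasing) auto
  then show "\<zeta> ^ (CARD('p) ^ Suc n) = 1" "\<zeta> ^ (CARD('p) ^ n) \<noteq> 1"
    using assms CARD_gt_1[where 'p='p] unfolding primitive_root_of_unity_def by auto
qed

text \<open>Z_p[\<zeta> - 1] with p inverted contains the generators and is already closed under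
  inverses.\<close>

lemma cyclo_field_cases:
  fixes \<zeta> x :: "'p::prime_card padic_closure"
  assumes \<zeta>: "primitive_root_of_unity (CARD('p) ^ Suc n) \<zeta>" and x: "x \<in> cyclo_field (Suc n)"
  obtains h k where "x = padic_poly h (\<zeta> - 1) / closure_p ^ k"
proof -
  define \<pi> where "\<pi> = \<zeta> - 1"
  have \<pi>: "padic_integral \<pi>"
    unfolding \<pi>_def
    by (rule padic_topnil_integral, rule padic_topnil_root_of_unity, rule primitive_root_of_unityD[OF \<zeta>])
  have "\<exists>h k. x = padic_poly h \<pi> / closure_p ^ k"
    using x unfolding cyclo_field_def
  proof (induction x rule: generate_field.induct)
    case one
    show ?case
      by (intro exI[of _ 1] exI[of _ 0]) simp
  next
    case (incl x)
    then consider a where "x = to_ac a" | "x ^ (CARD('p) ^ Suc n) = 1"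
      by auto
    then show ?case
    proof cases
      case 1
      obtain b c where bc: "a = Fract b c" "c \<noteq> 0"
        by (cases a)
      obtain k u where u: "c = padic_p ^ k * u" "u dvd 1"
        using bc(2) by (rule padic_factor)
      obtain w where w: "1 = u * w"
        using u(2) by (rule dvdE)
      have "a = to_fract b / to_fract c"
        using bc by (simp add: Fract_conv_to_fract)
      then have "x = of_padic_int b / of_padic_int c"
        by (simp add: 1 of_padic_int_def)
      also have "\<dots> = of_padic_int b / (closure_p ^ k * of_padic_int u)"
        by (simp add: u hom_distribs)
      also have "\<dots> = of_padic_int (b * w) / closure_p ^ k"
      proof -
        have "of_padic_int u * of_padic_int w = 1"
          by (simp flip: of_padic.hom_mult w)
        then have "of_padic_int u \<noteq> 0" "of_padic_int w = 1 / of_padic_int u"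
          by (auto simp: mult.commute intro!: eq_divide_imp)
        then show ?thesis
          by (simp add: hom_distribs)
      qed
      finally show ?thesis
        by (intro exI[of _ "[:b * w:]"] exI[of _ k]) (simp add: hom_distribs)
    next
      case 2
      then obtain j where "x = \<zeta> ^ j"
        using root_of_unity_powers(2)[OF \<zeta>] by auto
      then have "x = padic_poly ([:1, 1:] ^ j) \<pi> / closure_p ^ 0"
        by (simp add: \<pi>_def hom_distribs)
      then show ?thesis
        by blast
    qed
  next
    case (a_inv x)
    then obtain h k where "x = padic_poly h \<pi> / closure_p ^ k"
      by blast
    then have "- x = padic_poly (- h) \<pi> / closure_p ^ k"
      by (simp add: hom_distribs)
    then show ?case
      by auto
  next
    case (m_inv x)
    then obtain h k where x: "x = padic_poly h \<pi> / closure_p ^ k" "x \<noteq> 0"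
      by auto
    \<comment> \<open>The numerator is inverted, up to a power of p, by a polynomial in itself,
      which is again a polynomial in \<pi>.\<close>
    obtain s e where s: "padic_poly h \<pi> * padic_poly s (padic_poly h \<pi>) = closure_p ^ e"
      using padic_inverse_poly[of "padic_poly h \<pi>"] \<pi> x by auto
    then have "padic_poly s (padic_poly h \<pi>) \<noteq> 0"
      using closure_p_nonzero[where 'p='p] by (metis mult_zero_right power_not_zero)
    then have "inverse x = closure_p ^ k * padic_poly s (padic_poly h \<pi>) / closure_p ^ e"
      unfolding x(1) s[symmetric] by simp
    then have "inverse x = padic_poly (smult (padic_p ^ k) (s \<circ>\<^sub>p h)) \<pi> / closure_p ^ e"
      by (simp add: hom_distribs of_padic.map_poly_pcompose poly_pcompose)
    then show ?case
      using x(2) by auto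
  next
    case (eng_add x y)
    then obtain h k g l where "x = padic_poly h \<pi> / closure_p ^ k" "y = padic_poly g \<pi> / closure_p ^ l"
      by blast
    then have "x + y = padic_poly (smult (padic_p ^ l) h + smult (padic_p ^ k) g) \<pi> / closure_p ^ (k + l)"
      by (simp add: hom_distribs power_add add_frac_eq mult.commute)
    then show ?case
      by auto
  next
    case (eng_mult x y)
    then obtain h k g l where "x = padic_poly h \<pi> / closure_p ^ k" "y = padic_poly g \<pi> / closure_p ^ l"
      by blast
    then have "x * y = padic_poly (h * g) \<pi> / closure_p ^ (k + l)"
      by (simp add: hom_distribs power_add)
    then show ?case
      by auto
  qed
  then show thesis
    using that by (auto simp: \<pi>_def)
qed

text \<open>The uniformizer generates the ring of integers over Z_p. The numerator is reduced below
  the degree of the cyclotomic polynomial; integrality of the quotient then forces p to divide every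
  coefficient, and the denominator is cancelled one factor at a time.\<close>

lemma cyclo_ints_cases:
  fixes \<zeta> x :: "'p::prime_card padic_closure"
  assumes \<zeta>: "primitive_root_of_unity (CARD('p) ^ Suc n) \<zeta>" and x: "x \<in> cyclo_ints (Suc n)"
  obtains h where "degree h < CARD('p) ^ n * (CARD('p) - 1)" "x = padic_poly h (\<zeta> - 1)"
proof -
  define d where "d = CARD('p) ^ n * (CARD('p) - 1)"
  note \<zeta>' = primitive_root_of_unityD[OF \<zeta>]
  have u: "padic_uniformizer d (\<zeta> - 1)"
    unfolding d_def by (rule padic_uniformizer_root_of_unity[OF \<zeta>'])
  let ?\<Psi> = "cyclotomic_shift CARD('p) n :: 'p padic_int poly"
  note monic = cyclotomic_shift_monic[OF CARD_gt_1[where 'p='p], of n, where 'a="'p padic_int", folded d_def]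
  have d0: "d > 0"
    using u by (simp add: padic_uniformizer_def)
  obtain f k where f: "x = padic_poly f (\<zeta> - 1) / closure_p ^ k"
    using x by (auto simp: cyclo_ints_def elim: cyclo_field_cases[OF \<zeta>])
  obtain q r where qr: "f = ?\<Psi> * q + r" "degree r < degree ?\<Psi>"
    using monic_division[OF monic(1)] d0 monic(2) by metis
  have "\<exists>h. degree h < d \<and> padic_poly r (\<zeta> - 1) / closure_p ^ k = padic_poly h (\<zeta> - 1)"
    if "degree r < d" "padic_integral (padic_poly r (\<zeta> - 1) / closure_p ^ k)" for r
    using that
  proof (induction k arbitrary: r)
    case (Suc k)
    have "padic_small 1 (padic_poly r (\<zeta> - 1))"
      using Suc.prems(2) padic_small_mono[of "Suc k" "padic_poly r (\<zeta> - 1)" 1] by (simp add: padic_small_def)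
    then have "padic_p dvd coeff r i" for i
      using padic_uniformizer_small_sum[OF u, of "coeff r" d i] Suc.prems(1) padic_poly_sum[of r d]
      by (cases "i < d") (simp_all add: coeff_eq_0)
    then have "[:padic_p:] dvd r"
      by (simp add: const_poly_dvd_iff)
    then obtain g where "r = [:padic_p:] * g" ..
    then have g: "r = smult padic_p g"
      by simp
    then have "padic_poly r (\<zeta> - 1) / closure_p ^ Suc k = padic_poly g (\<zeta> - 1) / closure_p ^ k"
      by (simp add: hom_distribs)
    moreover have "degree g < d"
      using Suc.prems(1) by (simp add: g)
    ultimately show ?case
      using Suc.IH[of g] Suc.prems(2) by simp
  qed auto
  moreover have "x = padic_poly r (\<zeta> - 1) / closure_p ^ k"
    using f cyclotomic_shift_root[OF \<zeta>'] by (simp add: qr(1) hom_distribs)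
  ultimately obtain h where "degree h < d" "x = padic_poly h (\<zeta> - 1)"
    using qr(2) monic(2) x by (auto simp: cyclo_ints_def)
  then show thesis
    using that by (simp add: d_def)
qed

text \<open>Along a subsequence the m-th increment is p^m times a polynomial of bounded degree in
  the uniformizer, so the limit can be taken coefficient by coefficient in Z_p.\<close>

lemma cyclo_ints_complete:
  fixes \<zeta> :: "'p::prime_card padic_closure" and S :: "nat \<Rightarrow> 'p padic_closure"
  assumes \<zeta>: "primitive_root_of_unity (CARD('p) ^ Suc n) \<zeta>"
    and S: "\<And>N. S N \<in> cyclo_ints (Suc n)"
    and cauchy: "\<And>m. \<exists>M. \<forall>N\<ge>M. padic_small m (S N - S M)"
  shows "\<exists>y\<in>cyclo_ints (Suc n). padic_tendsto S y"
proof -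
  define d where "d = CARD('p) ^ n * (CARD('p) - 1)"
  have \<pi>: "\<zeta> - 1 \<in> cyclo_ints (Suc n)"
    using cyclo_ints_root_of_unity[of \<zeta> "Suc n"] primitive_root_of_unityD[OF \<zeta>]
    by (simp add: cyclo_ints_closed)
  obtain M where M: "\<And>m N. N \<ge> M m \<Longrightarrow> padic_small m (S N - S (M m))"
    using cauchy by metis
  have M2: "padic_small m (S N - S N')" if "N \<ge> M m" "N' \<ge> M m" for m N N'
    using padic_small_diff[OF M[OF that(1)] M[OF that(2)]] by simp
  \<comment> \<open>Summing the Cauchy moduli makes them monotone and keeps each at least
    \<open>M m\<close>.\<close>
  define L where "L m = (\<Sum>i\<le>m. M i)" for m
  have L: "M m \<le> L m" "L m \<le> L (Suc m)" for m
    by (auto simp: L_def member_le_sum)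
  have "\<exists>h. degree h < d \<and> S (L (Suc m)) - S (L m) = closure_p ^ m * padic_poly h (\<zeta> - 1)" for m
  proof -
    have "padic_small m (S (L (Suc m)) - S (L m))"
      using L[of m] by (intro M2) auto
    then obtain y where y: "padic_integral y" "S (L (Suc m)) - S (L m) = closure_p ^ m * y"
      by (auto simp: padic_small_iff)
    then have "y = (S (L (Suc m)) - S (L m)) / closure_p ^ m"
      by simp
    then have "y \<in> cyclo_ints (Suc n)"
      using y(1) S by (simp add: cyclo_ints_def cyclo_field_closed)
    then obtain h where "degree h < d" "y = padic_poly h (\<zeta> - 1)"
      unfolding d_def by (rule cyclo_ints_cases[OF \<zeta>])
    then show ?thesis
      using y(2) by auto
  qed
  then obtain h where h: "\<And>m. degree (h m) < d"
    "\<And>m. S (L (Suc m)) - S (L m) = closure_p ^ m * padic_poly (h m) (\<zeta> - 1)"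
    by metis
  have "\<exists>c. \<forall>m. padic_p ^ m dvd c - (\<Sum>k<m. padic_p ^ k * coeff (h k) i)" for i
    by (rule padic_sum_complete)
  then obtain c where c: "\<And>i m. padic_p ^ m dvd c i - (\<Sum>k<m. padic_p ^ k * coeff (h k) i)"
    by metis
  define y where "y = S (L 0) + (\<Sum>i<d. of_padic_int (c i) * (\<zeta> - 1) ^ i)"
  have y: "y \<in> cyclo_ints (Suc n)"
    unfolding y_def
    by (intro cyclo_ints_closed(4,9) S cyclo_ints_closed(6)[OF cyclo_ints_closed(1)]
        cyclo_ints_closed(7)[OF \<pi>])
  have tel: "S (L m) = S (L 0) + (\<Sum>k<m. closure_p ^ k * padic_poly (h k) (\<zeta> - 1))" for m
    by (induction m) (simp_all flip: h(2))
  have small: "padic_small m (S (L m) - y)" for m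
  proof -
    have "(\<Sum>k<m. closure_p ^ k * padic_poly (h k) (\<zeta> - 1)) =
        (\<Sum>k<m. \<Sum>i<d. closure_p ^ k * (of_padic_int (coeff (h k) i) * (\<zeta> - 1) ^ i))"
      by (simp add: padic_poly_sum[OF h(1)] sum_distrib_left)
    also have "\<dots> = (\<Sum>i<d. of_padic_int (\<Sum>k<m. padic_p ^ k * coeff (h k) i) * (\<zeta> - 1) ^ i)"
      by (subst sum.swap) (simp add: hom_distribs sum_distrib_right mult.assoc)
    finally have "y - S (L m) =
        (\<Sum>i<d. of_padic_int (c i - (\<Sum>k<m. padic_p ^ k * coeff (h k) i)) * (\<zeta> - 1) ^ i)"
      unfolding tel[of m] y_def by (simp add: of_padic.hom_minus left_diff_distrib sum_subtractf)
    also have "padic_small m \<dots>"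
      using c \<pi> by (intro padic_small_sum padic_small_mult_left)
        (auto simp: padic_small_of_padic_int_iff cyclo_ints_def)
    finally show ?thesis
      using padic_small_uminus by fastforce
  qed
  have "padic_small m (S N - y)" if "N \<ge> L m" for m N
    using padic_small_add[OF M2[of m N "L m"] small[of m]] that L[of m] by simp
  then have "padic_tendsto S y"
    unfolding padic_tendsto_small_iff eventually_sequentially by blast
  with y show ?thesis
    by blast
qed

section \<open>Embeddings and norms\<close>

lemma field_embeddings_hom:
  assumes "\<sigma> \<in> field_embeddings K L"
  shows "x \<in> K \<Longrightarrow> \<sigma> x = x"
    and "x \<in> L \<Longrightarrow> y \<in> L \<Longrightarrow> \<sigma> (x + y) = \<sigma> x + \<sigma> y"
    and "x \<in> L \<Longrightarrow> y \<in> L \<Longrightarrow> \<sigma> (x * y) = \<sigma> x * \<sigma> y"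
  using assms by (auto simp: field_embeddings_def Ring.ring_hom_def)

lemma field_embeddings_padic_poly:
  assumes \<sigma>: "\<sigma> \<in> field_embeddings (cyclo_field m) (cyclo_field n)" and x: "x \<in> cyclo_field n"
  shows "\<sigma> (padic_poly h x) = padic_poly h (\<sigma> x)"
proof (induction h)
  case 0
  then show ?case
    using field_embeddings_hom(1)[OF \<sigma> cyclo_field_0] by simp
next
  case (pCons a h)
  then show ?case
    using x field_embeddings_hom(1)[OF \<sigma> cyclo_field_of_padic_int]
    by (simp add: hom_distribs field_embeddings_hom(2,3)[OF \<sigma>] cyclo_field_closed)
qed

lemma field_embeddings_fraction:
  assumes \<sigma>: "\<sigma> \<in> field_embeddings (cyclo_field m) (cyclo_field n)" and x: "x \<in> cyclo_field n"
  shows "\<sigma> (padic_poly h x / closure_p ^ k) = padic_poly h (\<sigma> x) / closure_p ^ k"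
proof -
  have "\<sigma> (padic_poly h x / closure_p ^ k * closure_p ^ k) = \<sigma> (padic_poly h x / closure_p ^ k) * closure_p ^ k"
    using x field_embeddings_hom(1)[OF \<sigma>, of "closure_p ^ k"]
    by (subst field_embeddings_hom(3)[OF \<sigma>]) (simp_all add: cyclo_field_closed)
  then show ?thesis
    using field_embeddings_padic_poly[OF \<sigma> x, of h] by (simp add: field_simps)
qed

lemma field_embeddings_root:
  assumes \<sigma>: "\<sigma> \<in> field_embeddings (cyclo_field m) (cyclo_field n)" and \<zeta>: "\<zeta> \<in> cyclo_field n"
  shows "\<sigma> (\<zeta> - 1) = \<sigma> \<zeta> - 1"
  using field_embeddings_padic_poly[OF \<sigma> \<zeta>, of "[:- 1, 1:]"] by (simp add: hom_distribs)

text \<open>An embedding is determined by the image of \<zeta>. As \<zeta>^p lies in the smaller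
  field, this image has the same p-th power and is \<eta>\<zeta> for a p-th root of unity \<eta>.
  Conversely, replacing \<zeta> by \<eta>\<zeta> respects every relation over Z_p, because the two
  are conjugate.\<close>

lemma bij_betw_field_embeddings:
  fixes \<zeta> :: "'p::prime_card padic_closure"
  assumes \<zeta>: "primitive_root_of_unity (CARD('p) ^ Suc (Suc n)) \<zeta>"
    and \<zeta>p: "primitive_root_of_unity (CARD('p) ^ Suc n) (\<zeta> ^ CARD('p))"
  shows "bij_betw (\<lambda>\<sigma>. \<sigma> \<zeta> / \<zeta>) (field_embeddings (cyclo_field (Suc n)) (cyclo_field (Suc (Suc n))))
    {\<eta>. \<eta> ^ CARD('p) = 1}"
proof -
  let ?K = "cyclo_field (Suc n) :: 'p padic_closure set"
  let ?L = "cyclo_field (Suc (Suc n)) :: 'p padic_closure set"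
  note \<zeta>' = primitive_root_of_unityD[OF \<zeta>]
  have \<zeta>L: "\<zeta> \<in> ?L"
    using \<zeta>'(1) by (rule cyclo_field_root_of_unity)
  then have \<pi>L: "\<zeta> - 1 \<in> ?L"
    by (simp add: cyclo_field_closed)
  have nz: "\<zeta> \<noteq> 0"
    using \<zeta>'(1) by (auto simp: zero_power)
  have \<zeta>pK: "\<zeta> ^ CARD('p) \<in> ?K"
    using \<zeta>'(1) by (intro cyclo_field_root_of_unity) (simp add: power_mult)
  have inj: "\<sigma> = \<tau>" if \<sigma>: "\<sigma> \<in> field_embeddings ?K ?L" and \<tau>: "\<tau> \<in> field_embeddings ?K ?L"
    and eq: "\<sigma> \<zeta> = \<tau> \<zeta>" for \<sigma> \<tau>
  proof (rule extensionalityI[of _ ?L])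
    show "\<sigma> \<in> extensional ?L" "\<tau> \<in> extensional ?L"
      using \<sigma> \<tau> by (auto simp: field_embeddings_def)
    fix x assume "x \<in> ?L"
    then obtain h k where "x = padic_poly h (\<zeta> - 1) / closure_p ^ k"
      by (rule cyclo_field_cases[OF \<zeta>])
    then show "\<sigma> x = \<tau> x"
      using field_embeddings_fraction[OF \<sigma> \<pi>L] field_embeddings_fraction[OF \<tau> \<pi>L]
        field_embeddings_root[OF \<sigma> \<zeta>L] field_embeddings_root[OF \<tau> \<zeta>L] eq by simp
  qed
  have root: "(\<sigma> \<zeta> / \<zeta>) ^ CARD('p) = 1" if \<sigma>: "\<sigma> \<in> field_embeddings ?K ?L" for \<sigma>
  proof -
    have "padic_poly (monom 1 CARD('p)) (\<sigma> \<zeta>) = \<sigma> (padic_poly (monom 1 CARD('p)) \<zeta>)"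
      by (rule field_embeddings_padic_poly[OF \<sigma> \<zeta>L, symmetric])
    then have "\<sigma> \<zeta> ^ CARD('p) = \<zeta> ^ CARD('p)"
      using field_embeddings_hom(1)[OF \<sigma> \<zeta>pK] by (simp add: hom_distribs poly_monom)
    then show ?thesis
      using nz by (simp add: power_divide)
  qed
  have surj: "\<exists>\<sigma>\<in>field_embeddings ?K ?L. \<sigma> \<zeta> / \<zeta> = \<eta>" if \<eta>: "\<eta> ^ CARD('p) = 1" for \<eta>
  proof -
    define \<pi> \<pi>' where "\<pi> = \<zeta> - 1" and "\<pi>' = \<eta> * \<zeta> - 1"
    have \<eta>p: "\<eta> ^ (CARD('p) ^ Suc k) = 1" for k
      using \<eta> by (simp add: power_mult)
    have conj: "(\<eta> * \<zeta>) ^ (CARD('p) ^ Suc (Suc n)) = 1" "(\<eta> * \<zeta>) ^ (CARD('p) ^ Suc n) \<noteq> 1"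
      using \<zeta>' \<eta>p by (simp_all add: power_mult_distrib del: power_Suc)
    have zero: "padic_poly h \<pi>' = 0" if "padic_poly h \<pi> = 0" for h
      unfolding \<pi>'_def by (rule padic_poly_conjugate[OF \<zeta>' conj that[unfolded \<pi>_def]])
    \<comment> \<open>Well-definedness of the embedding to be constructed: clearing both
      denominators gives a polynomial relation at \<pi>, which transfers to the conjugate
      \<pi>'.\<close>
    have wd: "padic_poly h \<pi>' / closure_p ^ k = padic_poly g \<pi>' / closure_p ^ l"
      if "padic_poly h \<pi> / closure_p ^ k = padic_poly g \<pi> / closure_p ^ l" for h g k l
    proof -
      have "padic_poly (smult (padic_p ^ l) h - smult (padic_p ^ k) g) \<pi> = 0"
        using that by (simp add: hom_distribs field_simps)
      then have "padic_poly (smult (padic_p ^ l) h - smult (padic_p ^ k) g) \<pi>' = 0"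
        by (rule zero)
      then show ?thesis
        by (simp add: hom_distribs field_simps)
    qed
    define \<sigma> where "\<sigma> = (\<lambda>x\<in>?L. THE y. \<exists>h k. x = padic_poly h \<pi> / closure_p ^ k \<and> y = padic_poly h \<pi>' / closure_p ^ k)"
    have \<sigma>: "\<sigma> (padic_poly h \<pi> / closure_p ^ k) = padic_poly h \<pi>' / closure_p ^ k" for h k
    proof -
      have "padic_poly h \<pi> / closure_p ^ k \<in> ?L"
        using \<pi>L by (simp add: \<pi>_def cyclo_field_closed)
      moreover have "(THE y. \<exists>h' k'. padic_poly h \<pi> / closure_p ^ k = padic_poly h' \<pi> / closure_p ^ k' \<and>
          y = padic_poly h' \<pi>' / closure_p ^ k') = padic_poly h \<pi>' / closure_p ^ k"
      proof (rule the_equality)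
        fix y assume "\<exists>h' k'. padic_poly h \<pi> / closure_p ^ k = padic_poly h' \<pi> / closure_p ^ k' \<and>
          y = padic_poly h' \<pi>' / closure_p ^ k'"
        then obtain h' k' where "padic_poly h \<pi> / closure_p ^ k = padic_poly h' \<pi> / closure_p ^ k'"
          and y: "y = padic_poly h' \<pi>' / closure_p ^ k'"
          by blast
        from wd[OF this(1)] show "y = padic_poly h \<pi>' / closure_p ^ k"
          unfolding y ..
      qed blast
      ultimately show ?thesis
        unfolding \<sigma>_def by (simp only: restrict_apply if_True)
    qed
    have \<sigma>p: "\<sigma> (padic_poly h \<pi>) = padic_poly h \<pi>'" for h
      using \<sigma>[of h 0] by simp
    have "\<sigma> \<in> Ring.ring_hom (ring_of_type_algebra\<lparr>carrier := ?L\<rparr>) ring_of_type_algebra"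
    proof (rule ring_hom_memI; simp)
      fix x y assume "x \<in> ?L" "y \<in> ?L"
      then obtain h k g l where xy: "x = padic_poly h \<pi> / closure_p ^ k" "y = padic_poly g \<pi> / closure_p ^ l"
        unfolding \<pi>_def by (metis cyclo_field_cases[OF \<zeta>])
      have "x * y = padic_poly (h * g) \<pi> / closure_p ^ (k + l)"
        by (simp add: xy hom_distribs power_add)
      then show "\<sigma> (x * y) = \<sigma> x * \<sigma> y"
        by (simp only: \<sigma> xy) (simp add: hom_distribs power_add)
      have "x + y = padic_poly (smult (padic_p ^ l) h + smult (padic_p ^ k) g) \<pi> / closure_p ^ (k + l)"
        by (simp add: xy hom_distribs power_add add_frac_eq mult.commute)
      then show "\<sigma> (x + y) = \<sigma> x + \<sigma> y"
        by (simp only: \<sigma> xy) (simp add: hom_distribs power_add add_frac_eq mult.commute)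
    next
      show "\<sigma> 1 = 1"
        using \<sigma>p[of 1] by simp
    qed
    moreover have "\<sigma> x = x" if "x \<in> ?K" for x
    proof -
      obtain h k where x: "x = padic_poly h (\<zeta> ^ CARD('p) - 1) / closure_p ^ k"
        using \<open>x \<in> ?K\<close> by (rule cyclo_field_cases[OF \<zeta>p])
      \<comment> \<open>Turns a polynomial in \<zeta>^p - 1 into one in \<pi>; the inner polynomial
        (1 + X)^p - 1 takes the same value at \<pi> and \<pi>', so the element is fixed.\<close>
      define g where "g = h \<circ>\<^sub>p ([:1, 1:] ^ CARD('p) - 1)"
      have "padic_poly g \<pi> = padic_poly h (\<zeta> ^ CARD('p) - 1)"
        by (simp add: g_def \<pi>_def hom_distribs of_padic.map_poly_pcompose poly_pcompose)
      moreover have "padic_poly g \<pi>' = padic_poly h (\<zeta> ^ CARD('p) - 1)"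
        by (simp add: g_def \<pi>'_def hom_distribs of_padic.map_poly_pcompose poly_pcompose
            power_mult_distrib \<eta>)
      ultimately show ?thesis
        using \<sigma>[of g k] by (simp add: x)
    qed
    moreover have "\<sigma> \<in> extensional ?L"
      by (simp add: \<sigma>_def)
    moreover have "\<sigma> \<zeta> / \<zeta> = \<eta>"
      using \<sigma>p[of "[:1, 1:]"] nz by (simp add: hom_distribs \<pi>_def \<pi>'_def)
    ultimately show ?thesis
      by (intro bexI[of _ \<sigma>]) (auto simp: field_embeddings_def)
  qed
  show ?thesis
    unfolding bij_betw_def
  proof
    show "inj_on (\<lambda>\<sigma>. \<sigma> \<zeta> / \<zeta>) (field_embeddings ?K ?L)"
      using inj nz by (intro inj_onI) simp
    show "(\<lambda>\<sigma>. \<sigma> \<zeta> / \<zeta>) ` field_embeddings ?K ?L = {\<eta>. \<eta> ^ CARD('p) = 1}"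
      using root surj by (auto simp: image_iff)
  qed
qed

text \<open>Each embedding carries the value at \<zeta> - 1 to the value at the conjugate point
  because it is continuous: integral elements are polynomials in \<zeta> - 1 over Z_p, so their
  images are integral and divisibility by p^m is preserved.\<close>

lemma field_norm_fps_evaluates:
  fixes \<zeta> :: "'p::prime_card padic_closure"
  assumes \<zeta>: "primitive_root_of_unity (CARD('p) ^ Suc (Suc n)) \<zeta>"
    and \<zeta>p: "primitive_root_of_unity (CARD('p) ^ Suc n) (\<zeta> ^ CARD('p))"
    and y: "\<And>\<eta>. \<eta> ^ CARD('p) = 1 \<Longrightarrow> fps_evaluates f (\<eta> * \<zeta> - 1) (y \<eta>)"
    and y1: "y 1 \<in> cyclo_field (Suc (Suc n))"
  shows "field_norm (cyclo_field (Suc n)) (cyclo_field (Suc (Suc n))) (y 1) = (\<Prod>\<eta> | \<eta> ^ CARD('p) = 1. y \<eta>)"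
proof -
  let ?E = "field_embeddings (cyclo_field (Suc n)) (cyclo_field (Suc (Suc n))) :: ('p padic_closure \<Rightarrow> _) set"
  let ?L = "cyclo_field (Suc (Suc n)) :: 'p padic_closure set"
  note \<zeta>' = primitive_root_of_unityD[OF \<zeta>]
  note bij = bij_betw_field_embeddings[OF \<zeta> \<zeta>p]
  have \<zeta>L: "\<zeta> \<in> ?L"
    using \<zeta>'(1) by (rule cyclo_field_root_of_unity)
  then have \<pi>L: "\<zeta> - 1 \<in> ?L"
    by (simp add: cyclo_field_closed)
  have nz: "\<zeta> \<noteq> 0"
    using \<zeta>'(1) by (auto simp: zero_power)
  have "\<sigma> (y 1) = y (\<sigma> \<zeta> / \<zeta>)" if \<sigma>: "\<sigma> \<in> ?E" for \<sigma>
  proof -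
    define \<eta> where "\<eta> = \<sigma> \<zeta> / \<zeta>"
    have \<eta>: "\<eta> ^ CARD('p) = 1" "\<sigma> (\<zeta> - 1) = \<eta> * \<zeta> - 1"
      using bij_betwE[OF bij] \<sigma> nz by (auto simp: \<eta>_def field_embeddings_root[OF \<sigma> \<zeta>L])
    have "(\<eta> * \<zeta>) ^ (CARD('p) ^ Suc (Suc n)) = 1"
      using \<zeta>'(1) \<eta>(1) by (simp add: power_mult_distrib power_mult)
    then have \<pi>': "padic_integral (\<eta> * \<zeta> - 1)"
      by (intro padic_topnil_integral padic_topnil_root_of_unity)
    define S where "S x = (\<lambda>N. \<Sum>k<N. of_padic_int (f $ k) * x ^ k)" for x :: "'p padic_closure"
    define q where "q N = (\<Sum>k<N. monom (f $ k) k)" for N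
    have Sq: "S x N = padic_poly (q N) x" for x N
      by (simp add: S_def q_def hom_distribs poly_sum poly_monom)
    have "padic_tendsto (S (\<zeta> - 1)) (y 1)"
      using y[of 1] by (simp add: fps_evaluates_def padic_sums_def S_def)
    have "padic_tendsto (S (\<eta> * \<zeta> - 1)) (\<sigma> (y 1))"
      unfolding padic_tendsto_small_iff
    proof
      fix m
      have "\<forall>\<^sub>F N in sequentially. padic_small m (S (\<zeta> - 1) N - y 1)"
        using \<open>padic_tendsto (S (\<zeta> - 1)) (y 1)\<close> by (simp add: padic_tendsto_small_iff)
      then show "\<forall>\<^sub>F N in sequentially. padic_small m (S (\<eta> * \<zeta> - 1) N - \<sigma> (y 1))"
      proof (rule eventually_mono)
        fix N assume "padic_small m (S (\<zeta> - 1) N - y 1)"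
        moreover have SL: "S (\<zeta> - 1) N \<in> ?L"
          unfolding Sq using \<pi>L by (rule cyclo_field_padic_poly)
        moreover define t where "t = (S (\<zeta> - 1) N - y 1) / closure_p ^ m"
        ultimately have "t \<in> cyclo_ints (Suc (Suc n))"
          using y1 by (simp add: cyclo_ints_def padic_small_def cyclo_field_closed)
        then obtain h where h: "t = padic_poly h (\<zeta> - 1)"
          by (rule cyclo_ints_cases[OF \<zeta>])
        have "S (\<zeta> - 1) N = padic_poly (smult (padic_p ^ m) h) (\<zeta> - 1) + y 1"
          unfolding of_padic.map_poly_hom_smult poly_smult h[symmetric] by (simp add: t_def hom_distribs)
        then have "\<sigma> (S (\<zeta> - 1) N) = \<sigma> (padic_poly (smult (padic_p ^ m) h) (\<zeta> - 1)) + \<sigma> (y 1)"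
          using y1 \<pi>L by (simp add: field_embeddings_hom(2)[OF \<sigma>] cyclo_field_closed)
        then have "S (\<eta> * \<zeta> - 1) N - \<sigma> (y 1) = closure_p ^ m * padic_poly h (\<eta> * \<zeta> - 1)"
          unfolding Sq field_embeddings_padic_poly[OF \<sigma> \<pi>L] \<eta>(2) by (simp add: hom_distribs)
        then show "padic_small m (S (\<eta> * \<zeta> - 1) N - \<sigma> (y 1))"
          using \<pi>' by (auto simp: padic_small_iff)
      qed
    qed
    then have "fps_evaluates f (\<eta> * \<zeta> - 1) (\<sigma> (y 1))"
      by (simp add: fps_evaluates_def padic_sums_def S_def)
    then show ?thesis
      using y[OF \<eta>(1)] fps_evaluates_unique by (auto simp: \<eta>_def)
  qed
  then have "field_norm (cyclo_field (Suc n)) ?L (y 1) = (\<Prod>\<sigma>\<in>?E. y (\<sigma> \<zeta> / \<zeta>))"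
    unfolding field_norm_def by (rule prod.cong[OF refl])
  also have "\<dots> = (\<Prod>\<eta> | \<eta> ^ CARD('p) = 1. y \<eta>)"
    by (rule prod.reindex_bij_betw[OF bij])
  finally show ?thesis .
qed

section \<open>Evaluation of power series\<close>

no_notation vec_index (infixl "$" 100)

definition integral_fps :: "'p::prime_card padic_closure fps \<Rightarrow> bool" where
  "integral_fps F \<longleftrightarrow> (\<forall>j. padic_integral (F $ j))"

lemma integral_fps_closed:
  "integral_fps 0" "integral_fps 1" "padic_integral c \<Longrightarrow> integral_fps (fps_const c)" "integral_fps fps_X"
  "integral_fps (of_nat k)"
  "integral_fps F \<Longrightarrow> integral_fps G \<Longrightarrow> integral_fps (F + G)"
  "integral_fps F \<Longrightarrow> integral_fps G \<Longrightarrow> integral_fps (F - G)"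
  "integral_fps F \<Longrightarrow> integral_fps G \<Longrightarrow> integral_fps (F * G)"
  by (auto simp: integral_fps_def fps_X_def fps_of_nat[symmetric] fps_mult_nth intro!: padic_integral_sum
      simp del: fps_of_nat)

lemma integral_fps_power: "integral_fps F \<Longrightarrow> integral_fps (F ^ n)"
  by (induction n) (simp_all add: integral_fps_closed)

lemma integral_fps_sum: "(\<And>i. i \<in> I \<Longrightarrow> integral_fps (F i)) \<Longrightarrow> integral_fps (sum F I)"
  by (induction I rule: infinite_finite_induct) (simp_all add: integral_fps_closed)

text \<open>The ideals \<open>{F. fps_small m F}\<close> form a neighbourhood basis of 0 for the weak topology.\<close>

definition fps_small :: "nat \<Rightarrow> 'p::prime_card padic_closure fps \<Rightarrow> bool" where
  "fps_small m F \<longleftrightarrow> integral_fps F \<and> (\<forall>j\<le>m. padic_small m (F $ j))"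

lemma fps_small_0 [simp]: "fps_small m 0"
  by (simp add: fps_small_def integral_fps_closed)

lemma fps_small_add: "fps_small m F \<Longrightarrow> fps_small m G \<Longrightarrow> fps_small m (F + G)"
  by (simp add: fps_small_def integral_fps_closed)

lemma fps_small_diff: "fps_small m F \<Longrightarrow> fps_small m G \<Longrightarrow> fps_small m (F - G)"
  by (simp add: fps_small_def integral_fps_closed)

lemma fps_small_sum: "(\<And>i. i \<in> I \<Longrightarrow> fps_small m (F i)) \<Longrightarrow> fps_small m (sum F I)"
  by (induction I rule: infinite_finite_induct) (simp_all add: fps_small_add)

lemma fps_small_mult: "fps_small m F \<Longrightarrow> integral_fps G \<Longrightarrow> fps_small m (F * G)"
  by (auto simp: fps_small_def integral_fps_closed fps_mult_nth integral_fps_def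
      intro!: padic_small_sum padic_small_mult_left padic_integral_sum)

lemma fps_small_const: "padic_small m c \<Longrightarrow> fps_small m (fps_const c)"
  by (auto simp: fps_small_def padic_small_imp_integral integral_fps_closed)

lemma fps_small_X_power: "m < i \<Longrightarrow> fps_small m (fps_X ^ i)"
  unfolding fps_small_def by (intro conjI integral_fps_power integral_fps_closed) (simp add: fps_X_power_iff)

lemma fps_small_all_imp_0:
  assumes "\<And>m. fps_small m F"
  shows "F = 0"
proof (rule fps_ext)
  fix j
  have "padic_small m (F $ j)" for m
    using assms[of "max m j"] padic_small_mono[of "max m j" "F $ j" m] by (simp add: fps_small_def)
  then show "F $ j = 0 $ j"
    using padic_small_all_imp_0[of "F $ j"] by simp
qed

definition fps_partial_value ::
    "'p::prime_card padic_int fps \<Rightarrow> 'p padic_closure fps \<Rightarrow> nat \<Rightarrow> 'p padic_closure fps" where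
  "fps_partial_value f A N = (\<Sum>k<N. fps_const (of_padic_int (f $ k)) * A ^ k)"

text \<open>A constant \<open>A\<close> gives evaluation at a number, \<eta>(1+T)-1 gives a
  substitution. Convergence is in the weak topology, which controls finitely many coefficients
  p-adically at a time.\<close>

definition fps_has_value ::
    "'p::prime_card padic_int fps \<Rightarrow> 'p padic_closure fps \<Rightarrow> 'p padic_closure fps \<Rightarrow> bool" where
  "fps_has_value f A Y \<longleftrightarrow> (\<forall>m. \<forall>\<^sub>F N in sequentially. fps_small m (Y - fps_partial_value f A N))"

lemma fps_has_value_unique:
  assumes "fps_has_value f A Y" "fps_has_value f A B"
  shows "Y = B"
proof -
  have "fps_small m (Y - B)" for m
  proof -
    have "\<forall>\<^sub>F N in sequentially. fps_small m (Y - fps_partial_value f A N) \<and> fps_small m (B - fps_partial_value f A N)"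
      using assms by (auto simp: fps_has_value_def eventually_conj_iff)
    then obtain N where "fps_small m (Y - fps_partial_value f A N)" "fps_small m (B - fps_partial_value f A N)"
      by (auto simp: eventually_sequentially)
    then show ?thesis
      using fps_small_diff by fastforce
  qed
  then show ?thesis
    using fps_small_all_imp_0[of "Y - B"] by simp
qed

lemma fps_has_value_nth:
  assumes "fps_has_value f A Y"
  shows "padic_sums (\<lambda>k. of_padic_int (f $ k) * (A ^ k) $ j) (Y $ j)"
  unfolding padic_sums_def padic_tendsto_small_iff
proof
  fix m
  have "\<forall>\<^sub>F N in sequentially. fps_small (max m j) (Y - fps_partial_value f A N)"
    using assms by (simp add: fps_has_value_def)
  then show "\<forall>\<^sub>F N in sequentially. padic_small m ((\<Sum>k<N. of_padic_int (f $ k) * (A ^ k) $ j) - Y $ j)"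
  proof (rule eventually_mono)
    fix N assume "fps_small (max m j) (Y - fps_partial_value f A N)"
    then have "padic_small (max m j) ((Y - fps_partial_value f A N) $ j)"
      by (simp only: fps_small_def)
    then have "padic_small m ((Y - fps_partial_value f A N) $ j)"
      by (rule padic_small_mono) simp
    then have "padic_small m (- ((Y - fps_partial_value f A N) $ j))"
      by (rule padic_small_uminus)
    then show "padic_small m ((\<Sum>k<N. of_padic_int (f $ k) * (A ^ k) $ j) - Y $ j)"
      by (simp add: fps_partial_value_def fps_sum_nth)
  qed
qed

lemma fps_has_value_compose:
  assumes "fps_has_value f A Y"
  shows "padic_fps_compose (fps_of_padic_int f) A = Y"
proof (rule fps_ext)
  fix j
  have "padic_suminf (\<lambda>k. of_padic_int (f $ k) * (A ^ k) $ j) = Y $ j"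
    unfolding padic_suminf_def
  proof (rule the_equality)
    show "padic_sums (\<lambda>k. of_padic_int (f $ k) * (A ^ k) $ j) (Y $ j)"
      using assms by (rule fps_has_value_nth)
    then show "y = Y $ j" if "padic_sums (\<lambda>k. of_padic_int (f $ k) * (A ^ k) $ j) y" for y
      using that unfolding padic_sums_def by (metis padic_tendsto_unique)
  qed
  then show "padic_fps_compose (fps_of_padic_int f) A $ j = Y $ j"
    by (simp add: padic_fps_compose_def fps_of_padic_int_def)
qed

lemma fps_has_value_evaluates:
  assumes "fps_has_value f (fps_const x) Y"
  shows "fps_evaluates f x (Y $ 0)"
  using fps_has_value_nth[OF assms, of 0] by (simp add: fps_evaluates_def)

text \<open>The primitive root of unity makes \<open>cyclo_ints (Suc n)\<close> complete.\<close>

definition evaluation_point :: "nat \<Rightarrow> 'p::prime_card padic_closure fps \<Rightarrow> bool" where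
  "evaluation_point n A \<longleftrightarrow>
     (\<exists>\<zeta> :: 'p padic_closure. primitive_root_of_unity (CARD('p) ^ Suc n) \<zeta>) \<and>
     (\<forall>j. A $ j \<in> cyclo_ints (Suc n)) \<and> padic_topnil (A $ 0)"

lemma evaluation_point_integral: "evaluation_point n A \<Longrightarrow> integral_fps A"
  by (auto simp: evaluation_point_def integral_fps_def cyclo_ints_def)

text \<open>In the binomial expansion of A = x + X A', a summand is small either because X enters
  with exponent above \<open>m\<close> or because \<open>x\<close> enters with a large
  exponent.\<close>

lemma evaluation_point_power_small:
  assumes "evaluation_point n A"
  shows "\<exists>K. \<forall>k\<ge>K. fps_small m (A ^ k)"
proof -
  define x where "x = A $ 0"
  define A' where "A' = fps_shift 1 A"
  have A: "A = fps_X * A' + fps_const x"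
    by (rule fps_ext) (simp add: A'_def x_def)
  have A'_int: "integral_fps A'"
    using evaluation_point_integral[OF assms] by (simp add: integral_fps_def A'_def)
  have "padic_topnil x"
    using assms by (simp add: evaluation_point_def x_def)
  then have xi: "padic_integral x"
    by (rule padic_topnil_integral)
  obtain N where N: "padic_small 1 (x ^ N)"
    using \<open>padic_topnil x\<close> by (auto simp: padic_topnil_def)
  have Nm: "padic_small m (x ^ (N * m))" for m
    using padic_small_mult[OF N] by (induction m) (simp_all add: power_add)
  \<comment> \<open>With at most \<open>m\<close> factors X A', at least N m factors
    \<open>x\<close> remain, and these provide \<open>m\<close> factors p.\<close>
  have "fps_small m (A ^ k)" if k: "k \<ge> N * m + m" for k
  proof -
    have "A ^ k = (\<Sum>i\<le>k. of_nat (k choose i) * (fps_X * A') ^ i * fps_const x ^ (k - i))"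
      unfolding A by (rule binomial_ring)
    also have "fps_small m \<dots>"
    proof (rule fps_small_sum)
      fix i assume "i \<in> {..k}"
      show "fps_small m (of_nat (k choose i) * (fps_X * A') ^ i * fps_const x ^ (k - i))"
      proof (cases "m < i")
        case True
        have "fps_small m (fps_X ^ i * (of_nat (k choose i) * A' ^ i * fps_const x ^ (k - i)))"
          using A'_int xi
          by (intro fps_small_mult fps_small_X_power True integral_fps_closed integral_fps_power)
        then show ?thesis
          by (simp add: power_mult_distrib mult_ac)
      next
        case False
        then have "k - i = N * m + (k - i - N * m)"
          using k by simp
        then have "padic_small m (x ^ (k - i))"
          using padic_small_mult_left[OF Nm padic_integral_power[OF xi]] by (metis power_add)
        then have "fps_small m (fps_const (x ^ (k - i)) * (of_nat (k choose i) * (fps_X * A') ^ i))"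
          using A'_int
          by (intro fps_small_mult fps_small_const integral_fps_closed integral_fps_power)
        then show ?thesis
          by (simp add: fps_const_power mult_ac)
      qed
    qed
    finally show ?thesis .
  qed
  then show ?thesis
    by blast
qed

text \<open>Powers of an evaluation point tend to 0. Identities between values can therefore be
  proved by cutting a series off after an arbitrary number of terms.\<close>

lemma evaluation_point_vanish:
  assumes A: "evaluation_point n A" and F: "\<And>N. \<exists>G. integral_fps G \<and> F = A ^ N * G"
  shows "F = 0"
proof (rule fps_small_all_imp_0)
  fix m
  obtain K where "fps_small m (A ^ K)"
    using evaluation_point_power_small[OF A] by blast
  then show "fps_small m F"
    using F[of K] by (auto intro: fps_small_mult)
qed

lemma cyclo_ints_fps_mult:
  "(\<And>j. F $ j \<in> cyclo_ints n) \<Longrightarrow> (\<And>j. G $ j \<in> cyclo_ints n) \<Longrightarrow> (F * G) $ j \<in> cyclo_ints n"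
  by (simp add: fps_mult_nth cyclo_ints_closed)

lemma cyclo_ints_fps_power:
  "(\<And>j. F $ j \<in> cyclo_ints n) \<Longrightarrow> (F ^ k) $ j \<in> cyclo_ints n"
  by (induction k arbitrary: j) (simp_all add: cyclo_ints_closed cyclo_ints_fps_mult)

text \<open>The coefficients of the partial sums lie in a complete ring, and the tails are small
  because powers of the point tend to 0.\<close>

lemma fps_has_value_exists:
  assumes A: "evaluation_point n A"
  shows "\<exists>Y. fps_has_value f A Y \<and> (\<forall>j. Y $ j \<in> cyclo_ints (Suc n))"
proof -
  obtain \<zeta> where \<zeta>: "primitive_root_of_unity (CARD('a) ^ Suc n) (\<zeta> :: 'a padic_closure)"
    using A by (auto simp: evaluation_point_def)
  let ?S = "fps_partial_value f A"
  have XK: "A $ j \<in> cyclo_ints (Suc n)" for j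
    using A by (simp add: evaluation_point_def)
  have SK: "?S N $ j \<in> cyclo_ints (Suc n)" for N j
    unfolding fps_partial_value_def fps_sum_nth fps_mult_left_const_nth
    by (intro cyclo_ints_closed(9) cyclo_ints_closed(6)[OF cyclo_ints_closed(1)] cyclo_ints_fps_power XK)
  have cauchy: "\<exists>M. \<forall>N\<ge>M. padic_small m (?S N $ j - ?S M $ j)" for m j
  proof -
    obtain K where K: "\<And>k. k \<ge> K \<Longrightarrow> fps_small (max m j) (A ^ k)"
      using evaluation_point_power_small[OF A] by blast
    have "padic_small m (?S N $ j - ?S K $ j)" if "N \<ge> K" for N
    proof -
      have "?S N - ?S K = (\<Sum>k\<in>{K..<N}. A ^ k * fps_const (of_padic_int (f $ k)))"
        using sum.atLeastLessThan_concat[of 0 K N "\<lambda>k. fps_const (of_padic_int (f $ k)) * A ^ k"] that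
        by (simp add: fps_partial_value_def lessThan_atLeast0 algebra_simps)
      also have "fps_small (max m j) \<dots>"
        using K by (intro fps_small_sum fps_small_mult integral_fps_closed) auto
      finally have "padic_small (max m j) ((?S N - ?S K) $ j)"
        by (simp only: fps_small_def)
      then show ?thesis
        unfolding fps_sub_nth by (rule padic_small_mono) simp
    qed
    then show ?thesis
      by blast
  qed
  have "\<exists>y\<in>cyclo_ints (Suc n). padic_tendsto (\<lambda>N. ?S N $ j) y" for j
    using SK cauchy by (rule cyclo_ints_complete[OF \<zeta>])
  then obtain y where y: "\<And>j. y j \<in> cyclo_ints (Suc n)" "\<And>j. padic_tendsto (\<lambda>N. ?S N $ j) (y j)"
    by metis
  have "fps_has_value f A (Abs_fps y)"
    unfolding fps_has_value_def
  proof
    fix m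
    have "\<forall>\<^sub>F N in sequentially. \<forall>j\<in>{..m}. padic_small m (?S N $ j - y j)"
      using y(2) by (intro eventually_ball_finite) (auto simp: padic_tendsto_small_iff)
    then show "\<forall>\<^sub>F N in sequentially. fps_small m (Abs_fps y - ?S N)"
    proof (rule eventually_mono)
      fix N assume *: "\<forall>j\<in>{..m}. padic_small m (?S N $ j - y j)"
      have "padic_small m (y j - ?S N $ j)" if "j \<le> m" for j
        using * that padic_small_uminus[of m "?S N $ j - y j"] by simp
      then show "fps_small m (Abs_fps y - ?S N)"
        using y(1) SK by (simp add: fps_small_def integral_fps_def cyclo_ints_def)
    qed
  qed
  then show ?thesis
    using y(1) by (intro exI[of _ "Abs_fps y"]) simp
qed

definition fps_value :: "'p::prime_card padic_closure fps \<Rightarrow> 'p padic_int fps \<Rightarrow> 'p padic_closure fps" where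
  "fps_value A f = (THE Y. fps_has_value f A Y)"

lemma fps_value_eqI: "fps_has_value f A Y \<Longrightarrow> fps_value A f = Y"
  unfolding fps_value_def using fps_has_value_unique by blast

lemma fps_has_value_fps_value: "evaluation_point n A \<Longrightarrow> fps_has_value f A (fps_value A f)"
  using fps_has_value_exists fps_value_eqI by metis

lemma fps_value_cyclo_ints: "evaluation_point n A \<Longrightarrow> fps_value A f $ j \<in> cyclo_ints (Suc n)"
  using fps_has_value_exists fps_value_eqI by metis

lemma fps_value_integral: "evaluation_point n A \<Longrightarrow> integral_fps (fps_value A f)"
  using fps_value_cyclo_ints by (auto simp: integral_fps_def cyclo_ints_def)

section \<open>Evaluation as a ring homomorphism\<close>

lemma fps_cutoff_decomp:
  "f = (\<Sum>k<N. fps_const (f $ k) * fps_X ^ k) + fps_X ^ N * fps_shift N (f :: 'a::comm_ring_1 fps)"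
  by (rule fps_ext)
    (simp add: fps_sum_nth if_distrib fps_X_power_mult_nth fps_X_power_nth cong: if_cong)

context
  fixes n and A :: "'p::prime_card padic_closure fps"
  assumes A: "evaluation_point n A"
begin

text \<open>Common scheme for linear identities: the remainder of the candidate value is a
  combination of two remainders known to be small. The offset \<open>k\<close> absorbs the shift of
  the summation index caused by a factor X.\<close>

lemma fps_value_eqI_combination:
  assumes "integral_fps F" "integral_fps G"
    and "\<And>N. Y - fps_partial_value h A (N + k) =
      (fps_value A f - fps_partial_value f A N) * F + (fps_value A g - fps_partial_value g A N) * G"
  shows "fps_value A h = Y"
proof (rule fps_value_eqI, unfold fps_has_value_def, rule)
  fix m
  have "\<forall>\<^sub>F N in sequentially. fps_small m (fps_value A f - fps_partial_value f A N) \<and>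
      fps_small m (fps_value A g - fps_partial_value g A N)"
    using fps_has_value_fps_value[OF A] by (auto simp: fps_has_value_def eventually_conj_iff)
  then have "\<forall>\<^sub>F N in sequentially. fps_small m (Y - fps_partial_value h A (N + k))"
    by (rule eventually_mono) (simp add: assms fps_small_add fps_small_mult)
  then show "\<forall>\<^sub>F N in sequentially. fps_small m (Y - fps_partial_value h A N)"
    by (rule eventually_sequentially_seg[THEN iffD1])
qed

lemma fps_value_add: "fps_value A (f + g) = fps_value A f + fps_value A g"
  by (rule fps_value_eqI_combination[of 1 1 _ _ 0 f g])
    (simp_all add: integral_fps_closed fps_partial_value_def hom_distribs ring_distribs sum.distrib
      flip: fps_const_add)

lemma fps_value_const_mult: "fps_value A (fps_const a * f) = fps_const (of_padic_int a) * fps_value A f"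
proof (rule fps_value_eqI_combination[of "fps_const (of_padic_int a)" 0 _ _ 0 f f])
  have "fps_partial_value (fps_const a * f) A N = fps_const (of_padic_int a) * fps_partial_value f A N" for N
    by (simp add: fps_partial_value_def hom_distribs sum_distrib_left mult.assoc flip: fps_const_mult)
  then show "fps_const (of_padic_int a) * fps_value A f - fps_partial_value (fps_const a * f) A (N + 0) =
      (fps_value A f - fps_partial_value f A N) * fps_const (of_padic_int a)
      + (fps_value A f - fps_partial_value f A N) * 0" for N
    by (simp add: algebra_simps)
qed (simp_all add: integral_fps_closed)

lemma fps_value_1: "fps_value A 1 = 1"
proof (rule fps_value_eqI, unfold fps_has_value_def, rule)
  fix m
  have "fps_partial_value 1 A N = 1" if "N \<ge> 1" for N
  proof -
    have "fps_partial_value 1 A N = (\<Sum>k<N. if k = 0 then 1 else 0)"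
      unfolding fps_partial_value_def by (rule sum.cong) auto
    then show ?thesis
      using that by simp
  qed
  then show "\<forall>\<^sub>F N in sequentially. fps_small m (1 - fps_partial_value 1 A N)"
    by (intro eventually_sequentiallyI[of 1]) simp
qed

lemma fps_value_X_mult: "fps_value A (fps_X * f) = A * fps_value A f"
proof (rule fps_value_eqI_combination[of A 0 _ _ 1 f f])
  have "fps_partial_value (fps_X * f) A (Suc N) = A * fps_partial_value f A N" for N
    unfolding fps_partial_value_def sum.lessThan_Suc_shift by (simp add: sum_distrib_left mult_ac)
  then show "A * fps_value A f - fps_partial_value (fps_X * f) A (N + 1) =
      (fps_value A f - fps_partial_value f A N) * A + (fps_value A f - fps_partial_value f A N) * 0" for N
    by (simp add: algebra_simps)
qed (simp_all add: integral_fps_closed evaluation_point_integral[OF A])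

lemma fps_value_const: "fps_value A (fps_const a) = fps_const (of_padic_int a)"
  using fps_value_const_mult[of a 1] by (simp add: fps_value_1)

lemma fps_value_0: "fps_value A 0 = 0"
  using fps_value_const[of 0] by simp

lemma fps_value_sum: "fps_value A (sum f I) = (\<Sum>i\<in>I. fps_value A (f i))"
  by (induction I rule: infinite_finite_induct) (simp_all add: fps_value_0 fps_value_add)

lemma fps_value_X_power_mult: "fps_value A (fps_X ^ k * f) = A ^ k * fps_value A f"
  by (induction k) (simp_all add: fps_value_X_mult mult.assoc)

text \<open>Splitting \<open>N\<close> terms off \<open>f\<close> shows that the defect of
  multiplicativity for \<open>f\<close> and \<open>g\<close> is A^N times the defect for the tail of
  \<open>f\<close> and \<open>g\<close>. This holds for every \<open>N\<close>, so the defect is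
  0.\<close>

lemma fps_value_mult: "fps_value A (f * g) = fps_value A f * fps_value A g"
proof -
  have "fps_value A (f * g) - fps_value A f * fps_value A g = 0"
  proof (rule evaluation_point_vanish[OF A])
    fix N
    define h where "h = fps_shift N f"
    define s where "s = fps_partial_value f A N"
    have f: "f = (\<Sum>k<N. fps_const (f $ k) * fps_X ^ k) + fps_X ^ N * h"
      unfolding h_def by (rule fps_cutoff_decomp)
    have "fps_value A f = fps_value A (\<Sum>k<N. fps_const (f $ k) * (fps_X ^ k * 1)) + fps_value A (fps_X ^ N * h)"
      by (subst f) (simp add: fps_value_add)
    also have "\<dots> = s + A ^ N * fps_value A h"
      unfolding fps_value_sum fps_value_const_mult fps_value_X_power_mult fps_value_1
      by (simp add: s_def fps_partial_value_def)
    finally have 1: "fps_value A f = s + A ^ N * fps_value A h" .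
    have "f * g = (\<Sum>k<N. fps_const (f $ k) * (fps_X ^ k * g)) + fps_X ^ N * (h * g)"
      by (subst f) (simp add: ring_distribs sum_distrib_right mult.assoc)
    then have "fps_value A (f * g) = fps_value A (\<Sum>k<N. fps_const (f $ k) * (fps_X ^ k * g)) + fps_value A (fps_X ^ N * (h * g))"
      by (simp only: fps_value_add)
    also have "\<dots> = s * fps_value A g + A ^ N * fps_value A (h * g)"
      unfolding fps_value_sum fps_value_const_mult fps_value_X_power_mult
      by (simp add: s_def fps_partial_value_def sum_distrib_right mult.assoc)
    finally have "fps_value A (f * g) - fps_value A f * fps_value A g =
        A ^ N * (fps_value A (h * g) - fps_value A h * fps_value A g)"
      unfolding 1 by (simp add: algebra_simps)
    then show "\<exists>G. integral_fps G \<and> fps_value A (f * g) - fps_value A f * fps_value A g = A ^ N * G"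
      by (intro exI[of _ "fps_value A (h * g) - fps_value A h * fps_value A g"] conjI
          integral_fps_closed fps_value_integral[OF A])
  qed
  then show ?thesis
    by simp
qed

lemma comm_ring_hom_fps_value: "comm_ring_hom (fps_value A)"
  by unfold_locales (simp_all add: fps_value_0 fps_value_1 fps_value_add fps_value_mult)

end

lemma fps_value_cutoff:
  assumes A: "evaluation_point n A"
  shows "fps_value A f = fps_partial_value f A N + A ^ N * fps_value A (fps_shift N f)"
proof -
  have "fps_value A f = fps_value A (\<Sum>k<N. fps_const (f $ k) * (fps_X ^ k * 1)) + fps_value A (fps_X ^ N * fps_shift N f)"
    by (subst fps_cutoff_decomp[where f=f and N=N]) (simp add: fps_value_add[OF A])
  then show ?thesis
    unfolding fps_value_sum[OF A] fps_value_const_mult[OF A] fps_value_X_power_mult[OF A] fps_value_1[OF A]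
    by (simp add: fps_partial_value_def)
qed

text \<open>The first \<open>N\<close> terms of \<open>f\<close> substitute as a polynomial, so the
  defect is divisible by the N-th power of the value of \<open>g\<close>, which is an evaluation
  point itself.\<close>

lemma fps_value_compose:
  assumes A: "evaluation_point n A" and g0: "g $ 0 = 0" and B: "evaluation_point k (fps_value A g)"
  shows "fps_value A (f oo g) = fps_value (fps_value A g) f"
proof -
  interpret vX: comm_ring_hom "fps_value A"
    using A by (rule comm_ring_hom_fps_value)
  have "fps_value A (f oo g) - fps_value (fps_value A g) f = 0"
  proof (rule evaluation_point_vanish[OF B])
    fix N
    define h where "h = fps_shift N f"
    have "f oo g = ((\<Sum>k<N. fps_const (f $ k) * fps_X ^ k) + fps_X ^ N * h) oo g"
      unfolding h_def by (subst fps_cutoff_decomp[where f=f and N=N, symmetric]) simp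
    also have "\<dots> = (\<Sum>k<N. fps_const (f $ k) * g ^ k) + g ^ N * (h oo g)"
      using g0 by (simp add: fps_compose_add_distrib fps_compose_sum_distrib fps_compose_mult_distrib
          flip: fps_compose_power)
    finally have "fps_value A (f oo g) = fps_partial_value f (fps_value A g) N
        + fps_value A g ^ N * fps_value A (h oo g)"
      by (simp add: hom_distribs fps_value_const[OF A] fps_partial_value_def)
    then have "fps_value A (f oo g) - fps_value (fps_value A g) f =
        fps_value A g ^ N * (fps_value A (h oo g) - fps_value (fps_value A g) h)"
      unfolding fps_value_cutoff[OF B, of f N] h_def by (simp add: algebra_simps)
    then show "\<exists>G. integral_fps G \<and> fps_value A (f oo g) - fps_value (fps_value A g) f = fps_value A g ^ N * G"
      by (intro exI[of _ "fps_value A (h oo g) - fps_value (fps_value A g) h"] conjI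
          integral_fps_closed fps_value_integral[OF A] fps_value_integral[OF B])
  qed
  then show ?thesis
    by simp
qed

lemma fps_value_X: "evaluation_point n A \<Longrightarrow> fps_value A fps_X = A"
  using fps_value_X_mult[of n A 1] fps_value_1[of n A] by simp

text \<open>The point (1 + A)^p - 1 does not change when 1 + A is multiplied by a p-th root of
  unity, so coefficients in the image of phi have the same value at all the conjugate
  points.\<close>

lemma fps_value_padic_phi:
  fixes A :: "'p::prime_card padic_closure fps"
  assumes A: "evaluation_point n A" and B: "evaluation_point k ((1 + A) ^ CARD('p) - 1)"
  shows "fps_value A (padic_phi f) = fps_value ((1 + A) ^ CARD('p) - 1) f"
proof -
  interpret vX: comm_ring_hom "fps_value A"
    using A by (rule comm_ring_hom_fps_value)
  have "fps_value A ((1 + fps_X) ^ CARD('p) - 1) = (1 + A) ^ CARD('p) - 1"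
    by (simp add: hom_distribs fps_value_X[OF A])
  then show ?thesis
    unfolding padic_phi_def using fps_value_compose[OF A, of "(1 + fps_X) ^ CARD('p) - 1" k f] B
    by (simp add: fps_power_zeroth_eq_one)
qed

lemma evaluation_point_fps_X:
  fixes \<zeta> :: "'p::prime_card padic_closure"
  assumes "primitive_root_of_unity (CARD('p) ^ Suc n) \<zeta>"
  shows "evaluation_point n (fps_X :: 'p padic_closure fps)"
  unfolding evaluation_point_def
proof (intro conjI allI)
  show "\<exists>\<zeta> :: 'p padic_closure. primitive_root_of_unity (CARD('p) ^ Suc n) \<zeta>"
    using assms by blast
qed (auto simp: fps_X_def cyclo_ints_closed padic_topnil_def intro!: exI[of _ 1])

lemma fps_value_fps_X:
  fixes f :: "'p::prime_card padic_int fps"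
  assumes A: "evaluation_point n (fps_X :: 'p padic_closure fps)"
  shows "fps_value fps_X f = fps_of_padic_int f"
proof (rule fps_ext)
  fix j
  have eq: "fps_value fps_X f = fps_partial_value f fps_X (Suc j) + fps_X ^ Suc j * fps_value fps_X (fps_shift (Suc j) f)"
    using A by (rule fps_value_cutoff)
  have "fps_value fps_X f $ j = (fps_partial_value f fps_X (Suc j) + fps_X ^ Suc j * fps_value fps_X (fps_shift (Suc j) f)) $ j"
    by (simp only: eq[symmetric])
  also have "\<dots> = fps_partial_value f fps_X (Suc j) $ j"
    by (simp add: fps_X_power_mult_nth del: power_Suc)
  also have "\<dots> = (\<Sum>k<Suc j. if k = j then of_padic_int (f $ k) else 0)"
    unfolding fps_partial_value_def fps_sum_nth by (rule sum.cong) (auto simp: fps_X_power_iff)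
  also have "\<dots> = of_padic_int (f $ j)"
    by simp
  finally show "fps_value fps_X f $ j = fps_of_padic_int f $ j"
    by (simp add: fps_of_padic_int_def)
qed

section \<open>The norm operator\<close>

lemma fps_const_dvd_iff: "fps_const c dvd F \<longleftrightarrow> (\<forall>j. c dvd F $ j)" for c :: "'a::comm_ring_1"
proof
  assume "\<forall>j. c dvd F $ j"
  then obtain g where "\<And>j. F $ j = c * g j"
    unfolding dvd_def by metis
  then have "F = fps_const c * Abs_fps g"
    by (intro fps_ext) simp
  then show "fps_const c dvd F"
    by simp
qed (auto simp: fps_mult_left_const_nth elim!: dvdE)

lemma fps_p_power_dvd_iff:
  fixes F :: "'p::prime_card padic_int fps"
  shows "of_nat CARD('p) ^ k dvd F \<longleftrightarrow> (\<forall>j. padic_p ^ k dvd F $ j)"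
  by (simp add: fps_of_nat[symmetric] fps_const_power fps_const_dvd_iff del: fps_of_nat)

lemma fps_p_power_dvd_all_imp_0:
  fixes F :: "'p::prime_card padic_int fps"
  assumes "\<And>k. of_nat CARD('p) ^ k dvd F"
  shows "F = 0"
  using assms by (intro fps_ext) (auto simp: fps_p_power_dvd_iff intro: padic_eq_0I)

abbreviation phi_X :: "'p::prime_card padic_int fps" where
  "phi_X \<equiv> (1 + fps_X) ^ CARD('p) - 1"

lemma phi_X_nth_0 [simp]: "(phi_X :: 'p::prime_card padic_int fps) $ 0 = 0"
  by (simp add: fps_power_zeroth_eq_one)

section \<open>Z_p[[T]] as a module over the image of phi\<close>

lemma comm_ring_hom_padic_phi: "comm_ring_hom (padic_phi :: 'p::prime_card padic_int fps \<Rightarrow> _)"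
  by unfold_locales
    (simp_all add: padic_phi_def fps_compose_add_distrib fps_compose_mult_distrib del: fps_sub_nth)

interpretation phi: comm_ring_hom "padic_phi :: 'p::prime_card padic_int fps \<Rightarrow> _"
  by (rule comm_ring_hom_padic_phi)

lemma phi_X_cong: "of_nat CARD('p) dvd (phi_X - fps_X ^ CARD('p) :: 'p::prime_card padic_int fps)"
  by (simp add: prime_power_binomial[OF prime_CARD])

text \<open>The k-th powers of phi(T) and T^p differ by a multiple of phi(T) - T^p, which p
  divides.\<close>

lemma padic_phi_cong:
  fixes g :: "'p::prime_card padic_int fps"
  shows "of_nat CARD('p) dvd padic_phi g - (g oo fps_X ^ CARD('p))"
proof -
  have "padic_p dvd (padic_phi g - (g oo fps_X ^ CARD('p))) $ n" for n
  proof -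
    have "(padic_phi g - (g oo fps_X ^ CARD('p))) $ n =
        (\<Sum>k=0..n. g $ k * (phi_X ^ k - (fps_X ^ CARD('p)) ^ k) $ n)"
      by (simp add: padic_phi_def fps_compose_nth right_diff_distrib sum_subtractf)
    also have "padic_p dvd \<dots>"
    proof (intro dvd_sum dvd_mult)
      fix k
      have "phi_X - fps_X ^ CARD('p) dvd (phi_X ^ k - (fps_X ^ CARD('p)) ^ k :: 'p padic_int fps)"
        by (subst power_diff_sumr2) simp
      then have "of_nat CARD('p) dvd (phi_X ^ k - (fps_X ^ CARD('p)) ^ k :: 'p padic_int fps)"
        using phi_X_cong dvd_trans by blast
      then show "padic_p dvd (phi_X ^ k - (fps_X ^ CARD('p)) ^ k :: 'p padic_int fps) $ n"
        using fps_p_power_dvd_iff[of 1 "phi_X ^ k - (fps_X ^ CARD('p)) ^ k :: 'p padic_int fps"]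
        unfolding power_one_right by blast
    qed
    finally show ?thesis .
  qed
  then show ?thesis
    using fps_p_power_dvd_iff[of 1 "padic_phi g - (g oo fps_X ^ CARD('p))"] by simp
qed

lemma fps_compose_X_power_nth:
  fixes g :: "'a::comm_ring_1 fps"
  assumes "p > 0"
  shows "(g oo fps_X ^ p) $ n = (if p dvd n then g $ (n div p) else 0)"
proof -
  have "(g oo fps_X ^ p) $ n = (\<Sum>k=0..n. if p * k = n then g $ k else 0)"
    unfolding fps_compose_nth by (intro sum.cong) (auto simp flip: power_mult)
  also have "\<dots> = (if p dvd n then g $ (n div p) else 0)"
  proof (cases "p dvd n")
    case True
    then obtain m where m: "n = p * m" ..
    have "(\<Sum>k=0..n. if p * k = n then g $ k else 0) = (\<Sum>k=0..n. if k = m then g $ k else 0)"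
      using assms by (intro sum.cong) (auto simp: m)
    then show ?thesis
      using assms by (simp add: m)
  qed (auto intro!: sum.neutral)
  finally show ?thesis .
qed

text \<open>Modulo p, phi substitutes T^p for T, so the exponents of \<open>f\<close> need only be
  sorted by their residues modulo p.\<close>

lemma padic_phi_decomposition_mod_p:
  fixes f :: "'p::prime_card padic_int fps"
  shows "\<exists>c h. f = (\<Sum>i<CARD('p). padic_phi (c i) * fps_X ^ i) + of_nat CARD('p) * h"
proof -
  let ?p = "CARD('p)"
  have p: "?p > 0"
    using CARD_gt_1[where 'p='p] by simp
  define c where "c i = Abs_fps (\<lambda>n. f $ (n * ?p + i))" for i
  have f: "f = (\<Sum>i<?p. (c i oo fps_X ^ ?p) * fps_X ^ i)"
  proof (rule fps_ext)
    fix n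
    have "(\<Sum>i<?p. (c i oo fps_X ^ ?p) * fps_X ^ i) $ n =
        (\<Sum>i<?p. if i = n mod ?p then f $ n else 0)"
      unfolding fps_sum_nth
    proof (rule sum.cong[OF refl])
      fix i assume i: "i \<in> {..<?p}"
      have "i \<le> n \<and> ?p dvd (n - i) \<longleftrightarrow> i = n mod ?p"
        using i by (metis lessThan_iff mod_less mod_eq_dvd_iff_nat mod_less_eq_dividend dvd_minus_mod)
      moreover have "(n - i) div ?p * ?p + i = n" if "i = n mod ?p"
        using that by (simp add: minus_mod_eq_div_mult)
      moreover have "n mod ?p \<le> n"
        by simp
      ultimately show "((c i oo fps_X ^ ?p) * fps_X ^ i) $ n = (if i = n mod ?p then f $ n else 0)"
        using p by (auto simp: fps_X_power_mult_right_nth fps_compose_X_power_nth c_def simp del: mod_less_eq_dividend)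
    qed
    also have "\<dots> = f $ n"
      using p by simp
    finally show "f $ n = (\<Sum>i<?p. (c i oo fps_X ^ ?p) * fps_X ^ i) $ n" ..
  qed
  have "of_nat ?p dvd (\<Sum>i<?p. ((c i oo fps_X ^ ?p) - padic_phi (c i)) * fps_X ^ i)"
    using padic_phi_cong[where 'p='p] by (intro dvd_sum dvd_mult2) (metis dvd_minus_iff minus_diff_eq)
  then obtain h where h: "(\<Sum>i<?p. ((c i oo fps_X ^ ?p) - padic_phi (c i)) * fps_X ^ i) = of_nat ?p * h" ..
  have "f = (\<Sum>i<?p. padic_phi (c i) * fps_X ^ i) + of_nat ?p * h"
    unfolding h[symmetric] by (subst f) (simp flip: sum.distrib add: left_diff_distrib)
  then show ?thesis
    by blast
qed

text \<open>The decomposition modulo p is applied to the successive errors, and the resulting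
  corrections are summed p-adically in each coefficient.\<close>

lemma padic_phi_decomposition:
  fixes f :: "'p::prime_card padic_int fps"
  shows "\<exists>c. f = (\<Sum>i<CARD('p). padic_phi (c i) * fps_X ^ i)"
proof -
  let ?p = "CARD('p)"
  obtain C H where CH: "\<And>f :: 'p padic_int fps.
      f = (\<Sum>i<?p. padic_phi (C f i) * fps_X ^ i) + of_nat ?p * H f"
    using padic_phi_decomposition_mod_p by metis
  \<comment> \<open>The error after \<open>n\<close> rounds, already divided by p^n.\<close>
  define F where "F n = (H ^^ n) f" for n
  have F: "F n = (\<Sum>i<?p. padic_phi (C (F n) i) * fps_X ^ i) + of_nat ?p * F (Suc n)" for n
    using CH[of "F n"] by (simp add: F_def)
  have partial: "f = (\<Sum>i<?p. padic_phi (\<Sum>k<n. of_nat ?p ^ k * C (F k) i) * fps_X ^ i) + of_nat ?p ^ n * F n" for n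
  proof (induction n)
    case 0
    then show ?case
      by (simp add: F_def)
  next
    case (Suc n)
    have "of_nat ?p ^ n * F n = (\<Sum>i<?p. padic_phi (of_nat ?p ^ n * C (F n) i) * fps_X ^ i)
        + of_nat ?p ^ Suc n * F (Suc n)"
      by (subst F) (simp add: hom_distribs ring_distribs sum_distrib_left mult_ac)
    then show ?case
      by (subst Suc.IH) (simp add: hom_distribs ring_distribs sum.distrib)
  qed
  define s where "s i j = (SOME s. \<forall>n. padic_p ^ n dvd s - (\<Sum>k<n. padic_p ^ k * C (F k) i $ j))" for i j
  have s: "\<forall>n. padic_p ^ n dvd s i j - (\<Sum>k<n. padic_p ^ k * C (F k) i $ j)" for i j
    unfolding s_def using padic_sum_complete[of "\<lambda>k. C (F k) i $ j"] by (rule someI_ex)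
  define c where "c i = Abs_fps (s i)" for i
  have c: "of_nat ?p ^ n dvd c i - (\<Sum>k<n. of_nat ?p ^ k * C (F k) i)" for n i
    unfolding fps_p_power_dvd_iff
  proof
    fix j
    have "(c i - (\<Sum>k<n. of_nat ?p ^ k * C (F k) i)) $ j = s i j - (\<Sum>k<n. padic_p ^ k * C (F k) i $ j)"
      by (simp add: c_def fps_sum_nth fps_of_nat[symmetric] fps_const_power del: fps_of_nat)
    then show "padic_p ^ n dvd (c i - (\<Sum>k<n. of_nat ?p ^ k * C (F k) i)) $ j"
      using s by simp
  qed
  have "f - (\<Sum>i<?p. padic_phi (c i) * fps_X ^ i) = 0"
  proof (rule fps_p_power_dvd_all_imp_0)
    fix n
    have "(\<Sum>i<?p. padic_phi (c i) * fps_X ^ i) - f =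
        (\<Sum>i<?p. padic_phi (c i - (\<Sum>k<n. of_nat ?p ^ k * C (F k) i)) * fps_X ^ i) - of_nat ?p ^ n * F n"
      by (subst partial[of n]) (simp add: hom_distribs left_diff_distrib sum_subtractf)
    also have "of_nat ?p ^ n dvd \<dots>"
    proof (intro dvd_diff dvd_sum dvd_mult2)
      fix i
      obtain g where "c i - (\<Sum>k<n. of_nat ?p ^ k * C (F k) i) = of_nat ?p ^ n * g"
        using c by (rule dvdE)
      then show "of_nat ?p ^ n dvd padic_phi (c i - (\<Sum>k<n. of_nat ?p ^ k * C (F k) i))"
        by (simp only: phi.hom_mult phi.hom_power phi.hom_of_nat dvd_triv_left)
    qed simp
    finally show "of_nat ?p ^ n dvd f - (\<Sum>i<?p. padic_phi (c i) * fps_X ^ i)"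
      by (metis dvd_minus_iff minus_diff_eq)
  qed
  then show ?thesis
    by (intro exI[of _ c]) simp
qed

text \<open>The Vandermonde matrix \<open>V\<close> of the points satisfies A V = V D with
  \<open>D\<close> diagonal, and over a domain det V cancels because it is nonzero: a kernel vector
  of the transpose would be a nonzero polynomial of degree below \<open>n\<close> with
  \<open>n\<close> roots.\<close>

lemma det_eq_prod_vandermonde_eigenvalues:
  fixes A :: "'a::idom mat"
  assumes A: "A \<in> carrier_mat n n" and inj: "inj_on x {..<n}"
    and eig: "\<And>i k. i < n \<Longrightarrow> k < n \<Longrightarrow> (\<Sum>j<n. A $$ (i, j) * x k ^ j) = e k * x k ^ i"
  shows "det A = (\<Prod>k<n. e k)"
proof -
  define V where "V = mat n n (\<lambda>(j, k). x k ^ j)"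
  have V: "V \<in> carrier_mat n n"
    by (simp add: V_def)
  define D where "D = mat n n (\<lambda>(i, j). if i = j then e i else 0)"
  have D: "D \<in> carrier_mat n n"
    by (simp add: D_def)
  have "A * V = V * D"
  proof (rule eq_matI)
    fix i k assume "i < dim_row (V * D)" "k < dim_col (V * D)"
    then have ik: "i < n" "k < n"
      by (simp_all add: V_def D_def)
    have "(A * V) $$ (i, k) = (\<Sum>j<n. A $$ (i, j) * x k ^ j)"
      using A ik by (simp add: V_def scalar_prod_def lessThan_atLeast0)
    moreover have "(V * D) $$ (i, k) = (\<Sum>j<n. x j ^ i * (if j = k then e j else 0))"
      using ik by (simp add: V_def D_def scalar_prod_def lessThan_atLeast0)
    then have "(V * D) $$ (i, k) = x k ^ i * e k"
      using ik by (simp add: if_distrib[of "\<lambda>y. _ * y"] cong: if_cong)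
    ultimately show "(A * V) $$ (i, k) = (V * D) $$ (i, k)"
      using eig ik by (simp add: mult.commute)
  qed (use A in \<open>simp_all add: V_def D_def\<close>)
  then have "det V * det A = det V * det D"
    using det_mult[OF A V] det_mult[OF V D] by (simp only: mult.commute)
  moreover have "det V \<noteq> 0"
  proof
    assume "det V = 0"
    then have "det (transpose_mat V) = 0"
      using det_transpose[OF V] by simp
    then obtain v where v: "v \<in> carrier_vec n" "v \<noteq> 0\<^sub>v n" "transpose_mat V *\<^sub>v v = 0\<^sub>v n"
      using det_0_iff_vec_prod_zero[of "transpose_mat V" n] V by auto
    define q where "q = (\<Sum>j<n. monom (vec_index v j) j)"
    have coeff: "coeff q j = (if j < n then vec_index v j else 0)" for j
    proof -
      have "coeff q j = (\<Sum>i<n. if i = j then vec_index v i else 0)"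
        unfolding q_def coeff_sum by (rule sum.cong) simp_all
      then show ?thesis
        by simp
    qed
    have root: "poly q (x k) = 0" if "k < n" for k
    proof -
      have "poly q (x k) = vec_index (transpose_mat V *\<^sub>v v) k"
        using v(1) that by (simp add: q_def poly_sum poly_monom V_def scalar_prod_def lessThan_atLeast0 mult.commute)
      then show ?thesis
        using v(3) that by simp
    qed
    have "q \<noteq> 0"
    proof
      assume "q = 0"
      then have "vec_index v j = 0" if "j < n" for j
        using coeff[of j] that by simp
      then have "v = 0\<^sub>v n"
        using v(1) by (intro eq_vecI) auto
      with v(2) show False ..
    qed
    then have n: "n > 0"
      by (auto simp: q_def intro!: Nat.gr0I)
    have "degree q < n"
      using n coeff by (intro le_less_trans[OF degree_le[of "n - 1"]]) auto
    moreover have "card (x ` {..<n}) \<le> card {y. poly q y = 0}"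
      using root poly_roots_finite[OF \<open>q \<noteq> 0\<close>] by (intro card_mono) auto
    ultimately show False
      using card_poly_roots_bound[OF \<open>q \<noteq> 0\<close>] inj by (simp add: card_image)
  qed
  ultimately have "det A = det D"
    by (auto simp: mult.commute)
  also have "upper_triangular D"
    unfolding D_def by (rule upper_triangularI) simp
  then have "det D = prod_list (diag_mat D)"
    using D by (rule det_upper_triangular)
  also have "\<dots> = (\<Prod>k<n. e k)"
    by (simp add: prod_list_diag_prod D_def lessThan_atLeast0)
  finally show ?thesis .
qed

text \<open>Row \<open>i\<close> holds coordinates of f T^i. With this orientation the vector (1, a,
  ..., a^(p-1)) becomes a right eigenvector once the entries are evaluated.\<close>

definition padic_mult_matrix :: "'p::prime_card padic_int fps \<Rightarrow> 'p padic_int fps mat" where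
  "padic_mult_matrix f = (SOME M. M \<in> carrier_mat CARD('p) CARD('p) \<and>
     (\<forall>i<CARD('p). f * fps_X ^ i = (\<Sum>j<CARD('p). padic_phi (M $$ (i, j)) * fps_X ^ j)))"

lemma padic_mult_matrix:
  fixes f :: "'p::prime_card padic_int fps"
  shows "padic_mult_matrix f \<in> carrier_mat CARD('p) CARD('p)"
    and "i < CARD('p) \<Longrightarrow> f * fps_X ^ i = (\<Sum>j<CARD('p). padic_phi (padic_mult_matrix f $$ (i, j)) * fps_X ^ j)"
proof -
  define c where "c i = (SOME c. f * fps_X ^ i = (\<Sum>j<CARD('p). padic_phi (c j) * fps_X ^ j))" for i
  have c: "f * fps_X ^ i = (\<Sum>j<CARD('p). padic_phi (c i j) * fps_X ^ j)" for i
    unfolding c_def using padic_phi_decomposition[of "f * fps_X ^ i"] by (rule someI_ex)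
  have "\<exists>M. M \<in> carrier_mat CARD('p) CARD('p) \<and>
     (\<forall>i<CARD('p). f * fps_X ^ i = (\<Sum>j<CARD('p). padic_phi (M $$ (i, j)) * fps_X ^ j))"
    using c by (intro exI[of _ "mat CARD('p) CARD('p) (\<lambda>(i, j). c i j)"]) simp
  then have "padic_mult_matrix f \<in> carrier_mat CARD('p) CARD('p) \<and>
     (\<forall>i<CARD('p). f * fps_X ^ i = (\<Sum>j<CARD('p). padic_phi (padic_mult_matrix f $$ (i, j)) * fps_X ^ j))"
    unfolding padic_mult_matrix_def by (rule someI_ex)
  then show "padic_mult_matrix f \<in> carrier_mat CARD('p) CARD('p)"
    and "i < CARD('p) \<Longrightarrow> f * fps_X ^ i = (\<Sum>j<CARD('p). padic_phi (padic_mult_matrix f $$ (i, j)) * fps_X ^ j)"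
    by blast+
qed

text \<open>The norm of \<open>\<int>\<^sub>p[[T]]\<close> over \<open>\<phi>(\<int>\<^sub>p[[T]])\<close>, pulled back along \<open>\<phi>\<close>.\<close>

definition padic_fps_norm :: "'p::prime_card padic_int fps \<Rightarrow> 'p padic_int fps" where
  "padic_fps_norm f = det (padic_mult_matrix f)"

text \<open>The points \<open>\<eta> (1 + A) - 1\<close> all have the same image \<open>B\<close> under \<open>(1 + T) ^ p - 1\<close>, so their
  powers are eigenvectors of one and the same matrix.\<close>

lemma fps_value_padic_fps_norm:
  fixes A :: "'p::prime_card padic_closure fps" and \<xi> :: "'p padic_closure"
  assumes \<xi>: "primitive_root_of_unity CARD('p) \<xi>"
    and A: "padic_topnil (A $ 0)"
    and A\<eta>: "\<And>\<eta>. \<eta> ^ CARD('p) = 1 \<Longrightarrow> evaluation_point n (fps_const \<eta> * (1 + A) - 1)"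
    and B: "evaluation_point l ((1 + A) ^ CARD('p) - 1)"
  shows "fps_value ((1 + A) ^ CARD('p) - 1) (padic_fps_norm f) =
    (\<Prod>\<eta> | \<eta> ^ CARD('p) = 1. fps_value (fps_const \<eta> * (1 + A) - 1) f)"
proof -
  let ?B = "(1 + A) ^ CARD('p) - 1"
  let ?p = "CARD('p)"
  interpret vB: comm_ring_hom "fps_value ?B"
    using B by (rule comm_ring_hom_fps_value)
  define a where "a k = fps_const (\<xi> ^ k) * (1 + A) - 1" for k
  have root: "(\<xi> ^ k) ^ ?p = 1" for k
  proof -
    have "(\<xi> ^ k) ^ ?p = (\<xi> ^ ?p) ^ k"
      by (simp only: power_mult[symmetric] mult.commute)
    then show ?thesis
      using \<xi> by (simp add: primitive_root_of_unity_def)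
  qed
  have a: "evaluation_point n (a k)" for k
    unfolding a_def by (rule A\<eta>[OF root])
  have aB: "(1 + a k) ^ ?p - 1 = ?B" for k
    by (simp add: a_def power_mult_distrib fps_const_power root)
  have A1: "1 + A \<noteq> 0"
  proof
    assume "1 + A = 0"
    then have "1 + A $ 0 = 0"
      by (metis fps_add_nth fps_one_nth fps_zero_nth)
    then show False
      using padic_unit_1_plus_topnil[OF A] by (simp add: padic_unit_def)
  qed
  have "inj_on a {..<?p}"
    using root_of_unity_powers(1)[OF \<xi>] A1 by (auto simp: a_def inj_on_def)
  moreover have "map_mat (fps_value ?B) (padic_mult_matrix f) \<in> carrier_mat ?p ?p"
    using padic_mult_matrix(1) by simp
  moreover have "(\<Sum>j<?p. map_mat (fps_value ?B) (padic_mult_matrix f) $$ (i, j) * a k ^ j) = fps_value (a k) f * a k ^ i"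
    if "i < ?p" for i k
  proof -
    interpret va: comm_ring_hom "fps_value (a k)"
      using a by (rule comm_ring_hom_fps_value)
    have "evaluation_point l ((1 + a k) ^ ?p - 1)"
      unfolding aB by (rule B)
    then have phi: "fps_value (a k) (padic_phi m) = fps_value ?B m" for m
      using fps_value_padic_phi[OF a, of l k m] unfolding aB by blast
    have "fps_value (a k) f * a k ^ i = fps_value (a k) (f * fps_X ^ i)"
      by (simp add: hom_distribs fps_value_X[OF a])
    also have "\<dots> = (\<Sum>j<?p. fps_value ?B (padic_mult_matrix f $$ (i, j)) * a k ^ j)"
      unfolding padic_mult_matrix(2)[OF that] by (simp add: hom_distribs fps_value_X[OF a] phi)
    also have "\<dots> = (\<Sum>j<?p. map_mat (fps_value ?B) (padic_mult_matrix f) $$ (i, j) * a k ^ j)"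
      using that padic_mult_matrix(1)[of f] by (intro sum.cong) auto
    finally show ?thesis ..
  qed
  ultimately have "det (map_mat (fps_value ?B) (padic_mult_matrix f)) = (\<Prod>k<?p. fps_value (a k) f)"
    by (intro det_eq_prod_vandermonde_eigenvalues) auto
  also have "\<dots> = (\<Prod>\<eta> | \<eta> ^ CARD('p) = 1. fps_value (fps_const \<eta> * (1 + A) - 1) f)"
    unfolding root_of_unity_powers(2)[OF \<xi>]
    using prod.reindex[OF root_of_unity_powers(1)[OF \<xi>], of "\<lambda>\<eta>. fps_value (fps_const \<eta> * (1 + A) - 1) f"]
    by (simp add: a_def)
  finally show ?thesis
    by (simp add: padic_fps_norm_def vB.hom_det)
qed

text \<open>Composition with a nonzero series without constant term is injective, and phi(T) is
  nonzero because it is T^p modulo p.\<close>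

lemma padic_phi_eq_iff: "padic_phi f = padic_phi g \<longleftrightarrow> f = (g :: 'p::prime_card padic_int fps)"
proof -
  have "(phi_X :: 'p padic_int fps) \<noteq> 0"
  proof
    assume 0: "(phi_X :: 'p padic_int fps) = 0"
    have "of_nat CARD('p) ^ 1 dvd (0 - fps_X ^ CARD('p) :: 'p padic_int fps)"
      using phi_X_cong[where 'p='p] unfolding 0 by simp
    then have "padic_p ^ 1 dvd (0 - fps_X ^ CARD('p) :: 'p padic_int fps) $ CARD('p)"
      unfolding fps_p_power_dvd_iff by blast
    then have "padic_p dvd (1 :: 'p padic_int)"
      by simp
    then show False
      using padic_unit_iff by blast
  qed
  then have "padic_phi (f - g) = 0 \<longleftrightarrow> f - g = 0"
    unfolding padic_phi_def fps_compose_eq_0_iff[OF phi_X_nth_0] by blast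
  then show ?thesis
    by (simp add: hom_distribs)
qed

lemma fps_of_padic_int_eq_iff: "fps_of_padic_int f = fps_of_padic_int g \<longleftrightarrow> f = g"
  by (auto simp: fps_of_padic_int_def fps_eq_iff)

text \<open>Level 0 refers to the field generated by the p-th roots of unity, whose integers contain
  the coefficients of these points.\<close>

lemma evaluation_point_eta_X:
  fixes \<xi> \<eta> :: "'p::prime_card padic_closure"
  assumes \<xi>: "primitive_root_of_unity CARD('p) \<xi>" and \<eta>: "\<eta> ^ CARD('p) = 1"
  shows "evaluation_point 0 (fps_const \<eta> * (1 + fps_X) - 1)"
  unfolding evaluation_point_def
proof (intro conjI allI)
  show "\<exists>\<zeta> :: 'p padic_closure. primitive_root_of_unity (CARD('p) ^ Suc 0) \<zeta>"
    using \<xi> by auto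
  have "\<eta> \<in> cyclo_ints (Suc 0)"
    using \<eta> by (intro cyclo_ints_root_of_unity) simp
  then show "(fps_const \<eta> * (1 + fps_X) - 1) $ j \<in> cyclo_ints (Suc 0)" for j
    by (simp add: cyclo_ints_closed fps_X_def)
  show "padic_topnil ((fps_const \<eta> * (1 + fps_X) - 1) $ 0)"
    using padic_topnil_root_of_unity[of \<eta> 1] \<eta> by simp
qed

lemma evaluation_point_phi_X:
  fixes \<xi> :: "'p::prime_card padic_closure"
  assumes \<xi>: "primitive_root_of_unity CARD('p) \<xi>"
  shows "evaluation_point 0 ((1 + fps_X :: 'p padic_closure fps) ^ CARD('p) - 1)"
proof -
  have A: "evaluation_point 0 (fps_X :: 'p padic_closure fps)"
    using \<xi> by (intro evaluation_point_fps_X[of _ \<xi>]) simp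
  interpret v: comm_ring_hom "fps_value (fps_X :: 'p padic_closure fps)"
    using A by (rule comm_ring_hom_fps_value)
  have eq: "(1 + fps_X) ^ CARD('p) - 1 = fps_value (fps_X :: 'p padic_closure fps) phi_X"
    by (simp add: hom_distribs fps_value_X[OF A])
  show ?thesis
    unfolding evaluation_point_def
  proof (intro conjI allI)
    show "((1 + fps_X :: 'p padic_closure fps) ^ CARD('p) - 1) $ j \<in> cyclo_ints (Suc 0)" for j
      unfolding eq by (rule fps_value_cyclo_ints[OF A])
    show "padic_topnil (((1 + fps_X :: 'p padic_closure fps) ^ CARD('p) - 1) $ 0)"
      by (auto simp: fps_power_zeroth_eq_one padic_topnil_def intro!: exI[of _ 1])
  qed (use A in \<open>simp add: evaluation_point_def\<close>)
qed

text \<open>The general product formula at the point T, where evaluation merely includes the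
  coefficients into the closure.\<close>

lemma fps_of_padic_int_phi_norm:
  fixes \<xi> :: "'p::prime_card padic_closure" and f :: "'p padic_int fps"
  assumes \<xi>: "primitive_root_of_unity CARD('p) \<xi>"
  shows "fps_of_padic_int (padic_phi (padic_fps_norm f)) =
    (\<Prod>\<eta> | \<eta> ^ CARD('p) = 1. fps_value (fps_const \<eta> * (1 + fps_X) - 1) f)"
proof -
  have A: "evaluation_point 0 (fps_X :: 'p padic_closure fps)"
    using \<xi> by (intro evaluation_point_fps_X[of _ \<xi>]) simp
  have "fps_of_padic_int (padic_phi (padic_fps_norm f)) =
      fps_value ((1 + fps_X) ^ CARD('p) - 1) (padic_fps_norm f)"
    using fps_value_padic_phi[OF A evaluation_point_phi_X[OF \<xi>]] fps_value_fps_X[OF A] by simp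
  also have "\<dots> = (\<Prod>\<eta> | \<eta> ^ CARD('p) = 1. fps_value (fps_const \<eta> * (1 + fps_X) - 1) f)"
    by (rule fps_value_padic_fps_norm[OF \<xi> _ evaluation_point_eta_X[OF \<xi>] evaluation_point_phi_X[OF \<xi>]])
      (auto simp: padic_topnil_def intro!: exI[of _ 1])
  finally show ?thesis .
qed

text \<open>The matrices are arbitrary choices, so multiplicativity is read off the product formula,
  each factor being a ring homomorphism in the series, and pulled back along the injective
  phi.\<close>

lemma padic_fps_norm_mult:
  fixes \<xi> :: "'p::prime_card padic_closure" and f :: "'p padic_int fps"
  assumes \<xi>: "primitive_root_of_unity CARD('p) \<xi>"
  shows "padic_fps_norm (f * g) = padic_fps_norm f * padic_fps_norm g"
proof -
  have A: "evaluation_point 0 (fps_X :: 'p padic_closure fps)"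
    using \<xi> by (intro evaluation_point_fps_X[of _ \<xi>]) simp
  have "fps_of_padic_int (padic_phi (padic_fps_norm (f * g))) =
      fps_of_padic_int (padic_phi (padic_fps_norm f)) * fps_of_padic_int (padic_phi (padic_fps_norm g))"
    unfolding fps_of_padic_int_phi_norm[OF \<xi>] prod.distrib[symmetric]
    by (rule prod.cong[OF refl]) (simp add: fps_value_mult[OF evaluation_point_eta_X[OF \<xi>]])
  also have "\<dots> = fps_of_padic_int (padic_phi (padic_fps_norm f * padic_fps_norm g))"
    unfolding fps_value_fps_X[OF A, symmetric] phi.hom_mult fps_value_mult[OF A] ..
  finally show ?thesis
    by (simp only: fps_of_padic_int_eq_iff padic_phi_eq_iff)
qed

text \<open>The product identity determines the operator at each series, because phi and the
  inclusion of coefficients are injective; the determinant satisfies it and is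
  multiplicative.\<close>

lemma norm_operator_eq_padic_fps_norm:
  fixes \<xi> :: "'p::prime_card padic_closure"
  assumes \<xi>: "primitive_root_of_unity CARD('p) \<xi>"
  shows "(norm_operator :: 'p padic_int fps \<Rightarrow> _) = padic_fps_norm"
proof -
  have eq: "(\<Prod>\<eta> | \<eta> ^ CARD('p) = 1. padic_fps_compose (fps_of_padic_int f) (fps_const \<eta> * (1 + fps_X) - 1)) =
      fps_of_padic_int (padic_phi (padic_fps_norm f))" for f :: "'p padic_int fps"
    unfolding fps_of_padic_int_phi_norm[OF \<xi>]
    by (rule prod.cong[OF refl])
      (simp add: fps_has_value_compose[OF fps_has_value_fps_value[OF evaluation_point_eta_X[OF \<xi>]]])
  show ?thesis
    unfolding norm_operator_def eq fps_of_padic_int_eq_iff padic_phi_eq_iff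
    by (rule the_equality) (auto simp: padic_fps_norm_mult[OF \<xi>])
qed

section \<open>Congruences for the norm operator\<close>

lemma prime_dvd_power_add:
  fixes x y :: "'a::comm_ring_1"
  assumes "prime p"
  shows "of_nat p dvd (x + y) ^ p - x ^ p - y ^ p"
proof -
  have p: "p > 0"
    using assms prime_gt_0_nat by blast
  have "(x + y) ^ p = (\<Sum>k\<le>p. of_nat (p choose k) * x ^ k * y ^ (p - k))"
    by (rule binomial_ring)
  also have "{..p} = insert 0 (insert p {0<..<p})"
    using p by auto
  also have "(\<Sum>k\<in>\<dots>. of_nat (p choose k) * x ^ k * y ^ (p - k)) =
      y ^ p + (x ^ p + (\<Sum>k\<in>{0<..<p}. of_nat (p choose k) * x ^ k * y ^ (p - k)))"
    using p by simp
  finally have "(x + y) ^ p - x ^ p - y ^ p = (\<Sum>k\<in>{0<..<p}. of_nat (p choose k) * x ^ k * y ^ (p - k))"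
    by (simp add: algebra_simps)
  also have "of_nat p dvd \<dots>"
  proof (intro dvd_sum dvd_mult2)
    fix k assume "k \<in> {0<..<p}"
    then have "p dvd (p choose k)"
      using assms p by (intro dvd_choose_prime) auto
    then show "of_nat p dvd (of_nat (p choose k) :: 'a)"
      by (auto elim!: dvdE)
  qed
  finally show ?thesis .
qed

lemma padic_phi_const: "padic_phi (fps_const a) = fps_const a"
  by (simp add: padic_phi_def)

lemma padic_phi_X: "padic_phi fps_X = (phi_X :: 'p::prime_card padic_int fps)"
  unfolding padic_phi_def by (rule fps_X_fps_compose_startby0) (rule phi_X_nth_0)

text \<open>Induction on the number of coefficients. Splitting f = a + T g leaves Fermat's
  congruence for \<open>a\<close> and the claim for \<open>g\<close>, shifted by p places and hence
  about earlier coefficients.\<close>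

lemma padic_phi_frobenius:
  fixes f :: "'p::prime_card padic_int fps"
  shows "of_nat CARD('p) dvd f ^ CARD('p) - padic_phi f"
proof -
  let ?p = "CARD('p)"
  have p: "?p > 0"
    using CARD_gt_1[where 'p='p] by simp
  have "\<forall>j<n. padic_p dvd (f ^ ?p - padic_phi f) $ j" for n
  proof (induction n arbitrary: f)
    case (Suc n)
    define a where "a = f $ 0"
    define g where "g = fps_shift 1 f"
    have f: "f = fps_const a + fps_X * g"
      by (rule fps_ext) (simp add: a_def g_def)
    \<comment> \<open>Four errors: additivity of the p-th power, Fermat's congruence, the shifted
      induction hypothesis, and phi(T) against T^p.\<close>
    have "f ^ ?p - padic_phi f = (f ^ ?p - fps_const a ^ ?p - (fps_X * g) ^ ?p) + fps_const (a ^ ?p - a)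
        + fps_X ^ ?p * (g ^ ?p - padic_phi g) - (phi_X - fps_X ^ ?p) * padic_phi g"
    proof -
      have "padic_phi f = fps_const a + phi_X * padic_phi g"
        unfolding f by (simp add: hom_distribs padic_phi_const padic_phi_X)
      moreover have "fps_const (a ^ ?p - a) = fps_const a ^ ?p - fps_const a"
        by (simp add: fps_const_power)
      ultimately show ?thesis
        by (simp only: power_mult_distrib ring_distribs) (simp add: algebra_simps)
    qed
    moreover have "padic_p dvd (f ^ ?p - fps_const a ^ ?p - (fps_X * g) ^ ?p) $ j" for j
      using prime_dvd_power_add[OF prime_CARD[where 'p='p], of "fps_const a" "fps_X * g"]
        fps_p_power_dvd_iff[of 1 "f ^ ?p - fps_const a ^ ?p - (fps_X * g) ^ ?p"]
      unfolding f[symmetric] power_one_right by blast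
    moreover have "padic_p dvd fps_const (a ^ ?p - a) $ j" for j
      using padic_little_fermat[of a] by simp
    moreover have "padic_p dvd (fps_X ^ ?p * (g ^ ?p - padic_phi g)) $ j" if "j < Suc n" for j
    proof (cases "j < ?p")
      case False
      then have "j - ?p < n"
        using that p by linarith
      then show ?thesis
        using Suc.IH[of g] False by (simp add: fps_X_power_mult_nth)
    qed (simp add: fps_X_power_mult_nth)
    moreover have "padic_p dvd ((phi_X - fps_X ^ ?p) * padic_phi g) $ j" for j
      using dvd_mult2[OF phi_X_cong[where 'p='p], of "padic_phi g"]
        fps_p_power_dvd_iff[of 1 "(phi_X - fps_X ^ ?p) * padic_phi g"]
      unfolding power_one_right by blast
    ultimately show ?case
      by (simp only: fps_add_nth fps_sub_nth) (blast intro: dvd_add dvd_diff)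
  qed simp
  then show ?thesis
    using fps_p_power_dvd_iff[of 1 "f ^ ?p - padic_phi f"] unfolding power_one_right by blast
qed

lemma fps_p_nonzero: "(of_nat CARD('p) :: 'p::prime_card padic_int fps) \<noteq> 0"
  by (simp add: fps_of_nat[symmetric] del: fps_of_nat)

text \<open>Modulo p the coefficients of \<open>g\<close> reappear in phi(g) at the multiples of p,
  which settles one factor p; the others follow by cancellation.\<close>

lemma padic_phi_dvd_cancel:
  fixes g :: "'p::prime_card padic_int fps"
  assumes "of_nat CARD('p) ^ k dvd padic_phi g"
  shows "of_nat CARD('p) ^ k dvd g"
  using assms
proof (induction k arbitrary: g)
  case (Suc k)
  let ?p = "CARD('p)"
  have p: "?p > 0"
    using CARD_gt_1[where 'p='p] by simp
  have "of_nat ?p dvd padic_phi g"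
    using Suc.prems dvd_mult_left unfolding power_Suc by blast
  then have "of_nat ?p dvd padic_phi g - (padic_phi g - (g oo fps_X ^ ?p))"
    by (intro dvd_diff padic_phi_cong)
  then have "padic_p dvd (g oo fps_X ^ ?p) $ (n * ?p)" for n
    using fps_p_power_dvd_iff[of 1 "g oo fps_X ^ ?p"] by simp
  then have "padic_p dvd g $ n" for n
    using p by (simp add: fps_compose_X_power_nth)
  then have "of_nat ?p dvd g"
    using fps_p_power_dvd_iff[of 1 g] by simp
  then obtain h where h: "g = of_nat ?p * h" ..
  have "of_nat ?p * of_nat ?p ^ k dvd of_nat ?p * padic_phi h"
    using Suc.prems by (simp add: h hom_distribs)
  then have "of_nat ?p ^ k dvd padic_phi h"
    by (simp only: dvd_mult_cancel_left fps_p_nonzero) simp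
  then have "of_nat ?p ^ k dvd h"
    by (rule Suc.IH)
  then show ?case
    by (simp add: h mult_dvd_mono)
qed simp

lemma padic_uniformizer_p:
  fixes \<xi> :: "'p::prime_card padic_closure"
  assumes \<xi>: "primitive_root_of_unity CARD('p) \<xi>"
  shows "padic_uniformizer (CARD('p) - 1) (\<xi> - 1)"
proof -
  have "primitive_root_of_unity (CARD('p) ^ Suc 0) \<xi>"
    using \<xi> by simp
  from padic_uniformizer_root_of_unity[OF primitive_root_of_unityD[OF this]] show ?thesis
    by simp
qed

lemma padic_uniformizer_dvd_p:
  fixes x :: "'p::prime_card padic_closure"
  assumes "padic_uniformizer d x"
  shows "padic_integral (closure_p / x)"
proof -
  obtain w where w: "d > 0" "padic_unit w" "x ^ d = closure_p * w"
    using assms by (auto simp: padic_uniformizer_def)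
  have x: "x \<noteq> 0" "padic_integral x"
    using assms padic_uniformizer_nonzero padic_uniformizer_integral by blast+
  have "x * x ^ (d - 1) = closure_p * w"
    using w by (simp flip: power_Suc)
  then have "closure_p / x = x ^ (d - 1) * inverse w"
    using x w(2) by (simp add: padic_unit_def field_simps)
  then show ?thesis
    using x w(2) by (simp add: padic_unit_def)
qed

text \<open>As \<eta> is a power of \<xi>, the difference \<eta> - 1 is a multiple of \<xi> - 1, and
  so is the difference of the points \<eta>(1+T)-1 and T. Partial sums inherit this; the remainders
  are divisible by p, itself a multiple of \<xi> - 1.\<close>

lemma fps_value_eta_X_cong:
  fixes \<xi> \<eta> :: "'p::prime_card padic_closure" and g :: "'p padic_int fps"
  assumes \<xi>: "primitive_root_of_unity CARD('p) \<xi>" and \<eta>: "\<eta> ^ CARD('p) = 1"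
  shows "\<exists>G. integral_fps G \<and>
    fps_value (fps_const \<eta> * (1 + fps_X) - 1) g = fps_of_padic_int g + fps_const (\<xi> - 1) * G"
proof -
  let ?p = "CARD('p)"
  define \<pi> where "\<pi> = \<xi> - 1"
  define A where "A = fps_const \<eta> * (1 + fps_X) - 1"
  have \<pi>: "\<pi> \<noteq> 0" "padic_integral (closure_p / \<pi>)"
    using padic_uniformizer_p[OF \<xi>] padic_uniformizer_nonzero padic_uniformizer_dvd_p unfolding \<pi>_def by blast+
  have A: "evaluation_point 0 A"
    unfolding A_def by (rule evaluation_point_eta_X[OF \<xi> \<eta>])
  have T: "evaluation_point 0 (fps_X :: 'p padic_closure fps)"
    using \<xi> by (intro evaluation_point_fps_X[of _ \<xi>]) simp
  have \<xi>i: "padic_integral \<xi>"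
    using \<xi> by (intro padic_integral_powerD[of \<xi> ?p]) (auto simp: primitive_root_of_unity_def)
  obtain i where i: "\<eta> = \<xi> ^ i"
    using root_of_unity_powers(2)[OF \<xi>] \<eta> by auto
  have "\<eta> - 1 = \<pi> * (\<Sum>l<i. \<xi> ^ l)"
    unfolding i \<pi>_def by (rule power_diff_1_eq)
  then obtain s where s: "padic_integral s" "\<eta> - 1 = \<pi> * s"
    using \<xi>i by (metis padic_integral_sum padic_integral_power)
  have small: "padic_integral (x / \<pi>)" if "padic_small 1 x" for x
  proof -
    obtain y where "padic_integral y" "x = closure_p * y"
      using \<open>padic_small 1 x\<close> by (auto simp: padic_small_iff)
    then show ?thesis
      using \<pi>(2) padic_integral_mult[of "closure_p / \<pi>" y] by simp
  qed
  have "padic_integral ((fps_value A g - fps_of_padic_int g) $ j / \<pi>)" for j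
  proof -
    have "\<forall>\<^sub>F N in sequentially. fps_small (max 1 j) (fps_value A g - fps_partial_value g A N) \<and>
        fps_small (max 1 j) (fps_value fps_X g - fps_partial_value g fps_X N)"
      using fps_has_value_fps_value[OF A] fps_has_value_fps_value[OF T]
      by (auto simp: fps_has_value_def eventually_conj_iff)
    then obtain N where N: "fps_small (max 1 j) (fps_value A g - fps_partial_value g A N)"
      "fps_small (max 1 j) (fps_value fps_X g - fps_partial_value g fps_X N)"
      by (auto simp: eventually_sequentially)
    have nth: "padic_small 1 (F $ j)" if "fps_small (max 1 j) F" for F
      using that padic_small_mono[of "max 1 j" "F $ j" 1] by (simp add: fps_small_def)
    have "integral_fps A"
      using A by (rule evaluation_point_integral)
    define H where "H = (\<Sum>k<N. fps_const (of_padic_int (g $ k)) * (\<Sum>l<k. fps_X ^ (k - Suc l) * A ^ l))"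
    have "integral_fps ((1 + fps_X) * H)"
      unfolding H_def using \<open>integral_fps A\<close>
      by (intro integral_fps_closed integral_fps_sum integral_fps_power padic_integral_of_padic_int)
    have "A - fps_X = fps_const (\<eta> - 1) * (1 + fps_X)"
      by (simp add: A_def algebra_simps flip: fps_const_sub)
    moreover have "fps_partial_value g A N - fps_partial_value g fps_X N = (A - fps_X) * H"
      unfolding fps_partial_value_def H_def sum_subtractf[symmetric] sum_distrib_left[of "A - fps_X" _ "{..<N}"]
        right_diff_distrib[symmetric] power_diff_sumr2[of A _ fps_X]
      by (simp only: mult.left_commute)
    ultimately have "fps_partial_value g A N - fps_partial_value g fps_X N = fps_const (\<eta> - 1) * ((1 + fps_X) * H)"
      by (simp only: mult.assoc)
    then have "(fps_partial_value g A N - fps_partial_value g fps_X N) $ j / \<pi> = s * ((1 + fps_X) * H) $ j"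
      using \<pi>(1) by (simp add: s(2))
    then have 1: "padic_integral ((fps_partial_value g A N - fps_partial_value g fps_X N) $ j / \<pi>)"
      using s(1) \<open>integral_fps ((1 + fps_X) * H)\<close> by (simp add: integral_fps_def)
    have "(fps_value A g - fps_of_padic_int g) $ j / \<pi> =
        (fps_value A g - fps_partial_value g A N) $ j / \<pi>
        - (fps_value fps_X g - fps_partial_value g fps_X N) $ j / \<pi>
        + (fps_partial_value g A N - fps_partial_value g fps_X N) $ j / \<pi>"
      by (simp add: fps_value_fps_X[OF T] diff_divide_distrib)
    then show ?thesis
      using small[OF nth[OF N(1)]] small[OF nth[OF N(2)]] 1
      by (simp only:) (intro padic_integral_add padic_integral_diff)
  qed
  then have "integral_fps (Abs_fps (\<lambda>j. (fps_value A g - fps_of_padic_int g) $ j / \<pi>))"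
    by (simp add: integral_fps_def)
  moreover have "fps_value A g = fps_of_padic_int g +
      fps_const \<pi> * Abs_fps (\<lambda>j. (fps_value A g - fps_of_padic_int g) $ j / \<pi>)"
    using \<pi>(1) by (intro fps_ext) simp
  ultimately show ?thesis
    unfolding A_def \<pi>_def by blast
qed

lemma prod_add_mult_integral:
  fixes a c :: "'p::prime_card padic_closure fps"
  assumes "finite S" "integral_fps a" "integral_fps c" "\<And>i. i \<in> S \<Longrightarrow> integral_fps (G i)"
  shows "\<exists>H. integral_fps H \<and> (\<Prod>i\<in>S. a + c * G i) = a ^ card S + c * H"
  using assms
proof (induction S rule: finite_induct)
  case empty
  then show ?case
    by (intro exI[of _ 0]) (simp add: integral_fps_closed)
next
  case (insert i S)
  then obtain H where H: "integral_fps H" "(\<Prod>i\<in>S. a + c * G i) = a ^ card S + c * H"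
    by auto
  have "(\<Prod>i\<in>insert i S. a + c * G i) = a ^ card (insert i S) + c * (a * H + G i * (a ^ card S + c * H))"
    using insert.hyps by (simp add: H(2) ring_distribs mult_ac)
  moreover have "integral_fps (a * H + G i * (a ^ card S + c * H))"
    using H(1) insert.prems by (intro integral_fps_closed integral_fps_power) auto
  ultimately show ?case
    by blast
qed

text \<open>A multiple of the uniformizer is no unit, and p divides every non-unit of Z_p. Over Z_p
  a fractional gain in valuation thus becomes a whole factor p.\<close>

lemma padic_p_dvd_if_uniformizer_dvd:
  fixes b :: "'p::prime_card padic_int"
  assumes x: "padic_uniformizer d x" and y: "padic_integral y" and b: "of_padic_int b = closure_p ^ k * x * y"
  shows "padic_p ^ Suc k dvd b"
proof -
  have "padic_small k (of_padic_int b)"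
    using y padic_uniformizer_integral[OF x] unfolding padic_small_iff b
    by (intro exI[of _ "x * y"]) (simp add: mult.assoc)
  then obtain c where c: "b = padic_p ^ k * c"
    by (auto simp: padic_small_of_padic_int_iff elim: dvdE)
  then have xy: "of_padic_int c = x * y"
    using b by (simp add: hom_distribs)
  have "padic_p dvd c"
  proof (rule ccontr)
    assume "\<not> padic_p dvd c"
    then have "padic_unit (of_padic_int c)"
      by (simp add: padic_unit_iff padic_unit_of_padic_int)
    then have "padic_unit x"
      unfolding xy using y padic_uniformizer_integral[OF x] padic_unitD by blast
    then show False
      using not_padic_unit_topnil x by (auto simp: padic_uniformizer_def)
  qed
  then show ?thesis
    by (simp add: c mult_dvd_mono mult.commute)
qed

context
  fixes \<xi> :: "'p::prime_card padic_closure"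
  assumes \<xi>: "primitive_root_of_unity CARD('p) \<xi>"
begin

text \<open>Each factor of the product formula fixes the constant \<open>c\<close>, so it differs
  from \<open>f\<close> by a multiple of p^k(\<xi> - 1), and the product differs from f^p by such a
  multiple. The difference has coefficients in Z_p, where \<xi> - 1 improves to p.\<close>

lemma padic_fps_norm_cong_power:
  fixes f g :: "'p padic_int fps"
  assumes f: "f = fps_const c + of_nat CARD('p) ^ k * g"
  shows "of_nat CARD('p) ^ Suc k dvd padic_phi (padic_fps_norm f) - f ^ CARD('p)"
proof -
  let ?p = "CARD('p)"
  let ?R = "{\<eta> :: 'p padic_closure. \<eta> ^ ?p = 1}"
  define \<pi> where "\<pi> = \<xi> - 1"
  define V where "V \<eta> = fps_value (fps_const \<eta> * (1 + fps_X) - 1)" for \<eta> :: "'p padic_closure"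
  have T: "evaluation_point 0 (fps_X :: 'p padic_closure fps)"
    using \<xi> by (intro evaluation_point_fps_X[of _ \<xi>]) simp
  have "fps_value (fps_X :: 'p padic_closure fps) = fps_of_padic_int"
    by (rule ext) (rule fps_value_fps_X[OF T])
  then interpret vT: comm_ring_hom "fps_of_padic_int :: 'p padic_int fps \<Rightarrow> _"
    using comm_ring_hom_fps_value[OF T] by simp
  have card: "card ?R = ?p"
    using root_of_unity_powers[OF \<xi>] by (simp add: card_image)
  then have fin: "finite ?R"
    using CARD_gt_1[where 'p='p] by (intro card_ge_0_finite) simp
  have cT: "fps_of_padic_int (fps_const c) = fps_const (of_padic_int c)"
    using fps_value_const[OF T, of c] by (simp add: fps_value_fps_X[OF T])
  have "\<forall>\<eta>\<in>?R. \<exists>G. integral_fps G \<and> V \<eta> g = fps_of_padic_int g + fps_const \<pi> * G"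
    unfolding V_def \<pi>_def using fps_value_eta_X_cong[OF \<xi>] by blast
  then obtain G where G: "\<And>\<eta>. \<eta> \<in> ?R \<Longrightarrow> integral_fps (G \<eta>)"
    "\<And>\<eta>. \<eta> \<in> ?R \<Longrightarrow> V \<eta> g = fps_of_padic_int g + fps_const \<pi> * G \<eta>"
    by metis
  define C where "C = of_nat ?p ^ k * fps_const \<pi>"
  have V: "V \<eta> f = fps_of_padic_int f + C * G \<eta>" if "\<eta> \<in> ?R" for \<eta>
  proof -
    have A: "evaluation_point 0 (fps_const \<eta> * (1 + fps_X) - 1)"
      using that by (intro evaluation_point_eta_X[OF \<xi>]) simp
    interpret vA: comm_ring_hom "V \<eta>"
      unfolding V_def using A by (rule comm_ring_hom_fps_value)
    have "V \<eta> (fps_const c) = fps_const (of_padic_int c)"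
      unfolding V_def by (rule fps_value_const[OF A])
    then have "V \<eta> f = fps_const (of_padic_int c) + of_nat ?p ^ k * V \<eta> g"
      unfolding f by (simp add: hom_distribs)
    also have "\<dots> = fps_of_padic_int f + C * G \<eta>"
      unfolding G(2)[OF that] f by (simp add: hom_distribs cT C_def ring_distribs mult_ac)
    finally show ?thesis .
  qed
  have ints: "integral_fps (fps_of_padic_int f)" "integral_fps C"
  proof -
    have "padic_integral \<pi>"
      unfolding \<pi>_def by (rule padic_uniformizer_integral[OF padic_uniformizer_p[OF \<xi>]])
    then show "integral_fps C"
      unfolding C_def by (intro integral_fps_closed integral_fps_power)
  qed (simp add: integral_fps_def fps_of_padic_int_def)
  obtain H where H: "integral_fps H" "(\<Prod>\<eta>\<in>?R. fps_of_padic_int f + C * G \<eta>) = fps_of_padic_int f ^ ?p + C * H"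
    using prod_add_mult_integral[OF fin ints, of G, OF G(1)] unfolding card by blast
  have "fps_of_padic_int (padic_phi (padic_fps_norm f)) = (\<Prod>\<eta>\<in>?R. V \<eta> f)"
    unfolding V_def by (rule fps_of_padic_int_phi_norm[OF \<xi>])
  also have "\<dots> = fps_of_padic_int f ^ ?p + C * H"
    unfolding H(2)[symmetric] by (rule prod.cong) (simp_all add: V)
  finally have eq: "fps_of_padic_int (padic_phi (padic_fps_norm f) - f ^ ?p) = C * H"
    by (simp add: hom_distribs)
  show ?thesis
    unfolding fps_p_power_dvd_iff
  proof
    fix j
    have "C = fps_const (closure_p ^ k * \<pi>)"
      by (simp add: C_def fps_of_nat[symmetric] fps_const_power del: fps_of_nat)
    then have "(C * H) $ j = closure_p ^ k * \<pi> * H $ j"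
      by simp
    then have "of_padic_int ((padic_phi (padic_fps_norm f) - f ^ ?p) $ j) = closure_p ^ k * \<pi> * H $ j"
      using arg_cong[OF eq, of "\<lambda>F. F $ j"] by (simp add: fps_of_padic_int_def)
    then show "padic_p ^ Suc k dvd (padic_phi (padic_fps_norm f) - f ^ ?p) $ j"
      using H(1) padic_p_dvd_if_uniformizer_dvd[OF padic_uniformizer_p[OF \<xi>]]
      unfolding integral_fps_def \<pi>_def by blast
  qed
qed

text \<open>For k = 0 every series has the required shape, so f^p is congruent both to phi of the
  norm and to phi(f) modulo p; phi then cancels.\<close>

lemma padic_fps_norm_cong:
  fixes f :: "'p padic_int fps"
  shows "of_nat CARD('p) dvd padic_fps_norm f - f"
proof -
  have "of_nat CARD('p) dvd padic_phi (padic_fps_norm f) - f ^ CARD('p)"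
    using padic_fps_norm_cong_power[of f 0 0 f] by simp
  then have "of_nat CARD('p) dvd (padic_phi (padic_fps_norm f) - f ^ CARD('p)) + (f ^ CARD('p) - padic_phi f)"
    using padic_phi_frobenius by (rule dvd_add)
  then have "of_nat CARD('p) ^ 1 dvd padic_phi (padic_fps_norm f - f)"
    by (simp add: hom_distribs)
  then show ?thesis
    using padic_phi_dvd_cancel[of 1 "padic_fps_norm f - f"] by simp
qed

text \<open>Two gains of one factor p meet: phi of the norm agrees with f^p modulo p^(k+2), and the
  p-th power of 1 + p^(k+1) g is 1 modulo p^(k+2).\<close>

lemma padic_fps_norm_cong_1:
  fixes f :: "'p padic_int fps"
  assumes "of_nat CARD('p) ^ Suc k dvd f - 1"
  shows "of_nat CARD('p) ^ Suc (Suc k) dvd padic_fps_norm f - 1"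
proof -
  let ?p = "CARD('p)"
  let ?q = "of_nat ?p :: 'p padic_int fps"
  obtain g where "f - 1 = ?q ^ Suc k * g"
    using assms by (rule dvdE)
  then have f: "f = 1 + ?q ^ Suc k * g"
    by (simp add: algebra_simps)
  define y where "y = ?q ^ Suc k * g"
  have "?q ^ Suc (Suc k) dvd padic_phi (padic_fps_norm f) - f ^ ?p"
    using f by (intro padic_fps_norm_cong_power[of f 1 "Suc k" g]) simp
  moreover have "?q ^ Suc (Suc k) dvd f ^ ?p - 1"
  proof -
    have "f ^ ?p - 1 = y ^ ?p + ?q * (y * (1 + y * binomial_tail ?p y))"
      using prime_power_binomial[OF prime_CARD[where 'p='p], of y] by (simp add: f y_def)
    also have "y ^ ?p = ?q ^ (Suc k * ?p) * g ^ ?p"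
      by (simp only: y_def power_mult_distrib power_mult)
    also have "?q ^ Suc (Suc k) dvd ?q ^ (Suc k * ?p) * g ^ ?p + ?q * (y * (1 + y * binomial_tail ?p y))"
    proof (rule dvd_add)
      \<comment> \<open>The term y^p carries p with exponent (k+1)p \<ge> 2(k+1) \<ge> k+2.\<close>
      have "Suc k * 2 \<le> Suc k * ?p"
        using CARD_gt_1[where 'p='p] by (intro mult_le_mono2) simp
      then show "?q ^ Suc (Suc k) dvd ?q ^ (Suc k * ?p) * g ^ ?p"
        by (intro dvd_mult2 le_imp_power_dvd) simp
      show "?q ^ Suc (Suc k) dvd ?q * (y * (1 + y * binomial_tail ?p y))"
        unfolding y_def by (simp add: mult_dvd_mono mult.assoc)
    qed
    finally show ?thesis .
  qed
  ultimately have "?q ^ Suc (Suc k) dvd (padic_phi (padic_fps_norm f) - f ^ ?p) + (f ^ ?p - 1)"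
    by (rule dvd_add)
  then have "?q ^ Suc (Suc k) dvd padic_phi (padic_fps_norm f - 1)"
    by (simp add: hom_distribs)
  then show ?thesis
    by (rule padic_phi_dvd_cancel)
qed

text \<open>A unit and its norm agree modulo p, so their ratio is 1 modulo p; every further norm
  acts on the ratio and gains a factor p.\<close>

lemma padic_fps_norm_iterate_step:
  fixes f :: "'p padic_int fps"
  assumes "f dvd 1"
  shows "\<exists>e. of_nat CARD('p) ^ Suc k dvd e - 1 \<and>
    (padic_fps_norm ^^ Suc k) f = (padic_fps_norm ^^ k) f * e"
proof (induction k)
  case 0
  obtain g where g: "1 = f * g"
    using assms by (rule dvdE)
  have "padic_fps_norm f = (f * g) * padic_fps_norm f"
    by (simp flip: g)
  then have "padic_fps_norm f = f * (g * padic_fps_norm f)"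
    by (simp add: mult.assoc)
  moreover have "g * padic_fps_norm f - 1 = g * (padic_fps_norm f - f)"
    by (simp add: g algebra_simps)
  then have "of_nat CARD('p) dvd g * padic_fps_norm f - 1"
    using padic_fps_norm_cong[of f] by simp
  ultimately show ?case
    by auto
next
  case (Suc k)
  then obtain e where e: "of_nat CARD('p) ^ Suc k dvd e - 1"
    "(padic_fps_norm ^^ Suc k) f = (padic_fps_norm ^^ k) f * e"
    by blast
  have "(padic_fps_norm ^^ Suc (Suc k)) f = (padic_fps_norm ^^ Suc k) f * padic_fps_norm e"
    using e(2) padic_fps_norm_mult[OF \<xi>, of "(padic_fps_norm ^^ k) f" e] by simp
  then show ?case
    using padic_fps_norm_cong_1[OF e(1)] by blast
qed

lemma padic_fps_norm_iterate_cong: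
  fixes f :: "'p padic_int fps"
  assumes f: "f dvd 1" and km: "k \<le> m"
  shows "of_nat CARD('p) ^ Suc k dvd (padic_fps_norm ^^ m) f - (padic_fps_norm ^^ k) f"
  using km
proof (induction m rule: dec_induct)
  case (step m)
  obtain e where e: "of_nat CARD('p) ^ Suc m dvd e - 1"
    "(padic_fps_norm ^^ Suc m) f = (padic_fps_norm ^^ m) f * e"
    using padic_fps_norm_iterate_step[OF f] by blast
  have "of_nat CARD('p) ^ Suc k dvd (padic_fps_norm ^^ m) f * (e - 1)"
    using e(1) step.hyps by (intro dvd_mult) (meson dvd_trans le_imp_power_dvd Suc_le_mono)
  then have "of_nat CARD('p) ^ Suc k dvd ((padic_fps_norm ^^ m) f - (padic_fps_norm ^^ k) f)
      + (padic_fps_norm ^^ m) f * (e - 1)"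
    using step.IH by (rule dvd_add[rotated])
  then show ?case
    unfolding e(2) by (simp add: algebra_simps)
qed simp

end

text \<open>Compactness of Z_p[[T]]: every residue of every coefficient takes finitely many values,
  so a diagonal subsequence makes each of them eventually constant. Pairs of coefficient index and
  precision are coded by one number.\<close>

lemma padic_fps_sequentially_compact:
  fixes g :: "nat \<Rightarrow> 'p::prime_card padic_int fps"
  shows "\<exists>r h. strict_mono r \<and> (\<forall>M. \<forall>\<^sub>F m in sequentially. \<forall>j<M. padic_p ^ M dvd (g (r m) - h) $ j)"
proof -
  define Q where "Q c m = padic_res (g m $ fst (prod_decode c)) (snd (prod_decode c))" for c m :: nat
  interpret subseqs "\<lambda>c s. \<forall>i j. Q c (s i) = Q c (s j)"
  proof
    fix c and s :: "nat \<Rightarrow> nat"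
    assume "strict_mono s"
    let ?B = "{0..<int CARD('p) ^ snd (prod_decode c)}"
    have "(Q c \<circ> s) ` UNIV \<subseteq> ?B"
      using padic_res_bounds by (auto simp: Q_def)
    then have "finite ((Q c \<circ> s) ` UNIV)"
      using finite_subset by blast
    from pigeonhole_infinite[OF infinite_UNIV_nat this]
    obtain a where "infinite {i \<in> UNIV. (Q c \<circ> s) i = (Q c \<circ> s) a}"
      by blast
    from infinite_enumerate[OF this]
    obtain r :: "nat \<Rightarrow> nat" where "strict_mono r" "\<forall>i. r i \<in> {i \<in> UNIV. (Q c \<circ> s) i = (Q c \<circ> s) a}"
      by blast
    then show "\<exists>r' :: nat \<Rightarrow> nat. strict_mono r' \<and> (\<forall>i j. Q c ((s \<circ> r') i) = Q c ((s \<circ> r') j))"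
      by (auto intro!: exI[of _ r])
  qed
  have diag: "Q c (diagseq (Suc c + i)) = Q c (diagseq (Suc c + j))" for c i j
    using diagseq_holds[of c] by simp
  have const: "padic_res (g (diagseq m) $ j) k = padic_res (g (diagseq m') $ j) k"
    if "m \<ge> Suc (prod_encode (j, k))" "m' \<ge> Suc (prod_encode (j, k))" for m m' j k
    using diag[of "prod_encode (j, k)" "m - Suc (prod_encode (j, k))" "m' - Suc (prod_encode (j, k))"] that
    by (simp add: Q_def prod_encode_inverse)
  \<comment> \<open>Cumulative thresholds: both \<open>L j k\<close> and \<open>L j (Suc k)\<close>
    lie beyond the point where residues of precision \<open>k\<close> are constant, so the selected
    terms are compatible.\<close>
  define L where "L j k = (\<Sum>l\<le>k. Suc (prod_encode (j, l)))" for j k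
  have L: "Suc (prod_encode (j, k)) \<le> L j k" "Suc (prod_encode (j, k)) \<le> L j (Suc k)" for j k
    unfolding L_def by (rule member_le_sum; simp)+
  define s where "s j = (SOME s. \<forall>k. padic_p ^ k dvd s - g (diagseq (L j k)) $ j)" for j
  have s: "\<forall>k. padic_p ^ k dvd s j - g (diagseq (L j k)) $ j" for j
  proof -
    have "\<exists>s. \<forall>k. padic_p ^ k dvd s - g (diagseq (L j k)) $ j"
      using L const by (intro padic_complete) (simp flip: padic_res_eq_iff)
    then show ?thesis
      unfolding s_def by (rule someI_ex)
  qed
  have "\<forall>\<^sub>F m in sequentially. \<forall>j<M. padic_p ^ M dvd (g (diagseq m) - Abs_fps s) $ j" for M
  proof -
    have "\<forall>\<^sub>F m in sequentially. padic_p ^ M dvd (g (diagseq m) - Abs_fps s) $ j" for j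
    proof (rule eventually_sequentiallyI[of "Suc (prod_encode (j, M))"])
      fix m assume "Suc (prod_encode (j, M)) \<le> m"
      then have "padic_p ^ M dvd g (diagseq m) $ j - g (diagseq (L j M)) $ j"
        using const[of j M m "L j M"] L by (simp flip: padic_res_eq_iff)
      then have "padic_p ^ M dvd (g (diagseq m) $ j - g (diagseq (L j M)) $ j) - (s j - g (diagseq (L j M)) $ j)"
        by (rule dvd_diff) (use s in blast)
      then show "padic_p ^ M dvd (g (diagseq m) - Abs_fps s) $ j"
        by simp
    qed
    then have "\<forall>\<^sub>F m in sequentially. \<forall>j\<in>{..<M}. padic_p ^ M dvd (g (diagseq m) - Abs_fps s) $ j"
      by (intro eventually_ball_finite) auto
    then show ?thesis
      by (rule eventually_mono) blast
  qed
  then show ?thesis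
    using subseq_diagseq by blast
qed

section \<open>Interpolation of norm-compatible units\<close>

lemma fps_prod_nth_0: "(\<Prod>i\<in>I. F i) $ 0 = (\<Prod>i\<in>I. F i $ (0 :: nat))"
  for F :: "'i \<Rightarrow> 'a::comm_ring_1 fps"
  by (induction I rule: infinite_finite_induct) simp_all

lemma fps_p_factor:
  fixes f :: "'p::prime_card padic_int fps"
  assumes "f \<noteq> 0"
  obtains k g where "f = of_nat CARD('p) ^ k * g" "\<not> of_nat CARD('p) dvd g"
proof -
  let ?q = "of_nat CARD('p) :: 'p padic_int fps"
  define K where "K = (LEAST n. \<not> ?q ^ n dvd f)"
  have "\<exists>n. \<not> ?q ^ n dvd f"
    using assms fps_p_power_dvd_all_imp_0 by blast
  then have *: "\<not> ?q ^ K dvd f"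
    unfolding K_def by (rule LeastI_ex)
  then obtain k where k: "K = Suc k"
    by (cases K) auto
  have "?q ^ k dvd f"
    using not_less_Least[of k "\<lambda>n. \<not> ?q ^ n dvd f"] k unfolding K_def by auto
  then obtain g where g: "f = ?q ^ k * g" ..
  have "\<not> ?q dvd g"
    using *[unfolded k] unfolding g power_Suc2 by (auto dest: mult_dvd_mono[OF dvd_refl])
  with g show thesis
    by (rule that)
qed

lemma padic_fps_unitI:
  fixes f :: "'a::comm_ring_1 fps"
  assumes "f $ 0 dvd 1"
  shows "f dvd 1"
proof -
  obtain y where "1 = f $ 0 * y"
    using assms by (rule dvdE)
  then have "f * fps_right_inverse f y = 1"
    by (intro fps_right_inverse) simp
  then show ?thesis
    by (metis dvd_triv_left)
qed

section \<open>Values at a number\<close>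

definition padic_value :: "'p::prime_card padic_closure \<Rightarrow> 'p padic_int fps \<Rightarrow> 'p padic_closure" where
  "padic_value x f = fps_value (fps_const x) f $ 0"

context
  fixes n and x :: "'p::prime_card padic_closure"
  assumes x: "evaluation_point n (fps_const x)"
begin

lemma comm_ring_hom_padic_value: "comm_ring_hom (padic_value x)"
  using fps_value_0[OF x] fps_value_1[OF x] fps_value_add[OF x] fps_value_mult[OF x]
  by unfold_locales (simp_all add: padic_value_def)

lemma fps_evaluates_padic_value: "fps_evaluates f x (padic_value x f)"
  unfolding padic_value_def using fps_has_value_fps_value[OF x] by (rule fps_has_value_evaluates)

lemma padic_value_cyclo_ints: "padic_value x f \<in> cyclo_ints (Suc n)"
  unfolding padic_value_def by (rule fps_value_cyclo_ints[OF x])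

lemma padic_value_integral: "padic_integral (padic_value x f)"
  using padic_value_cyclo_ints by (simp add: cyclo_ints_def)

lemma padic_value_const: "padic_value x (fps_const a) = of_padic_int a"
  by (simp add: padic_value_def fps_value_const[OF x])

lemma padic_value_X: "padic_value x fps_X = x"
  by (simp add: padic_value_def fps_value_X[OF x])

lemma padic_value_fps_of_poly: "padic_value x (fps_of_poly h) = padic_poly h x"
proof -
  interpret v: comm_ring_hom "padic_value x"
    by (rule comm_ring_hom_padic_value)
  show ?thesis
    by (induction h) (simp_all add: fps_of_poly_pCons hom_distribs padic_value_const padic_value_X mult.commute)
qed

lemma padic_value_small:
  assumes "of_nat CARD('p) ^ k dvd f"
  shows "padic_small k (padic_value x f)"
proof -
  interpret v: comm_ring_hom "padic_value x"
    by (rule comm_ring_hom_padic_value)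
  obtain g where "f = of_nat CARD('p) ^ k * g"
    using assms by (rule dvdE)
  then show ?thesis
    unfolding padic_small_iff
    by (intro exI[of _ "padic_value x g"]) (simp add: hom_distribs padic_value_integral)
qed

text \<open>Continuity for the weak topology: low coefficients of the difference contribute
  multiples of a power of p, high ones multiples of a power of \<open>x\<close>.\<close>

lemma padic_value_tendsto:
  assumes "\<And>M. \<forall>\<^sub>F m in sequentially. \<forall>j<M. padic_p ^ M dvd (g m - h) $ j"
  shows "padic_tendsto (\<lambda>m. padic_value x (g m)) (padic_value x h)"
  unfolding padic_tendsto_small_iff
proof
  fix k
  interpret v: comm_ring_hom "padic_value x"
    by (rule comm_ring_hom_padic_value)
  obtain K where K: "\<forall>M\<ge>K. fps_small k (fps_const x ^ M)"
    using evaluation_point_power_small[OF x] by blast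
  define M where "M = max k K"
  have "fps_small k (fps_const (x ^ M))"
    using K by (simp add: M_def fps_const_power)
  then have small: "padic_small k (x ^ M)"
    unfolding fps_small_def by (metis fps_nth_fps_const zero_le)
  have "\<forall>\<^sub>F m in sequentially. \<forall>j<M. padic_p ^ M dvd (g m - h) $ j"
    by (rule assms)
  then show "\<forall>\<^sub>F m in sequentially. padic_small k (padic_value x (g m) - padic_value x h)"
  proof (rule eventually_mono)
    fix m assume *: "\<forall>j<M. padic_p ^ M dvd (g m - h) $ j"
    define s where "s = (\<Sum>j<M. fps_const ((g m - h) $ j) * fps_X ^ j)"
    have "of_nat CARD('p) ^ M dvd s"
      unfolding s_def
    proof (intro dvd_sum dvd_mult2)
      fix j assume "j \<in> {..<M}"
      then have "padic_p ^ M dvd (g m - h) $ j"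
        using * by blast
      then show "of_nat CARD('p) ^ M dvd fps_const ((g m - h) $ j)"
        unfolding fps_p_power_dvd_iff by simp
    qed
    then have "padic_small M (padic_value x s)"
      by (rule padic_value_small)
    then have s: "padic_small k (padic_value x s)"
      by (rule padic_small_mono) (simp add: M_def)
    have "g m - h = s + fps_X ^ M * fps_shift M (g m - h)"
      unfolding s_def by (rule fps_cutoff_decomp)
    then have "padic_value x (g m) - padic_value x h = padic_value x s + x ^ M * padic_value x (fps_shift M (g m - h))"
      by (metis v.hom_minus v.hom_add v.hom_mult v.hom_power padic_value_X)
    then show "padic_small k (padic_value x (g m) - padic_value x h)"
      using s small padic_value_integral by (simp add: padic_small_mult_left)
  qed
qed

text \<open>The value and the constant term differ by a multiple of the topologically nilpotent
  \<open>x\<close>. If p divided the constant term, the value would be topologically nilpotent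
  too.\<close>

lemma padic_value_unit_imp_dvd_1:
  assumes "padic_topnil x" "padic_unit (padic_value x f)"
  shows "f dvd 1"
proof (rule padic_fps_unitI, unfold padic_unit_iff, rule notI)
  interpret v: comm_ring_hom "padic_value x"
    by (rule comm_ring_hom_padic_value)
  assume "padic_p dvd f $ 0"
  then obtain b where b: "f $ 0 = padic_p * b" ..
  have "f = fps_const (f $ 0) + fps_X * fps_shift 1 f"
    by (rule fps_ext) simp
  then have "padic_value x f = of_padic_int (f $ 0) + x * padic_value x (fps_shift 1 f)"
    by (metis v.hom_add v.hom_mult padic_value_X padic_value_const)
  also have "\<dots> = x * padic_value x (fps_shift 1 f) + closure_p * of_padic_int b"
    by (simp add: b hom_distribs)
  finally have "padic_topnil (padic_value x f)"
    using assms(1) by (simp add: padic_topnil_add_p padic_topnil_mult padic_value_integral)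
  then show False
    using assms(2) not_padic_unit_topnil by blast
qed

end

section \<open>Values along the tower of roots of unity\<close>

locale cyclotomic_tower =
  fixes \<xi> :: "nat \<Rightarrow> 'p::prime_card padic_closure"
  assumes prim: "n \<ge> 1 \<Longrightarrow> primitive_root_of_unity (CARD('p) ^ n) (\<xi> n)"
    and tower: "n \<ge> 1 \<Longrightarrow> \<xi> (Suc n) ^ CARD('p) = \<xi> n"
begin

lemma prim_Suc: "primitive_root_of_unity (CARD('p) ^ Suc n) (\<xi> (Suc n))"
  by (rule prim) simp

lemma prim_1: "primitive_root_of_unity CARD('p) (\<xi> 1)"
  using prim[of 1] by simp

lemma evaluation_point_root_of_unity:
  fixes \<zeta> :: "'p padic_closure"
  assumes "\<zeta> ^ (CARD('p) ^ Suc n) = 1"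
  shows "evaluation_point n (fps_const (\<zeta> - 1))"
  unfolding evaluation_point_def
  using prim_Suc[of n] cyclo_ints_root_of_unity[OF assms] padic_topnil_root_of_unity[OF assms]
  by (auto simp: cyclo_ints_closed)

lemma evaluation_point_xi: "evaluation_point n (fps_const (\<xi> (Suc n) - 1))"
  by (rule evaluation_point_root_of_unity) (rule primitive_root_of_unityD[OF prim_Suc])

lemma topnil_xi: "padic_topnil (\<xi> (Suc n) - 1)"
  by (rule padic_topnil_root_of_unity) (rule primitive_root_of_unityD[OF prim_Suc])

text \<open>The index is shifted so that levels start at 0: the values of
  \<open>tower_value n\<close> lie in the field of level \<open>Suc n\<close>.\<close>

definition tower_value :: "nat \<Rightarrow> 'p padic_int fps \<Rightarrow> 'p padic_closure" where
  "tower_value n = padic_value (\<xi> (Suc n) - 1)"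

lemma comm_ring_hom_tower_value: "comm_ring_hom (tower_value n)"
  unfolding tower_value_def by (rule comm_ring_hom_padic_value[OF evaluation_point_xi])

text \<open>Apply the product formula at the constant A = \<zeta> - 1 with \<zeta> of the upper
  level: the points \<eta>(1+A)-1 are its conjugates over the lower field, and (1+A)^p - 1 is the
  uniformizer one level below.\<close>

lemma field_norm_tower_value:
  "field_norm (cyclo_field (Suc n)) (cyclo_field (Suc (Suc n))) (tower_value (Suc n) f) =
    tower_value n (padic_fps_norm f)"
proof -
  let ?\<zeta> = "\<xi> (Suc (Suc n))"
  let ?A = "fps_const (?\<zeta> - 1)"
  define y where "y \<eta> = padic_value (\<eta> * ?\<zeta> - 1) f" for \<eta>
  have \<zeta>p: "?\<zeta> ^ CARD('p) = \<xi> (Suc n)"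
    by (rule tower) simp
  have point: "evaluation_point (Suc n) (fps_const (\<eta> * ?\<zeta> - 1))" if "\<eta> ^ CARD('p) = 1" for \<eta>
    using that primitive_root_of_unityD(1)[OF prim_Suc, of "Suc n"]
    by (intro evaluation_point_root_of_unity) (simp add: power_mult_distrib power_mult)
  have A\<eta>: "fps_const \<eta> * (1 + ?A) - 1 = fps_const (\<eta> * ?\<zeta> - 1)" for \<eta>
    by (simp flip: fps_const_sub fps_const_mult)
  have B: "(1 + ?A) ^ CARD('p) - 1 = fps_const (\<xi> (Suc n) - 1)"
    by (simp add: fps_const_power \<zeta>p flip: fps_const_sub)
  have "tower_value n (padic_fps_norm f) = fps_value ((1 + ?A) ^ CARD('p) - 1) (padic_fps_norm f) $ 0"
    by (simp add: tower_value_def padic_value_def B)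
  also have "fps_value ((1 + ?A) ^ CARD('p) - 1) (padic_fps_norm f) =
      (\<Prod>\<eta> | \<eta> ^ CARD('p) = 1. fps_value (fps_const \<eta> * (1 + ?A) - 1) f)"
  proof (rule fps_value_padic_fps_norm[OF prim_1])
    show "padic_topnil (?A $ 0)"
      by (simp add: topnil_xi)
    show "evaluation_point (Suc n) (fps_const \<eta> * (1 + ?A) - 1)" if "\<eta> ^ CARD('p) = 1" for \<eta>
      unfolding A\<eta> by (rule point[OF that])
    show "evaluation_point n ((1 + ?A) ^ CARD('p) - 1)"
      unfolding B by (rule evaluation_point_xi)
  qed
  also have "(\<Prod>\<eta> | \<eta> ^ CARD('p) = 1. fps_value (fps_const \<eta> * (1 + ?A) - 1) f) $ 0 =
      (\<Prod>\<eta> | \<eta> ^ CARD('p) = 1. y \<eta>)"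
    unfolding fps_prod_nth_0 A\<eta> by (simp add: y_def padic_value_def)
  also have "\<dots> = field_norm (cyclo_field (Suc n)) (cyclo_field (Suc (Suc n))) (y 1)"
  proof (rule field_norm_fps_evaluates[OF prim_Suc, symmetric])
    show "primitive_root_of_unity (CARD('p) ^ Suc n) (?\<zeta> ^ CARD('p))"
      unfolding \<zeta>p by (rule prim_Suc)
    show "fps_evaluates f (\<eta> * ?\<zeta> - 1) (y \<eta>)" if "\<eta> ^ CARD('p) = 1" for \<eta>
      unfolding y_def by (rule fps_evaluates_padic_value[OF point[OF that]])
    show "y 1 \<in> cyclo_field (Suc (Suc n))"
      using padic_value_cyclo_ints[OF point[of 1], of f] by (simp add: y_def cyclo_ints_def)
  qed
  finally show ?thesis
    by (simp add: y_def tower_value_def)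
qed

text \<open>Once p is divided out, the difference has a first coefficient prime to p, at index
  \<open>i\<close>. At a level of ramification degree above \<open>i\<close>, vanishing of the value
  would force p to divide that coefficient.\<close>

lemma tower_value_inj:
  assumes "\<And>n. tower_value n f = tower_value n g"
  shows "f = g"
proof (rule ccontr)
  assume "f \<noteq> g"
  then have "f - g \<noteq> 0"
    by simp
  then obtain k h where h: "f - g = of_nat CARD('p) ^ k * h" "\<not> of_nat CARD('p) dvd h"
    by (rule fps_p_factor)
  have "\<exists>i. \<not> padic_p dvd h $ i"
    using h(2) fps_p_power_dvd_iff[of 1 h] by auto
  define i where "i = (LEAST i. \<not> padic_p dvd h $ i)"
  have i: "\<not> padic_p dvd h $ i"
    unfolding i_def using \<open>\<exists>i. \<not> padic_p dvd h $ i\<close> by (rule LeastI_ex)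
  have less: "padic_p dvd h $ j" if "j < i" for j
    using not_less_Least[of j "\<lambda>i. \<not> padic_p dvd h $ i"] that unfolding i_def by blast
  \<comment> \<open>Level \<open>i\<close> is deep enough, since i < p^i \<le> p^i (p - 1).\<close>
  define d where "d = CARD('p) ^ i * (CARD('p) - 1)"
  define x where "x = \<xi> (Suc i) - 1"
  have "i < CARD('p) ^ i"
    using CARD_gt_1[where 'p='p] by (intro power_gt_expt) simp
  also have "\<dots> \<le> d"
    using CARD_gt_1[where 'p='p] by (simp add: d_def)
  finally have "i < d" .
  have x: "padic_uniformizer d x"
    unfolding d_def x_def by (rule padic_uniformizer_root_of_unity[OF primitive_root_of_unityD[OF prim_Suc]])
  interpret v: comm_ring_hom "tower_value i"
    by (rule comm_ring_hom_tower_value)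
  have "closure_p ^ k * tower_value i h = tower_value i (f - g)"
    unfolding h(1) by (simp add: hom_distribs)
  also have "\<dots> = 0"
    using assms[of i] by (simp add: hom_distribs)
  finally have "tower_value i h = 0"
    by simp
  then have "padic_tendsto (\<lambda>N. \<Sum>k<N. of_padic_int (h $ k) * x ^ k) 0"
    using fps_evaluates_padic_value[OF evaluation_point_xi[of i], of h]
    by (simp add: fps_evaluates_def padic_sums_def tower_value_def x_def)
  then have "\<forall>\<^sub>F N in sequentially. padic_small 1 ((\<Sum>k<N. of_padic_int (h $ k) * x ^ k) - 0) \<and> i < N"
    unfolding padic_tendsto_small_iff by (intro eventually_conj eventually_gt_at_top) auto
  then obtain N where N: "padic_small 1 (\<Sum>k<N. of_padic_int (h $ k) * x ^ k)" "i < N"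
    by (auto simp: eventually_sequentially)
  have "padic_p dvd h $ i"
    using x N(1) \<open>i < d\<close> N(2) by (rule padic_uniformizer_small_sum)
  with i show False ..
qed

text \<open>Extensional on the indices from 1 on, as elements of
  \<open>norm_compatible_units\<close> are; the subtraction undoes the level shift of
  \<open>tower_value\<close>.\<close>

definition tower_sequence :: "'p padic_int fps \<Rightarrow> nat \<Rightarrow> 'p padic_closure" where
  "tower_sequence f = (\<lambda>n\<in>{1..}. tower_value (n - 1) f)"

lemma tower_sequence_eq_iff:
  assumes "u \<in> extensional {1..}"
  shows "tower_sequence f = u \<longleftrightarrow> (\<forall>n\<ge>1. fps_evaluates f (\<xi> n - 1) (u n))"
proof -
  have ev: "fps_evaluates f (\<xi> n - 1) (tower_sequence f n)" if "n \<ge> 1" for n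
    using that fps_evaluates_padic_value[OF evaluation_point_xi[of "n - 1"], of f]
    by (simp add: tower_sequence_def tower_value_def)
  show ?thesis
  proof
    assume *: "\<forall>n\<ge>1. fps_evaluates f (\<xi> n - 1) (u n)"
    show "tower_sequence f = u"
    proof (rule extensionalityI[of _ "{1..}"])
      show "tower_sequence f n = u n" if "n \<in> {1..}" for n
        using that fps_evaluates_unique[OF ev] * by auto
    qed (use assms in \<open>simp_all add: tower_sequence_def\<close>)
  qed (use ev in auto)
qed

lemma norm_fixed_units_carrier:
  fixes f :: "'p padic_int fps"
  shows "f \<in> carrier norm_fixed_units \<longleftrightarrow> f dvd 1 \<and> padic_fps_norm f = f"
  by (simp add: norm_fixed_units_def norm_operator_eq_padic_fps_norm[OF prim_1])

lemma tower_sequence_carrier: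
  assumes f: "f \<in> carrier norm_fixed_units"
  shows "tower_sequence f \<in> carrier norm_compatible_units"
proof -
  obtain g where g: "1 = f * g"
    using f norm_fixed_units_carrier by (auto elim: dvdE)
  have units: "tower_value n f \<in> cyclo_units (Suc n)" for n
  proof -
    interpret v: comm_ring_hom "tower_value n"
      by (rule comm_ring_hom_tower_value)
    have "tower_value n f * tower_value n g = 1"
      by (simp flip: v.hom_mult g)
    then have "padic_unit (tower_value n f)"
      unfolding tower_value_def
      by (rule padic_unitI) (rule padic_value_integral[OF evaluation_point_xi])+
    then show ?thesis
      using padic_value_cyclo_ints[OF evaluation_point_xi, of n f]
      by (simp add: cyclo_units_def padic_unit_def cyclo_ints_def tower_value_def)
  qed
  have "field_norm (cyclo_field n) (cyclo_field (Suc n)) (tower_sequence f (Suc n)) = tower_sequence f n"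
    if "n \<ge> 1" for n
    using that f field_norm_tower_value[of "n - 1" f]
    by (simp add: tower_sequence_def norm_fixed_units_carrier)
  moreover have "tower_sequence f \<in> (\<Pi>\<^sub>E n\<in>{1..}. cyclo_units n)"
    unfolding tower_sequence_def
  proof (intro restrict_PiE[THEN iffD2] funcsetI Pi_I)
    fix n :: nat assume "n \<in> {1..}"
    then show "tower_value (n - 1) f \<in> cyclo_units n"
      using units[of "n - 1"] by simp
  qed
  ultimately show ?thesis
    by (simp add: norm_compatible_units_def)
qed

text \<open>Integers of a given level are polynomials in its uniformizer, so a polynomial already
  attains one prescribed value; it is a unit as a series because that value is a unit.\<close>

lemma tower_value_lift:
  assumes u: "u \<in> carrier norm_compatible_units"
  shows "\<exists>f. f dvd 1 \<and> tower_value n f = u (Suc n)"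
proof -
  have "u (Suc n) \<in> cyclo_units (Suc n)"
    using u by (auto simp: norm_compatible_units_def)
  then have unit: "padic_unit (u (Suc n))" and "u (Suc n) \<in> cyclo_ints (Suc n)"
    by (auto simp: cyclo_units_def padic_unit_def cyclo_ints_def)
  then obtain h where h: "u (Suc n) = padic_poly h (\<xi> (Suc n) - 1)"
    by (auto elim: cyclo_ints_cases[OF prim_Suc])
  then have "tower_value n (fps_of_poly h) = u (Suc n)"
    by (simp add: tower_value_def padic_value_fps_of_poly[OF evaluation_point_xi])
  moreover from this have "padic_unit (padic_value (\<xi> (Suc n) - 1) (fps_of_poly h))"
    using unit by (simp add: tower_value_def)
  then have "fps_of_poly h dvd 1"
    by (rule padic_value_unit_imp_dvd_1[OF evaluation_point_xi topnil_xi])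
  ultimately show ?thesis
    by blast
qed

text \<open>One application of the norm operator descends one level through the field norm, and
  \<open>u\<close> is compatible with field norms.\<close>

lemma tower_value_norm_iterate:
  assumes u: "u \<in> carrier norm_compatible_units" and f: "tower_value (n + k) f = u (Suc (n + k))"
  shows "tower_value n ((padic_fps_norm ^^ k) f) = u (Suc n)"
  using f
proof (induction k arbitrary: f)
  case (Suc k)
  have "tower_value (n + k) (padic_fps_norm f) =
      field_norm (cyclo_field (Suc (n + k))) (cyclo_field (Suc (Suc (n + k)))) (u (Suc (Suc (n + k))))"
    using field_norm_tower_value[of "n + k" f] Suc.prems by simp
  also have "\<dots> = u (Suc (n + k))"
    using u by (simp add: norm_compatible_units_def)
  finally have "tower_value n ((padic_fps_norm ^^ k) (padic_fps_norm f)) = u (Suc n)"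
    by (rule Suc.IH)
  then show ?case
    by (simp only: funpow_Suc_right o_def)
qed simp

text \<open>With \<open>f m\<close> lifting the \<open>2 m\<close>-th term, \<open>g m\<close> is the \<open>m\<close>-fold norm of \<open>f m\<close>. At the \<open>n\<close>-th level it agrees with \<open>u\<close>
  modulo \<open>p ^ (m + 1)\<close>, since taking further norms does not change it modulo that power.\<close>

lemma tower_sequence_surj:
  assumes u: "u \<in> carrier norm_compatible_units"
  shows "\<exists>f\<in>carrier norm_fixed_units. tower_sequence f = u"
proof -
  have "\<exists>f. f dvd 1 \<and> tower_value (2 * m) f = u (Suc (2 * m))" for m
    by (rule tower_value_lift[OF u])
  then obtain f where f: "\<And>m. f m dvd 1" "\<And>m. tower_value (2 * m) (f m) = u (Suc (2 * m))"
    by metis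
  define g where "g m = (padic_fps_norm ^^ m) (f m)" for m
  have g: "padic_small (Suc m) (tower_value n (g m) - u (Suc n))" if "n \<le> m" for n m
  proof -
    interpret v: comm_ring_hom "tower_value n"
      by (rule comm_ring_hom_tower_value)
    have "tower_value n ((padic_fps_norm ^^ (2 * m - n)) (f m)) = u (Suc n)"
      using that f(2)[of m] by (intro tower_value_norm_iterate[OF u]) simp
    moreover have "of_nat CARD('p) ^ Suc m dvd (padic_fps_norm ^^ (2 * m - n)) (f m) - g m"
      unfolding g_def using that by (intro padic_fps_norm_iterate_cong[OF prim_1] f) simp
    then have "padic_small (Suc m) (tower_value n ((padic_fps_norm ^^ (2 * m - n)) (f m) - g m))"
      unfolding tower_value_def by (rule padic_value_small[OF evaluation_point_xi])
    ultimately have "padic_small (Suc m) (u (Suc n) - tower_value n (g m))"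
      by (simp add: hom_distribs)
    then show ?thesis
      using padic_small_uminus by fastforce
  qed
  obtain r h where r: "strict_mono r"
    "\<And>M. \<forall>\<^sub>F m in sequentially. \<forall>j<M. padic_p ^ M dvd (g (r m) - h) $ j"
    using padic_fps_sequentially_compact[of g] by blast
  have h: "tower_value n h = u (Suc n)" for n
  proof (rule padic_tendsto_unique)
    show "padic_tendsto (\<lambda>m. tower_value n (g (r m))) (tower_value n h)"
      unfolding tower_value_def using r(2) by (rule padic_value_tendsto[OF evaluation_point_xi])
    show "padic_tendsto (\<lambda>m. tower_value n (g (r m))) (u (Suc n))"
      unfolding padic_tendsto_small_iff
    proof
      fix k
      show "\<forall>\<^sub>F m in sequentially. padic_small k (tower_value n (g (r m)) - u (Suc n))"
      proof (rule eventually_sequentiallyI[of "max n k"])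
        fix m assume m: "max n k \<le> m"
        then have "max n k \<le> r m"
          using seq_suble[OF r(1), of m] by linarith
        then show "padic_small k (tower_value n (g (r m)) - u (Suc n))"
          using padic_small_mono[OF g[of n "r m"], of k] by simp
      qed
    qed
  qed
  have "padic_unit (tower_value 0 h)"
    using u unfolding h by (auto simp: norm_compatible_units_def cyclo_units_def padic_unit_def)
  then have "h dvd 1"
    using padic_value_unit_imp_dvd_1[OF evaluation_point_xi topnil_xi] by (simp add: tower_value_def)
  moreover have "tower_value n (padic_fps_norm h) = tower_value n h" for n
  proof -
    have "tower_value n (padic_fps_norm h) =
        field_norm (cyclo_field (Suc n)) (cyclo_field (Suc (Suc n))) (u (Suc (Suc n)))"
      using field_norm_tower_value[of n h] by (simp add: h)
    also have "\<dots> = u (Suc n)"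
      using u by (simp add: norm_compatible_units_def)
    finally show ?thesis
      by (simp add: h)
  qed
  then have "padic_fps_norm h = h"
    by (rule tower_value_inj)
  ultimately have "h \<in> carrier norm_fixed_units"
    by (simp add: norm_fixed_units_carrier)
  moreover have "tower_sequence h = u"
  proof (rule extensionalityI[of _ "{1..}"])
    show "u \<in> extensional {1..}"
      using u by (auto simp: norm_compatible_units_def PiE_def)
    show "tower_sequence h n = u n" if "n \<in> {1..}" for n
      using that h[of "n - 1"] by (simp add: tower_sequence_def)
  qed (simp add: tower_sequence_def)
  ultimately show ?thesis
    by blast
qed

lemma tower_sequence_inj: "tower_sequence f = tower_sequence g \<longleftrightarrow> f = g"
proof
  assume "tower_sequence f = tower_sequence g"
  then have "tower_sequence f (Suc n) = tower_sequence g (Suc n)" for n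
    by simp
  then show "f = g"
    by (intro tower_value_inj) (simp add: tower_sequence_def)
qed simp

lemma tower_sequence_mult:
  "tower_sequence (f * g) = monoid.mult norm_compatible_units (tower_sequence f) (tower_sequence g)"
proof -
  have "tower_value n (f * g) = tower_value n f * tower_value n g" for n
    using comm_ring_hom_tower_value by (simp add: comm_ring_hom.axioms ring_hom.axioms semiring_hom.axioms
        monoid_mult_hom.axioms semigroup_mult_hom.axioms times_hom.hom_mult)
  then show ?thesis
    by (auto simp: norm_compatible_units_def tower_sequence_def)
qed

lemma bij_betw_tower_sequence:
  "bij_betw tower_sequence (carrier norm_fixed_units) (carrier norm_compatible_units)"
  unfolding bij_betw_def inj_on_def tower_sequence_inj
  using tower_sequence_carrier tower_sequence_surj by blast

end

theorem theorem10p13: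
  fixes \<xi> :: "nat \<Rightarrow> 'p::prime_card padic_closure"
  assumes "odd CARD('p)"
    and "\<And>n. n \<ge> 1 \<Longrightarrow> primitive_root_of_unity (CARD('p) ^ n) (\<xi> n)"
    and "\<And>n. n \<ge> 1 \<Longrightarrow> \<xi> (Suc n) ^ CARD('p) = \<xi> n"
  shows "\<exists>!F. F \<in> extensional (carrier norm_compatible_units) \<and>
              F \<in> iso norm_compatible_units norm_fixed_units \<and>
              (\<forall>u \<in> carrier norm_compatible_units. \<forall>n\<ge>1.
                 fps_evaluates (F u) (\<xi> n - 1) (u n))"
proof -
  interpret cyclotomic_tower \<xi>
    using assms(2,3) by unfold_locales
  let ?U = "carrier norm_compatible_units :: (nat \<Rightarrow> 'p padic_closure) set"
  let ?V = "carrier norm_fixed_units :: 'p padic_int fps set"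
  \<comment> \<open>The interpolation map is the inverse of evaluation; the restriction fixes its
    values off the carrier, as uniqueness requires.\<close>
  define F where "F = restrict (the_inv_into ?V tower_sequence) ?U"
  have ext: "u \<in> extensional {1..}" if "u \<in> ?U" for u
    using that by (auto simp: norm_compatible_units_def PiE_def)
  have F: "F u \<in> ?V" "tower_sequence (F u) = u" if "u \<in> ?U" for u
    using that bij_betw_the_inv_into[OF bij_betw_tower_sequence]
      f_the_inv_into_f_bij_betw[OF bij_betw_tower_sequence]
    by (auto simp: F_def bij_betw_def)
  have V_mult: "f * g \<in> ?V" if "f \<in> ?V" "g \<in> ?V" for f g
  proof -
    have "f * g dvd 1 * 1"
      using that unfolding norm_fixed_units_carrier by (intro mult_dvd_mono) auto
    then show ?thesis
      using that by (simp add: norm_fixed_units_carrier padic_fps_norm_mult[OF prim_1])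
  qed
  show ?thesis
  proof (rule ex1I)
    have "F \<in> hom norm_compatible_units norm_fixed_units"
    proof (rule homI)
      fix u v assume uv: "u \<in> ?U" "v \<in> ?U"
      \<comment> \<open>Closure of the norm-compatible units under products is inherited from the
        fixed units through evaluation, and injectivity of evaluation identifies the two
        series.\<close>
      have "tower_sequence (F u * F v) = monoid.mult norm_compatible_units u v"
        by (simp add: tower_sequence_mult F(2) uv)
      moreover have "tower_sequence (F u * F v) \<in> ?U"
        by (intro tower_sequence_carrier V_mult F(1) uv)
      ultimately have "monoid.mult norm_compatible_units u v \<in> ?U"
        "tower_sequence (F (monoid.mult norm_compatible_units u v)) = tower_sequence (F u * F v)"
        using F(2) by simp_all
      then show "F (monoid.mult norm_compatible_units u v) = monoid.mult norm_fixed_units (F u) (F v)"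
        unfolding tower_sequence_inj by (simp add: norm_fixed_units_def)
    qed (rule F(1))
    moreover have "bij_betw F ?U ?V"
      unfolding F_def using bij_betw_the_inv_into[OF bij_betw_tower_sequence]
      by (simp add: bij_betw_def inj_on_def)
    ultimately show "F \<in> extensional ?U \<and> F \<in> iso norm_compatible_units norm_fixed_units \<and>
        (\<forall>u\<in>?U. \<forall>n\<ge>1. fps_evaluates (F u) (\<xi> n - 1) (u n))"
      using F(2) tower_sequence_eq_iff[OF ext] by (auto simp: iso_def F_def)
  next
    fix G assume G: "G \<in> extensional ?U \<and> G \<in> iso norm_compatible_units norm_fixed_units \<and>
        (\<forall>u\<in>?U. \<forall>n\<ge>1. fps_evaluates (G u) (\<xi> n - 1) (u n))"
    show "G = F"
    proof (rule extensionalityI[of _ ?U])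
      fix u assume u: "u \<in> ?U"
      then have "tower_sequence (G u) = tower_sequence (F u)"
        using G tower_sequence_eq_iff[OF ext[OF u]] F(2) by simp
      then show "G u = F u"
        by (simp add: tower_sequence_inj)
    qed (use G in \<open>auto simp: F_def\<close>)
  qed
qed

end
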